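(* Let $\varphi$ be an increasing concave function on $[0,1]$ with $\varphi(0)=0$ and $\gamma_\varphi>0$, and let $1\le p<\infty$. The following conditions are equivalent: (a) there exists a non-trivial weight $w$ on $[0,1]$ such that the Lorentz space $\Lambda_{p,\varphi}$ is $w$-decomposable; (b) $\varphi$ is equivalent to a quasi-concave function on $[0,1]$ that is regularly varying at zero of order $p$.
   Context: $m$ is Lebesgue measure; functions are identified if they agree a.e., and $\operatorname{supp}x$ and infima/suprema of $w$ over sets are understood up to null sets. For measurable $x$ on $[0,1]$, $x^*(t)=\inf\{\lambda>0: m\{|x|>\lambda\}\le t\}$. The Lorentz space $\Lambda_{p,\varphi}$ consists of measurable $x$ on $[0,1]$ with $\|x\|_{\Lambda_{p,\varphi}}=\Big(\int_0^1[x^*(t)\varphi(t)]^p\,\frac{dt}{t}\Big)^{1/p}<\infty$ (when $0<\gamma_\varphi\le\delta_\varphi<1$ this functional is equivalent to a norm making it a symmetric space; $w$-decomposability below is understood with respect to this functional, and is insensitive to passing to an equivalent one). Dilation indices: $\gamma_\varphi=\lim_{t\to0^+}\frac{\ln\bar\varphi(t)}{\ln t}$, $\delta_\varphi=\lim_{t\to\infty}\frac{\ln\bar\varphi(t)}{\ln t}$, where $\bar\varphi(t)=\sup\{\varphi(st)/\varphi(s): s,st\in(0,1]\}$. A function $\psi:[0,1]\to[0,\infty)$ is quasi-concave if $\psi(0)=0$, $\psi$ is non-decreasing and $\psi(t)/t$ is non-increasing on $(0,1]$. It is regularly varying at zero of order $p\in[1,\infty]$ if $\lim_{t\to0^+}\psi(tu)/\psi(t)=u^{1/p}$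 for all $u>0$. Two functions are equivalent if each is bounded by a constant multiple of the other. A weight on $[0,1]$ is a measurable function that is positive and finite a.e.; it is non-trivial if $w$ or $1/w$ is unbounded. A space $X$ of functions is $w$-decomposable if there is $C>0$ such that for every $n\in\mathbb N$ and all nonzero $x_1,\dots,x_n,y_1,\dots,y_n\in X$ with $\|x_i\|_X=\|y_i\|_X$ ($1\le i\le n$) and $\inf w(\operatorname{supp}x_i\cup\operatorname{supp}y_i)\ge 2\sup w(\operatorname{supp}x_{i+1}\cup\operatorname{supp}y_{i+1})$ ($1\le i\le n-1$), one has $C^{-1}\|\sum_{i=1}^n x_i\|_X\le\|\sum_{i=1}^n y_i\|_X\le C\|\sum_{i=1}^n x_i\|_X$. *)

theory Defs
  imports "HOL-Probability.Essential_Supremum"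
begin

definition dilation_function :: "(real \<Rightarrow> real) \<Rightarrow> real \<Rightarrow> real" where
  "dilation_function \<phi> t =
     (SUP s\<in>{s. s \<in> {0<..1} \<and> s * t \<in> {0<..1}}. \<phi> (s * t) / \<phi> s)"

text \<open>
  For a concave \<open>\<phi>\<close> the supremum above is finite and the limit below exists.
  For the degenerate \<open>\<phi> = 0\<close> the index evaluates to 0.
\<close>

definition lower_dilation_index :: "(real \<Rightarrow> real) \<Rightarrow> real" where
  "lower_dilation_index \<phi> = Lim (at_right 0) (\<lambda>t. ln (dilation_function \<phi> t) / ln t)"

definition quasi_concave :: "(real \<Rightarrow> real) \<Rightarrow> bool" where
  "quasi_concave \<psi> \<longleftrightarrow>
     (\<forall>t\<in>{0..1}. 0 \<le> \<psi> t) \<and> \<psi> 0 = 0 \<and> mono_on {0..1} \<psi> \<and> antimono_on {0<..1} (\<lambda>t. \<psi> t / t)"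

definition regularly_varying_at_zero :: "(real \<Rightarrow> real) \<Rightarrow> real \<Rightarrow> bool" where
  "regularly_varying_at_zero \<psi> p \<longleftrightarrow>
     (\<forall>u>0. ((\<lambda>t. \<psi> (t * u) / \<psi> t) \<longlongrightarrow> u powr (1 / p)) (at_right 0))"

definition equivalent_on_unit :: "(real \<Rightarrow> real) \<Rightarrow> (real \<Rightarrow> real) \<Rightarrow> bool" where
  "equivalent_on_unit \<phi> \<psi> \<longleftrightarrow>
     (\<exists>C>0. \<forall>t\<in>{0..1}. \<phi> t \<le> C * \<psi> t \<and> \<psi> t \<le> C * \<phi> t)"

text \<open>Used for \<open>t > 0\<close> only, where the set is nonempty for every measurable real-valued \<open>x\<close>.\<close>

definition decreasing_rearrangement :: "(real \<Rightarrow> real) \<Rightarrow> real \<Rightarrow> real" where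
  "decreasing_rearrangement x t =
     Inf {l. 0 < l \<and> measure (lebesgue_on {0..1}) {s \<in> {0..1}. l < \<bar>x s\<bar>} \<le> t}"

definition lorentz_norm :: "real \<Rightarrow> (real \<Rightarrow> real) \<Rightarrow> (real \<Rightarrow> real) \<Rightarrow> ennreal" where
  "lorentz_norm p \<phi> x =
     (let I = \<integral>\<^sup>+ t\<in>{0<..1}. ennreal ((decreasing_rearrangement x t * \<phi> t) powr p / t) \<partial>lebesgue
      in if I = \<infinity> then \<infinity> else ennreal (enn2real I powr (1 / p)))"

definition lorentz_space :: "real \<Rightarrow> (real \<Rightarrow> real) \<Rightarrow> (real \<Rightarrow> real) set" where
  "lorentz_space p \<phi> =
     {x \<in> borel_measurable (lebesgue_on {0..1}). lorentz_norm p \<phi> x < \<infinity>}"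

definition weight :: "(real \<Rightarrow> real) \<Rightarrow> bool" where
  "weight w \<longleftrightarrow>
     w \<in> borel_measurable (lebesgue_on {0..1}) \<and> (AE t in lebesgue_on {0..1}. 0 < w t)"

definition ess_bounded_above :: "(real \<Rightarrow> real) \<Rightarrow> bool" where
  "ess_bounded_above f \<longleftrightarrow> (\<exists>K. AE t in lebesgue_on {0..1}. f t \<le> K)"

definition nontrivial_weight :: "(real \<Rightarrow> real) \<Rightarrow> bool" where
  "nontrivial_weight w \<longleftrightarrow>
     weight w \<and> (\<not> ess_bounded_above w \<or> \<not> ess_bounded_above (\<lambda>t. 1 / w t))"

definition supp :: "(real \<Rightarrow> real) \<Rightarrow> real set" where
  "supp x = {t \<in> {0..1}. x t \<noteq> 0}"

definition ess_sup_on :: "(real \<Rightarrow> real) \<Rightarrow> real set \<Rightarrow> ereal" where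
  "ess_sup_on w S = esssup (lebesgue_on S) (\<lambda>t. ereal (w t))"

definition ess_inf_on :: "(real \<Rightarrow> real) \<Rightarrow> real set \<Rightarrow> ereal" where
  "ess_inf_on w S = - esssup (lebesgue_on S) (\<lambda>t. - ereal (w t))"

definition w_decomposable ::
  "(real \<Rightarrow> real) \<Rightarrow> (real \<Rightarrow> real) set \<Rightarrow> ((real \<Rightarrow> real) \<Rightarrow> ennreal) \<Rightarrow> bool" where
  "w_decomposable w X N \<longleftrightarrow>
     (\<exists>C::real. C > 0 \<and>
       (\<forall>(n::nat) x y.
          (\<forall>i\<in>{1..n}. x i \<in> X \<and> y i \<in> X
             \<and> \<not> (AE t in lebesgue_on {0..1}. x i t = 0)
             \<and> \<not> (AE t in lebesgue_on {0..1}. y i t = 0)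
             \<and> N (x i) = N (y i)) \<longrightarrow>
          (\<forall>i\<in>{1..<n}. ess_inf_on w (supp (x i) \<union> supp (y i))
             \<ge> 2 * ess_sup_on w (supp (x (i + 1)) \<union> supp (y (i + 1)))) \<longrightarrow>
          ennreal (1 / C) * N (\<lambda>t. \<Sum>i=1..n. x i t) \<le> N (\<lambda>t. \<Sum>i=1..n. y i t)
          \<and> N (\<lambda>t. \<Sum>i=1..n. y i t) \<le> ennreal C * N (\<lambda>t. \<Sum>i=1..n. x i t)))"

end

theory Submission
  imports Defs
begin

text \<open>
  Writing \<open>\<Phi>(a) = \<integral>\<^sub>0\<^sup>a \<phi>\<^sup>p dt / t\<close>, the \<open>p\<close>-th power of the Lorentz norm of \<open>x\<close> is the integral of
  \<open>\<Phi>(m {\<bar>x\<bar>\<^sup>p > \<mu>})\<close> over \<open>\<mu> > 0\<close>, and \<open>\<Phi>\<close> is comparable to \<open>\<phi>\<^sup>p\<close> because the lower index is positive.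
  Distribution functions of disjoint summands add up, so two-sided \<open>p\<close>-additivity of the norm reduces to
  comparing \<open>\<Phi>(\<Sum>a\<^sub>i)\<close> with \<open>\<Sum>\<Phi>(a\<^sub>i)\<close> pointwise.

  If \<open>\<phi>\<close> is equivalent to a regularly varying function of order \<open>p\<close>, then \<open>\<phi>\<^sup>p\<close> is linear up to constants
  over ratios up to \<open>4\<^sup>i\<close> on a short interval \<open>[0, M\<^sub>i]\<close>, and a weight whose small values live on these
  intervals forces the \<open>i\<close>-th summand into \<open>[0, M\<^sub>i]\<close>.

  Conversely, equimeasurable indicators on \<open>n\<close> separated level sets of \<open>w\<close> may be exchanged for indicators
  of lacunary measures, which behave as in \<open>\<ell>\<^sub>p\<close>. Hence \<open>\<phi>(n a)\<^sup>p\<close> is comparable to \<open>n \<phi>(a)\<^sup>p\<close> for small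
  \<open>a\<close>, with constants independent of \<open>n\<close>. On a logarithmic scale, linear interpolation of \<open>\<phi>\<close> between nodes
  whose gaps tend to infinity then yields the regularly varying equivalent.
\<close>

section \<open>Fundamental functions\<close>

text \<open>The obstacle is that decomposability only compares two families with each other, while
  the conclusion concerns \<phi> alone. So a yardstick family is needed whose norm is known for
  every admissible \<phi>: among rapidly decreasing measures the largest one present dominates at
  each level, and the positive index, kept here in the quantitative form \<open>decay\<close>, makes
  \<open>\<phi> powr p\<close> decrease along with them. In the other direction nothing is known
  about the heights of the summands, so every estimate is made at a fixed level and then integrated.

  The growth condition obtained for \<phi> has a constant independent of n, but a threshold on a
  that depends on n, since the level sets of w may be arbitrarily small. This matches regular
  variation up to equivalence: far out on the logarithmic scale, ln(\<phi>(t) / t^(1/p)) moves by a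
  bounded amount over windows of any given length, so its average slope over growing windows tends
  to 0 while the averaging changes it only boundedly.\<close>

locale fundamental_function =
  fixes \<phi> :: "real \<Rightarrow> real" and p K \<gamma> :: real
  assumes p_ge_1: "1 \<le> p" and K_pos: "0 < K" and \<gamma>_pos: "0 < \<gamma>"
    and mono: "0 \<le> s \<Longrightarrow> s \<le> t \<Longrightarrow> t \<le> 1 \<Longrightarrow> \<phi> s \<le> \<phi> t"
    and zero: "\<phi> 0 = 0"
    and pos: "0 < t \<Longrightarrow> t \<le> 1 \<Longrightarrow> 0 < \<phi> t"
    and quotient_antimono: "0 < s \<Longrightarrow> s \<le> t \<Longrightarrow> t \<le> 1 \<Longrightarrow> \<phi> t / t \<le> \<phi> s / s"
    and decay: "0 < s \<Longrightarrow> s \<le> t \<Longrightarrow> t \<le> 1 \<Longrightarrow> \<phi> s \<le> K * (s / t) powr \<gamma> * \<phi> t"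
begin

text \<open>Extended-valued because finiteness is only proved in \<open>primitive_upper\<close>;
  afterwards \<open>prim\<close> takes over. The right end is open since the layer cake formula
  meets it through the strict inequality \<open>t < distribution x l\<close>.\<close>

definition primitive :: "real \<Rightarrow> ennreal" where
  "primitive a = (\<integral>\<^sup>+ t. ennreal (\<phi> t powr p / t) * indicator {0<..<a} t \<partial>lborel)"

lemma nonneg: "0 \<le> t \<Longrightarrow> t \<le> 1 \<Longrightarrow> 0 \<le> \<phi> t"
  using pos[of t] zero by (cases "t = 0") auto

lemma powr_mono_on: "0 \<le> s \<Longrightarrow> s \<le> t \<Longrightarrow> t \<le> 1 \<Longrightarrow> \<phi> s powr p \<le> \<phi> t powr p"
  using mono[of s t] nonneg[of s] p_ge_1 by (intro powr_mono2) auto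

lemma powr_dilate:
  assumes "0 < s" "s \<le> t" "t \<le> 1"
  shows "\<phi> t powr p \<le> (t / s) powr p * \<phi> s powr p"
proof -
  have "\<phi> t \<le> (t / s) * \<phi> s"
    using quotient_antimono[OF assms] assms by (simp add: field_simps)
  then have "\<phi> t powr p \<le> ((t / s) * \<phi> s) powr p"
    using assms nonneg[of t] p_ge_1 by (intro powr_mono2) auto
  then show ?thesis
    by (simp only: powr_mult)
qed

lemma powr_decay:
  assumes "0 < s" "s \<le> t" "t \<le> 1"
  shows "\<phi> s powr p \<le> K powr p * (s / t) powr (\<gamma> * p) * \<phi> t powr p"
proof -
  have "\<phi> s powr p \<le> (K * (s / t) powr \<gamma> * \<phi> t) powr p"
    using decay[OF assms] assms nonneg[of s] p_ge_1 by (intro powr_mono2) auto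
  then show ?thesis
    using assms nonneg[of t] K_pos by (simp add: powr_mult powr_powr)
qed

text \<open>\<phi> is monotone on [0, 1] only and arbitrary elsewhere; clamping the argument gives a
  monotone, hence Borel, function on the whole line.\<close>

lemma measurable_clamped [measurable]: "(\<lambda>t. \<phi> (max 0 (min 1 t))) \<in> borel_measurable borel"
  by (intro borel_measurable_mono monoI mono) auto

lemma primitive_clamped:
  assumes "a \<le> 1"
  shows "primitive a = (\<integral>\<^sup>+ t. ennreal (\<phi> (max 0 (min 1 t)) powr p / t) * indicator {0<..<a} t \<partial>lborel)"
  unfolding primitive_def using assms
  by (intro nn_integral_cong) (auto simp: indicator_def max_def min_def)

lemma primitive_zero [simp]: "primitive 0 = 0"
  by (simp add: primitive_def)

text \<open>After \<open>powr_decay\<close> relative to the endpoint \<open>a\<close>, the integrand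
  is at most a multiple of \<open>t powr (\<gamma> * p - 1)\<close>, which is integrable at 0
  because \<gamma> is positive.\<close>

lemma primitive_upper:
  assumes "0 \<le> a" "a \<le> 1"
  shows "primitive a \<le> ennreal (K powr p / (\<gamma> * p) * \<phi> a powr p)"
proof (cases "a = 0")
  case False
  define c where "c = K powr p * a powr - (\<gamma> * p) * \<phi> a powr p"
  have gp: "\<gamma> * p > 0" using \<gamma>_pos p_ge_1 by simp
  have c0: "c \<ge> 0" by (simp add: c_def)
  have "((\<lambda>t. t powr (\<gamma> * p - 1)) has_integral (a powr (\<gamma> * p) / (\<gamma> * p))) {0..a}"
    using has_integral_powr_from_0[of "\<gamma> * p - 1" a] gp assms by simp
  then have I: "(\<integral>\<^sup>+ t. ennreal (t powr (\<gamma> * p - 1)) * indicator {0..a} t \<partial>lborel) = ennreal (a powr (\<gamma> * p) / (\<gamma> * p))"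
    by (intro nn_integral_has_integral_lebesgue') auto
  have "primitive a \<le> (\<integral>\<^sup>+ t. ennreal c * (ennreal (t powr (\<gamma> * p - 1)) * indicator {0..a} t) \<partial>lborel)"
    unfolding primitive_def
  proof (intro nn_integral_mono)
    fix t :: real
    show "ennreal (\<phi> t powr p / t) * indicator {0<..<a} t \<le> ennreal c * (ennreal (t powr (\<gamma> * p - 1)) * indicator {0..a} t)"
    proof (cases "0 < t \<and> t < a")
      case True
      have "\<phi> t powr p / t \<le> (K powr p * (t / a) powr (\<gamma> * p) * \<phi> a powr p) / t"
        using powr_decay[of t a] True assms by (intro divide_right_mono) auto
      also have "\<dots> = c * t powr (\<gamma> * p - 1)"
        using True by (simp add: c_def powr_divide powr_minus powr_diff field_simps)
      finally show ?thesis
        using True c0 by (simp add: ennreal_mult[symmetric] ennreal_leI)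
    qed (auto simp: indicator_def)
  qed
  also have "\<dots> = ennreal c * ennreal (a powr (\<gamma> * p) / (\<gamma> * p))"
    by (subst nn_integral_cmult) (auto simp: I)
  also have "\<dots> = ennreal (K powr p / (\<gamma> * p) * \<phi> a powr p)"
    using c0 gp False assms by (simp add: ennreal_mult[symmetric] c_def powr_minus field_simps)
  finally show ?thesis .
qed (simp add: zero)

text \<open>The part over (a/2, a) is already large enough: there the integrand is at least
  \<open>\<phi> (a / 2) powr p / a\<close>, and halving the argument at most halves \<phi>.\<close>

lemma primitive_lower:
  assumes "0 \<le> a" "a \<le> 1"
  shows "ennreal (\<phi> a powr p / (2 * 2 powr p)) \<le> primitive a"
proof (cases "a = 0")
  case False
  define c where "c = \<phi> (a / 2) powr p / a"
  have "ennreal (\<phi> a powr p / (2 * 2 powr p)) \<le> ennreal (c * (a / 2))"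
    using powr_dilate[of "a/2" a] False assms by (intro ennreal_leI) (simp add: c_def field_simps)
  also have "\<dots> = ennreal c * emeasure lborel {a/2<..<a}"
    using False assms by (simp add: ennreal_mult[symmetric] c_def)
  also have "\<dots> = (\<integral>\<^sup>+ t. ennreal c * indicator {a/2<..<a} t \<partial>lborel)"
    by (simp add: nn_integral_cmult_indicator)
  also have "\<dots> \<le> primitive a"
    unfolding primitive_def
  proof (intro nn_integral_mono)
    fix t :: real
    show "ennreal c * indicator {a/2<..<a} t \<le> ennreal (\<phi> t powr p / t) * indicator {0<..<a} t"
    proof (cases "a/2 < t \<and> t < a")
      case True
      have "c \<le> \<phi> t powr p / t"
        unfolding c_def using True assms powr_mono_on[of "a/2" t] by (intro frac_le) auto
      then show ?thesis using True assms by (auto simp: ennreal_leI)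
    qed (auto simp: indicator_def)
  qed
  finally show ?thesis .
qed (simp add: zero)

definition prim :: "real \<Rightarrow> real" where
  "prim a = enn2real (primitive a)"

definition prim_const :: real where
  "prim_const = max (2 * 2 powr p) (K powr p / (\<gamma> * p))"

lemma prim_const_pos: "0 < prim_const"
  by (simp add: prim_const_def less_max_iff_disj)

lemma primitive_eq: "0 \<le> a \<Longrightarrow> a \<le> 1 \<Longrightarrow> primitive a = ennreal (prim a)"
  using primitive_upper[of a] unfolding prim_def
  by (metis ennreal_enn2real ennreal_less_top le_less_trans)

lemma prim_nonneg [simp]: "0 \<le> prim a"
  by (simp add: prim_def)

lemma prim_upper:
  assumes "0 \<le> a" "a \<le> 1" shows "prim a \<le> prim_const * \<phi> a powr p"
proof -
  have "ennreal (prim a) \<le> ennreal (K powr p / (\<gamma> * p) * \<phi> a powr p)"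
    using primitive_upper[OF assms] primitive_eq[OF assms] by simp
  then have "prim a \<le> K powr p / (\<gamma> * p) * \<phi> a powr p"
    using \<gamma>_pos p_ge_1 by (subst (asm) ennreal_le_iff) auto
  also have "\<dots> \<le> prim_const * \<phi> a powr p"
    by (intro mult_right_mono) (auto simp: prim_const_def)
  finally show ?thesis .
qed

lemma prim_lower:
  assumes "0 \<le> a" "a \<le> 1" shows "\<phi> a powr p \<le> prim_const * prim a"
proof -
  have "ennreal (\<phi> a powr p / (2 * 2 powr p)) \<le> ennreal (prim a)"
    using primitive_lower[OF assms] primitive_eq[OF assms] by simp
  then have "\<phi> a powr p / (2 * 2 powr p) \<le> prim a"
    by (subst (asm) ennreal_le_iff) auto
  then have "\<phi> a powr p \<le> (2 * 2 powr p) * prim a"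
    by (simp add: field_simps)
  also have "\<dots> \<le> prim_const * prim a"
    by (intro mult_right_mono) (auto simp: prim_const_def)
  finally show ?thesis .
qed

lemma prim_zero [simp]: "prim 0 = 0"
  by (simp add: prim_def)

lemma prim_pos: "0 < a \<Longrightarrow> a \<le> 1 \<Longrightarrow> 0 < prim a"
  using prim_lower[of a] pos[of a] prim_nonneg[of a]
  by (cases "prim a = 0") (auto simp: less_le)

end

section \<open>The layer cake formula\<close>

interpretation unit_interval: finite_measure "lebesgue_on {0..1::real}"
  by (rule finite_measure_lebesgue_on) auto

definition distribution :: "(real \<Rightarrow> real) \<Rightarrow> real \<Rightarrow> real" where
  "distribution x l = measure (lebesgue_on {0..1}) {s \<in> {0..1}. l < \<bar>x s\<bar>}"

definition lorentz_modular :: "real \<Rightarrow> (real \<Rightarrow> real) \<Rightarrow> (real \<Rightarrow> real) \<Rightarrow> ennreal" where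
  "lorentz_modular p \<phi> x =
     (\<integral>\<^sup>+ t\<in>{0<..1}. ennreal ((decreasing_rearrangement x t * \<phi> t) powr p / t) \<partial>lebesgue)"

lemma measure_unit_interval: "measure (lebesgue_on {0..1::real}) {0..1} = 1"
  by (simp add: measure_restrict_space)

lemma distribution_le_1: "distribution x l \<le> 1"
  using unit_interval.bounded_measure[of "{s \<in> {0..1}. l < \<bar>x s\<bar>}"] measure_unit_interval
  by (simp add: distribution_def)

lemma distribution_nonneg: "0 \<le> distribution x l"
  by (simp add: distribution_def)

lemma superlevel_sets:
  assumes [measurable]: "x \<in> borel_measurable (lebesgue_on {0..1})"
  shows "{s \<in> {0..1}. l < \<bar>x s :: real\<bar>} \<in> sets (lebesgue_on {0..1})"
proof -
  have "{s \<in> space (lebesgue_on {0..1}). l < \<bar>x s\<bar>} \<in> sets (lebesgue_on {0..1})"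
    by measurable
  then show ?thesis by simp
qed

lemma distribution_antimono:
  assumes "x \<in> borel_measurable (lebesgue_on {0..1})" "l \<le> l'"
  shows "distribution x l' \<le> distribution x l"
  unfolding distribution_def using assms(2)
  by (intro unit_interval.finite_measure_mono superlevel_sets assms(1)) auto

lemma distribution_measurable:
  assumes "x \<in> borel_measurable (lebesgue_on {0..1})"
  shows "distribution x \<in> borel_measurable borel"
proof -
  have "(\<lambda>l. - distribution x l) \<in> borel_measurable borel"
    using distribution_antimono[OF assms] by (intro borel_measurable_mono monoI) auto
  then have "(\<lambda>l. - (- distribution x l)) \<in> borel_measurable borel"
    by (rule borel_measurable_uminus)
  then show ?thesis by simp
qed

text \<open>Since \<open>x\<close> is real-valued, its superlevel sets shrink to the empty set. This
  makes the set in \<open>decreasing_rearrangement\<close> nonempty, so that \<open>Inf\<close> is a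
  genuine infimum there.\<close>

lemma distribution_eventually_small:
  assumes x: "x \<in> borel_measurable (lebesgue_on {0..1})" and "0 < t"
  obtains l where "0 < l" "distribution x l \<le> t"
proof -
  let ?A = "\<lambda>n::nat. {s \<in> {0..1}. real n < \<bar>x s\<bar>}"
  have "(\<lambda>n. measure (lebesgue_on {0..1}) (?A n)) \<longlonglongrightarrow> measure (lebesgue_on {0..1}) (\<Inter>n. ?A n)"
  proof (rule unit_interval.finite_Lim_measure_decseq)
    show "range ?A \<subseteq> sets (lebesgue_on {0..1})"
      using superlevel_sets[OF x] by blast
    show "decseq ?A" by (force simp: decseq_def)
  qed
  moreover have "(\<Inter>n. ?A n) = {}"
  proof -
    have "\<exists>n::nat. \<not> (real n < \<bar>x s\<bar>)" for s
      using real_arch_simple[of "\<bar>x s\<bar>"] by (auto simp: not_less)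
    then show ?thesis by fastforce
  qed
  ultimately have "(\<lambda>n. distribution x (real n)) \<longlonglongrightarrow> 0"
    by (simp add: distribution_def)
  then have "\<forall>\<^sub>F n in sequentially. distribution x (real n) < t"
    using \<open>0 < t\<close> by (rule order_tendstoD)
  moreover have "\<forall>\<^sub>F n in sequentially. 0 < n"
    by (rule eventually_gt_at_top)
  ultimately have "\<forall>\<^sub>F n in sequentially. 0 < n \<and> distribution x (real n) < t"
    by eventually_elim auto
  then obtain n where "0 < n" "distribution x (real n) < t"
    using eventually_happens'[OF sequentially_bot] by blast
  then show ?thesis by (intro that[of "real n"]) auto
qed

context
  fixes x :: "real \<Rightarrow> real" and t :: real
  assumes x: "x \<in> borel_measurable (lebesgue_on {0..1})" and t: "0 < t"
begin

lemma rearrangement_eq: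
  "decreasing_rearrangement x t = Inf {l. 0 < l \<and> distribution x l \<le> t}"
  by (simp add: decreasing_rearrangement_def distribution_def)

lemma rearrangement_nonneg: "0 \<le> decreasing_rearrangement x t"
  unfolding rearrangement_eq using distribution_eventually_small[OF x t]
  by (intro cInf_greatest) fastforce+

lemma distribution_gt_if_less_rearrangement:
  assumes "0 < l" "l < decreasing_rearrangement x t"
  shows "t < distribution x l"
proof (rule ccontr)
  assume "\<not> t < distribution x l"
  then have "decreasing_rearrangement x t \<le> l"
    unfolding rearrangement_eq using assms by (intro cInf_lower bdd_belowI[of _ 0]) auto
  then show False using assms by simp
qed

lemma le_rearrangement_if_distribution_gt:
  assumes "t < distribution x l"
  shows "l \<le> decreasing_rearrangement x t"
  unfolding rearrangement_eq
proof (rule cInf_greatest)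
  show "{l. 0 < l \<and> distribution x l \<le> t} \<noteq> {}"
    using distribution_eventually_small[OF x t] by blast
  fix l' assume "l' \<in> {l. 0 < l \<and> distribution x l \<le> t}"
  then show "l \<le> l'"
    using assms distribution_antimono[OF x, of l' l] by (cases "l \<le> l'") auto
qed

text \<open>Up to the endpoint, the levels \<mu> counted here form the interval from 0 to x*(t)^p.
  The upper bound uses the closed interval and the lower bound the open one, so the endpoint need
  not be decided.\<close>

lemma rearrangement_powr_layer:
  assumes "1 \<le> p"
  shows "(\<integral>\<^sup>+ \<mu>. indicator {0<..} \<mu> * indicator {0<..<distribution x (\<mu> powr (1 / p))} t \<partial>lborel)
    = ennreal (decreasing_rearrangement x t powr p)" (is "?I = ennreal ?X")
proof (rule antisym)
  have *: "\<mu> \<le> ?X" if "0 < \<mu>" "t < distribution x (\<mu> powr (1 / p))" for \<mu>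
  proof -
    have "(\<mu> powr (1 / p)) powr p \<le> ?X"
      using le_rearrangement_if_distribution_gt[OF that(2)] assms by (intro powr_mono2) auto
    then show ?thesis using that assms by (simp add: powr_powr)
  qed
  have "?I \<le> (\<integral>\<^sup>+ \<mu>. indicator {0..?X} \<mu> \<partial>lborel)"
    using * by (intro nn_integral_mono) (auto simp: indicator_def)
  then show "?I \<le> ennreal ?X" by simp
  have **: "t < distribution x (\<mu> powr (1 / p))" if "0 < \<mu>" "\<mu> < ?X" for \<mu>
  proof (rule distribution_gt_if_less_rearrangement)
    show "0 < \<mu> powr (1 / p)" using that by simp
    have "\<mu> powr (1 / p) < ?X powr (1 / p)"
      using that assms by (intro powr_less_mono2) auto
    then show "\<mu> powr (1 / p) < decreasing_rearrangement x t"
      using assms rearrangement_nonneg by (simp add: powr_powr)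
  qed
  have "ennreal ?X = (\<integral>\<^sup>+ \<mu>. indicator {0<..<?X} \<mu> \<partial>lborel)" by simp
  also have "\<dots> \<le> ?I"
    using ** t by (intro nn_integral_mono) (auto simp: indicator_def)
  finally show "ennreal ?X \<le> ?I" .
qed

end

context fundamental_function
begin

text \<open>Write x*(t)^p as the integral in \<open>rearrangement_powr_layer\<close> and exchange
  the integrations; the inner integral over t is then \<open>prim\<close>. Taking the p-th power of
  the level as variable avoids the density \<open>p * l powr (p - 1)\<close>.\<close>

lemma modular_layer_cake:
  assumes x: "x \<in> borel_measurable (lebesgue_on {0..1})"
  shows "lorentz_modular p \<phi> x =
    (\<integral>\<^sup>+ \<mu>. ennreal (prim (distribution x (\<mu> powr (1 / p)))) * indicator {0<..} \<mu> \<partial>lborel)"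
proof -
  define D where "D = (\<lambda>\<mu>. distribution x (\<mu> powr (1 / p)))"
  let ?f = "\<lambda>t. ennreal (\<phi> (max 0 (min 1 t)) powr p / t)"
  have [measurable]: "D \<in> borel_measurable borel"
    using distribution_measurable[OF x] by (simp add: D_def)
  have D1: "D \<mu> \<le> 1" "0 \<le> D \<mu>" for \<mu>
    by (auto simp: D_def distribution_le_1 distribution_nonneg)
  have "lorentz_modular p \<phi> x = (\<integral>\<^sup>+ t. ennreal ((decreasing_rearrangement x t * \<phi> t) powr p / t) * indicator {0<..1} t \<partial>lborel)"
    by (simp add: lorentz_modular_def nn_integral_completion)
  also have "\<dots> = (\<integral>\<^sup>+ t. (\<integral>\<^sup>+ \<mu>. ?f t * (indicator {0<..} \<mu> * indicator {0<..<D \<mu>} t) \<partial>lborel) \<partial>lborel)"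
  proof (rule nn_integral_cong)
    fix t :: real
    have eq: "(\<integral>\<^sup>+ \<mu>. ?f t * (indicator {0<..} \<mu> * indicator {0<..<D \<mu>} t) \<partial>lborel)
        = ?f t * (\<integral>\<^sup>+ \<mu>. (indicator {0<..} \<mu> * indicator {0<..<D \<mu>} t) \<partial>lborel)"
      by (rule nn_integral_cmult) (unfold indicator_def greaterThanLessThan_iff, measurable)
    show "ennreal ((decreasing_rearrangement x t * \<phi> t) powr p / t) * indicator {0<..1} t =
       (\<integral>\<^sup>+ \<mu>. ?f t * (indicator {0<..} \<mu> * indicator {0<..<D \<mu>} t) \<partial>lborel)"
    proof (cases "0 < t \<and> t \<le> 1")
      case True
      then have "max 0 (min 1 t) = t" by simp
      then show ?thesis
        unfolding eq unfolding D_def using True rearrangement_powr_layer[OF x _ p_ge_1, of t]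
        by (simp add: powr_mult ennreal_mult[symmetric] mult.commute)
    next
      \<comment> \<open>Beyond (0, 1] the clamped kernel differs from the original one, but
        distribution functions are at most 1, so the indicator vanishes there.\<close>
      case False
      then have "indicator {0<..<D \<mu>} t = (0::ennreal)" for \<mu>
        using D1[of \<mu>] by (auto simp: indicator_def)
      then show ?thesis using False by auto
    qed
  qed
  also have "\<dots> = (\<integral>\<^sup>+ \<mu>. (\<integral>\<^sup>+ t. ?f t * (indicator {0<..} \<mu> * indicator {0<..<D \<mu>} t) \<partial>lborel) \<partial>lborel)"
    by (rule lborel_pair.Fubini') (unfold indicator_def greaterThanLessThan_iff, measurable)
  also have "\<dots> = (\<integral>\<^sup>+ \<mu>. ennreal (prim (D \<mu>)) * indicator {0<..} \<mu> \<partial>lborel)"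
  proof (rule nn_integral_cong)
    fix \<mu> :: real
    have "(\<integral>\<^sup>+ t. ?f t * (indicator {0<..} \<mu> * indicator {0<..<D \<mu>} t) \<partial>lborel)
        = (\<integral>\<^sup>+ t. (?f t * indicator {0<..<D \<mu>} t) * indicator {0<..} \<mu> \<partial>lborel)"
      by (intro nn_integral_cong) (simp only: mult.assoc mult.commute mult.left_commute)
    also have "\<dots> = (\<integral>\<^sup>+ t. ?f t * indicator {0<..<D \<mu>} t \<partial>lborel) * indicator {0<..} \<mu>"
      by (rule nn_integral_multc) measurable
    also have "\<dots> = ennreal (prim (D \<mu>)) * indicator {0<..} \<mu>"
      by (simp only: primitive_clamped[OF D1(1), symmetric] primitive_eq[OF D1(2,1)])
    finally show "(\<integral>\<^sup>+ t. ?f t * (indicator {0<..} \<mu> * indicator {0<..<D \<mu>} t) \<partial>lborel) =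
        ennreal (prim (D \<mu>)) * indicator {0<..} \<mu>" .
  qed
  finally show ?thesis by (simp only: D_def)
qed

end

lemma lorentz_norm_modular:
  "lorentz_norm p \<phi> x = (if lorentz_modular p \<phi> x = \<infinity> then \<infinity>
     else ennreal (enn2real (lorentz_modular p \<phi> x) powr (1 / p)))"
  by (simp add: lorentz_norm_def lorentz_modular_def Let_def)

text \<open>Taking p-th powers moves every norm estimate to modulars, which are integrals over
  levels; a constant \<open>C\<close> becomes \<open>C powr p\<close>.\<close>

lemma lorentz_norm_le_iff:
  assumes "1 \<le> p" "0 < C"
  shows "lorentz_norm p \<phi> x \<le> ennreal C * lorentz_norm p \<phi> y
    \<longleftrightarrow> lorentz_modular p \<phi> x \<le> ennreal (C powr p) * lorentz_modular p \<phi> y"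
proof (cases "lorentz_modular p \<phi> y")
  case y: (real r)
  show ?thesis
  proof (cases "lorentz_modular p \<phi> x")
    case x: (real q)
    have "q powr (1 / p) \<le> C * r powr (1 / p) \<longleftrightarrow> q powr (1 / p) \<le> (C powr p * r) powr (1 / p)"
      using assms by (simp add: powr_mult powr_powr)
    also have "\<dots> \<longleftrightarrow> q \<le> C powr p * r"
      using assms x y powr_mono2[of "1 / p" q "C powr p * r"] powr_less_mono2[of "1 / p" "C powr p * r" q]
      by fastforce
    finally show ?thesis
      using assms x y by (simp add: lorentz_norm_modular ennreal_mult[symmetric])
  next
    case top
    then show ?thesis using assms y by (simp add: lorentz_norm_modular ennreal_mult[symmetric] top_unique)
  qed
next
  case top
  then show ?thesis using assms by (simp add: lorentz_norm_modular ennreal_mult_top)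
qed

lemma lorentz_modular_eq_if_norm_eq:
  assumes "1 \<le> p" "lorentz_norm p \<phi> x = lorentz_norm p \<phi> y"
  shows "lorentz_modular p \<phi> x = lorentz_modular p \<phi> y"
  using lorentz_norm_le_iff[of p 1 \<phi> x y] lorentz_norm_le_iff[of p 1 \<phi> y x] assms by simp

section \<open>Modulars of disjointly supported sums\<close>

lemma distribution_sum:
  fixes x :: "'i \<Rightarrow> real \<Rightarrow> real"
  assumes "finite A" and x: "\<And>i. i \<in> A \<Longrightarrow> x i \<in> borel_measurable (lebesgue_on {0..1})"
    and disj: "AE t in lebesgue_on {0..1}. \<forall>i\<in>A. \<forall>j\<in>A. i \<noteq> j \<longrightarrow> x i t = 0 \<or> x j t = 0"
    and "0 \<le> l"
  shows "distribution (\<lambda>t. \<Sum>i\<in>A. x i t) l = (\<Sum>i\<in>A. distribution (x i) l)"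
proof -
  let ?M = "lebesgue_on {0..1::real}"
  let ?S = "\<lambda>f. {s \<in> {0..1}. l < \<bar>f s :: real\<bar>}"
  let ?s = "\<lambda>t. \<Sum>i\<in>A. x i t"
  have s: "?s \<in> borel_measurable ?M" using x by simp
  \<comment> \<open>Almost everywhere at most one summand is nonzero, and \<open>0 \<le> l\<close>
    keeps the vanishing summands out of the superlevel sets.\<close>
  have "AE t in ?M. (indicator (?S ?s) t :: real) = (\<Sum>i\<in>A. indicator (?S (x i)) t)"
    using disj
  proof eventually_elim
    case (elim t)
    show ?case
    proof (cases "\<forall>i\<in>A. x i t = 0")
      case True
      then show ?thesis using \<open>0 \<le> l\<close> by (auto simp: indicator_def)
    next
      case False
      then obtain k where k: "k \<in> A" "x k t \<noteq> 0" by blast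
      then have z: "x i t = 0" if "i \<in> A - {k}" for i using elim that by auto
      have "?s t = x k t"
        using \<open>finite A\<close> k z by (simp add: sum.remove)
      moreover have "(\<Sum>i\<in>A. indicator (?S (x i)) t) = (indicator (?S (x k)) t :: real)"
        using \<open>finite A\<close> k z \<open>0 \<le> l\<close> by (subst sum.remove[of _ k]) (auto intro!: sum.neutral)
      ultimately show ?thesis by (simp add: indicator_def)
    qed
  qed
  then have "(\<integral>t. indicat_real (?S ?s) t \<partial>?M) = (\<integral>t. (\<Sum>i\<in>A. indicat_real (?S (x i)) t) \<partial>?M)"
    using superlevel_sets[OF s] superlevel_sets[OF x]
    by (intro integral_cong_AE) auto
  also have "\<dots> = (\<Sum>i\<in>A. (\<integral>t. indicat_real (?S (x i)) t \<partial>?M))"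
    using superlevel_sets[OF x]
    by (intro Bochner_Integration.integral_sum) (auto simp: unit_interval.emeasure_finite less_top[symmetric])
  moreover have "(\<integral>t. indicat_real (?S f) t \<partial>?M) = distribution f l" for f
  proof -
    have "?S f \<inter> space ?M = ?S f" by auto
    then show ?thesis by (simp only: distribution_def Bochner_Integration.integral_indicator)
  qed
  ultimately show ?thesis by (simp only:)
qed

context fundamental_function
begin

lemma primitive_mono: "a \<le> b \<Longrightarrow> primitive a \<le> primitive b"
  unfolding primitive_def by (intro nn_integral_mono) (auto simp: indicator_def)

lemma prim_mono: "0 \<le> a \<Longrightarrow> a \<le> b \<Longrightarrow> b \<le> 1 \<Longrightarrow> prim a \<le> prim b"
  using primitive_mono[of a b] by (simp add: primitive_eq)

lemma prim_distribution_measurable: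
  assumes "x \<in> borel_measurable (lebesgue_on {0..1})"
  shows "(\<lambda>\<mu>. prim (distribution x (\<mu> powr (1 / p)))) \<in> borel_measurable borel"
proof -
  have [measurable]: "(\<lambda>a. prim (max 0 (min 1 a))) \<in> borel_measurable borel"
    by (intro borel_measurable_mono monoI prim_mono) auto
  note [measurable] = distribution_measurable[OF assms]
  have "(\<lambda>\<mu>. prim (max 0 (min 1 (distribution x (\<mu> powr (1 / p)))))) \<in> borel_measurable borel"
    by measurable
  then show ?thesis
    by (simp add: distribution_le_1 distribution_nonneg)
qed

context
  fixes x :: "'i \<Rightarrow> real \<Rightarrow> real" and A :: "'i set"
  assumes fin: "finite A"
    and x: "\<And>i. i \<in> A \<Longrightarrow> x i \<in> borel_measurable (lebesgue_on {0..1})"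
    and disj: "AE t in lebesgue_on {0..1}. \<forall>i\<in>A. \<forall>j\<in>A. i \<noteq> j \<longrightarrow> x i t = 0 \<or> x j t = 0"
begin

lemma sum_modular:
  "(\<Sum>i\<in>A. lorentz_modular p \<phi> (x i)) =
    (\<integral>\<^sup>+ \<mu>. ennreal (\<Sum>i\<in>A. prim (distribution (x i) (\<mu> powr (1 / p)))) * indicator {0<..} \<mu> \<partial>lborel)"
proof -
  have "(\<Sum>i\<in>A. lorentz_modular p \<phi> (x i)) =
    (\<Sum>i\<in>A. \<integral>\<^sup>+ \<mu>. ennreal (prim (distribution (x i) (\<mu> powr (1 / p)))) * indicator {0<..} \<mu> \<partial>lborel)"
    using modular_layer_cake x by simp
  also have "\<dots> = (\<integral>\<^sup>+ \<mu>. (\<Sum>i\<in>A. ennreal (prim (distribution (x i) (\<mu> powr (1 / p)))) * indicator {0<..} \<mu>) \<partial>lborel)"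
    by (rule nn_integral_sum[symmetric]) (use prim_distribution_measurable[OF x] in measurable)
  also have "\<dots> = (\<integral>\<^sup>+ \<mu>. ennreal (\<Sum>i\<in>A. prim (distribution (x i) (\<mu> powr (1 / p)))) * indicator {0<..} \<mu> \<partial>lborel)"
    by (simp add: sum_distrib_right[symmetric] sum_ennreal)
  finally show ?thesis .
qed

lemma modular_sum:
  "lorentz_modular p \<phi> (\<lambda>t. \<Sum>i\<in>A. x i t) =
    (\<integral>\<^sup>+ \<mu>. ennreal (prim (\<Sum>i\<in>A. distribution (x i) (\<mu> powr (1 / p)))) * indicator {0<..} \<mu> \<partial>lborel)"
proof -
  have "(\<lambda>t. \<Sum>i\<in>A. x i t) \<in> borel_measurable (lebesgue_on {0..1})"
    using x by simp
  from modular_layer_cake[OF this] show ?thesis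
    using distribution_sum[OF fin x disj] by simp
qed

text \<open>A comparison of \<open>prim\<close> at every single level integrates to one of modulars.
  This reduces two-sided additivity, for summands of any shape, to inequalities between numbers in
  [0, 1].\<close>

lemma modular_sum_upper:
  assumes "0 \<le> B" and "\<And>\<mu>. 0 < \<mu> \<Longrightarrow> prim (\<Sum>i\<in>A. distribution (x i) \<mu>) \<le> B * (\<Sum>i\<in>A. prim (distribution (x i) \<mu>))"
  shows "lorentz_modular p \<phi> (\<lambda>t. \<Sum>i\<in>A. x i t) \<le> ennreal B * (\<Sum>i\<in>A. lorentz_modular p \<phi> (x i))"
proof -
  have "ennreal B * (\<Sum>i\<in>A. lorentz_modular p \<phi> (x i)) = (\<integral>\<^sup>+ \<mu>. ennreal B *
    (ennreal (\<Sum>i\<in>A. prim (distribution (x i) (\<mu> powr (1 / p)))) * indicator {0<..} \<mu>) \<partial>lborel)"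
    unfolding sum_modular
    by (rule nn_integral_cmult[symmetric]) (use prim_distribution_measurable[OF x] in measurable)
  moreover have "lorentz_modular p \<phi> (\<lambda>t. \<Sum>i\<in>A. x i t) \<le> \<dots>"
    unfolding modular_sum using assms
    by (intro nn_integral_mono) (auto simp: indicator_def ennreal_mult[symmetric] sum_nonneg intro!: ennreal_leI)
  ultimately show ?thesis by simp
qed

lemma modular_sum_lower:
  assumes "0 \<le> B" and "\<And>\<mu>. 0 < \<mu> \<Longrightarrow> (\<Sum>i\<in>A. prim (distribution (x i) \<mu>)) \<le> B * prim (\<Sum>i\<in>A. distribution (x i) \<mu>)"
  shows "(\<Sum>i\<in>A. lorentz_modular p \<phi> (x i)) \<le> ennreal B * lorentz_modular p \<phi> (\<lambda>t. \<Sum>i\<in>A. x i t)"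
proof -
  have "(\<lambda>t. \<Sum>i\<in>A. x i t) \<in> borel_measurable (lebesgue_on {0..1})"
    using x by simp
  from prim_distribution_measurable[OF this]
  have m: "(\<lambda>\<mu>. prim (\<Sum>i\<in>A. distribution (x i) (\<mu> powr (1 / p)))) \<in> borel_measurable borel"
    using distribution_sum[OF fin x disj] by simp
  have "ennreal B * lorentz_modular p \<phi> (\<lambda>t. \<Sum>i\<in>A. x i t) = (\<integral>\<^sup>+ \<mu>. ennreal B *
    (ennreal (prim (\<Sum>i\<in>A. distribution (x i) (\<mu> powr (1 / p)))) * indicator {0<..} \<mu>) \<partial>lborel)"
    unfolding modular_sum
    by (rule nn_integral_cmult[symmetric]) (use m in measurable)
  moreover have "(\<Sum>i\<in>A. lorentz_modular p \<phi> (x i)) \<le> \<dots>"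
    unfolding sum_modular using assms
    by (intro nn_integral_mono) (auto simp: indicator_def ennreal_mult[symmetric] sum_nonneg intro!: ennreal_leI)
  ultimately show ?thesis by simp
qed

end

end

section \<open>Regular variation implies decomposability\<close>

lemma AE_ess_sup_on:
  assumes "S \<subseteq> {0..1}" "S \<in> sets lebesgue"
  shows "AE t in lebesgue_on {0..1}. t \<in> S \<longrightarrow> ereal (w t) \<le> ess_sup_on w S"
proof -
  have "AE t in lebesgue_on S. ereal (w t) \<le> ess_sup_on w S"
    unfolding ess_sup_on_def by (rule esssup_AE)
  then have "AE t in lebesgue. t \<in> S \<longrightarrow> ereal (w t) \<le> ess_sup_on w S"
    using assms by (subst (asm) AE_restrict_space_iff) auto
  then show ?thesis
    by (subst AE_restrict_space_iff) (auto elim: AE_mp)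
qed

lemma AE_ess_inf_on:
  assumes "S \<subseteq> {0..1}" "S \<in> sets lebesgue"
  shows "AE t in lebesgue_on {0..1}. t \<in> S \<longrightarrow> ess_inf_on w S \<le> ereal (w t)"
proof -
  have "AE t in lebesgue_on S. - ereal (w t) \<le> - ess_inf_on w S"
    unfolding ess_inf_on_def ereal_uminus_uminus by (rule esssup_AE)
  then have "AE t in lebesgue. t \<in> S \<longrightarrow> ess_inf_on w S \<le> ereal (w t)"
    using assms by (subst (asm) AE_restrict_space_iff) (auto simp only: ereal_minus_le_minus)
  then show ?thesis
    by (subst AE_restrict_space_iff) (auto elim: AE_mp)
qed

text \<open>Evaluating at such a witness turns almost everywhere bounds on \<open>w\<close> into
  inequalities between numbers.\<close>

lemma obtain_from_nonnull:
  assumes "\<not> (AE t in M. t \<notin> S)" "AE t in M. P t"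
  obtains t where "t \<in> S" "P t"
proof -
  have "\<exists>t\<in>S. P t"
  proof (rule ccontr)
    assume "\<not> ?thesis"
    then have "AE t in M. t \<notin> S" using assms(2) by (auto elim: AE_mp)
    then show False using assms(1) by simp
  qed
  then show ?thesis using that by blast
qed

context
  fixes w :: "real \<Rightarrow> real" and S :: "nat \<Rightarrow> real set" and n :: nat
  assumes w_pos: "AE t in lebesgue_on {0..1}. 0 < w t"
    and S: "\<And>i. i \<in> {1..n} \<Longrightarrow> S i \<subseteq> {0..1} \<and> S i \<in> sets lebesgue"
    and nonnull: "\<And>i. i \<in> {1..n} \<Longrightarrow> \<not> (AE t in lebesgue_on {0..1}. t \<notin> S i)"
    and sep: "\<And>i. i \<in> {1..<n} \<Longrightarrow> 2 * ess_sup_on w (S (i + 1)) \<le> ess_inf_on w (S i)"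
begin

text \<open>For i >= 2 the essential supremum over \<open>S i\<close> is a real number: a value of
  \<open>w\<close> on \<open>S i\<close> bounds it from below, half a value of \<open>w\<close> on
  \<open>S (i - 1)\<close> from above. On \<open>S 1\<close> it may be infinite, hence the guard
  \<open>2 \<le> i\<close>.\<close>

lemma separating_levels:
  obtains s :: "nat \<Rightarrow> real" where
    "AE t in lebesgue_on {0..1}. \<forall>i\<in>{1..n}. t \<in> S i \<longrightarrow>
       (2 \<le> i \<longrightarrow> w t \<le> s i) \<and> (i < n \<longrightarrow> 2 * s (i + 1) \<le> w t)"
proof -
  define s where "s i = real_of_ereal (ess_sup_on w (S i))" for i
  have fin: "ess_sup_on w (S i) = ereal (s i)" if i: "2 \<le> i" "i \<le> n" for i
  proof -
    have i': "i \<in> {1..n}" "i - 1 \<in> {1..n}" "i - 1 \<in> {1..<n}" "i - 1 + 1 = i" using i by auto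
    obtain t where "ereal (w t) \<le> ess_sup_on w (S i)"
      using obtain_from_nonnull[OF nonnull[OF i'(1)] AE_ess_sup_on[of "S i" w]] S i' by blast
    moreover obtain t' where "ess_inf_on w (S (i - 1)) \<le> ereal (w t')"
      using obtain_from_nonnull[OF nonnull[OF i'(2)] AE_ess_inf_on[of "S (i - 1)" w]] S i' by blast
    then have "2 * ess_sup_on w (S i) \<le> ereal (w t')"
      using sep[OF i'(3)] i'(4) by simp
    ultimately show ?thesis
      unfolding s_def by (cases "ess_sup_on w (S i)") auto
  qed
  have "AE t in lebesgue_on {0..1}. \<forall>i\<in>{1..n}.
      t \<in> S i \<longrightarrow> ereal (w t) \<le> ess_sup_on w (S i) \<and> ess_inf_on w (S i) \<le> ereal (w t)"
  proof (rule AE_finite_allI)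
    fix i assume "i \<in> {1..n}"
    then have "AE t in lebesgue_on {0..1}. t \<in> S i \<longrightarrow> ereal (w t) \<le> ess_sup_on w (S i)"
      "AE t in lebesgue_on {0..1}. t \<in> S i \<longrightarrow> ess_inf_on w (S i) \<le> ereal (w t)"
      using S AE_ess_sup_on AE_ess_inf_on by blast+
    then show "AE t in lebesgue_on {0..1}. t \<in> S i \<longrightarrow> ereal (w t) \<le> ess_sup_on w (S i) \<and> ess_inf_on w (S i) \<le> ereal (w t)"
      by eventually_elim auto
  qed auto
  then have "AE t in lebesgue_on {0..1}. \<forall>i\<in>{1..n}. t \<in> S i \<longrightarrow>
       (2 \<le> i \<longrightarrow> w t \<le> s i) \<and> (i < n \<longrightarrow> 2 * s (i + 1) \<le> w t)"
  proof eventually_elim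
    case (elim t)
    show ?case
    proof (intro ballI impI conjI)
      fix i assume i: "i \<in> {1..n}" "t \<in> S i"
      then have e: "ereal (w t) \<le> ess_sup_on w (S i)" "ess_inf_on w (S i) \<le> ereal (w t)"
        using elim by auto
      { assume "2 \<le> i"
        then show "w t \<le> s i" using fin[of i] i e by simp }
      { assume "i < n"
        then have "2 * ess_sup_on w (S (i + 1)) \<le> ereal (w t)"
          using sep[of i] i e by simp
        moreover have "ess_sup_on w (S (i + 1)) = ereal (s (i + 1))"
          using fin[of "i + 1"] i \<open>i < n\<close> by simp
        ultimately show "2 * s (i + 1) \<le> w t"
          by simp }
    qed
  qed
  then show ?thesis by (rule that)
qed

text \<open>Some point of \<open>S i\<close> obeys both bounds, so the numbers \<open>s i\<close> at
  least halve from step to step; they are positive because \<open>w\<close> is. A common point of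
  \<open>S i\<close> and \<open>S j\<close> with i < j would give w t <= s j <= s (i + 1) < 2 * s (i
  + 1) <= w t.\<close>

lemma separated_disjoint_decay:
  assumes "AE t in lebesgue_on {0..1}. w t \<le> c"
  shows "AE t in lebesgue_on {0..1}. \<forall>i\<in>{1..n}. t \<in> S i \<longrightarrow> w t \<le> c * (1 / 2) ^ (i - 1)"
    and "AE t in lebesgue_on {0..1}. \<forall>i\<in>{1..n}. \<forall>j\<in>{1..n}. i \<noteq> j \<longrightarrow> t \<notin> S i \<or> t \<notin> S j"
proof -
  obtain s where s: "AE t in lebesgue_on {0..1}. \<forall>i\<in>{1..n}. t \<in> S i \<longrightarrow>
       (2 \<le> i \<longrightarrow> w t \<le> s i) \<and> (i < n \<longrightarrow> 2 * s (i + 1) \<le> w t)"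
    using separating_levels by blast
  have s_step: "2 * s (i + 1) \<le> s i" if "2 \<le> i" "i < n" for i
  proof -
    have "i \<in> {1..n}" using that by simp
    then obtain t where "t \<in> S i" "\<forall>i\<in>{1..n}. t \<in> S i \<longrightarrow>
       (2 \<le> i \<longrightarrow> w t \<le> s i) \<and> (i < n \<longrightarrow> 2 * s (i + 1) \<le> w t)"
      using obtain_from_nonnull[OF nonnull s] by blast
    then have "w t \<le> s i" "2 * s (i + 1) \<le> w t" using that by auto
    then show ?thesis by simp
  qed
  have s_pos: "0 < s i" if "2 \<le> i" "i \<le> n" for i
  proof -
    have X: "AE t in lebesgue_on {0..1}. 0 < w t \<and> (t \<in> S i \<longrightarrow> w t \<le> s i)"
      using w_pos s by eventually_elim (use that in auto)
    have "i \<in> {1..n}" using that by simp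
    then obtain t where "t \<in> S i" "0 < w t \<and> (t \<in> S i \<longrightarrow> w t \<le> s i)"
      using obtain_from_nonnull[OF nonnull X] by blast
    then show ?thesis by simp
  qed
  have s_decay: "s i \<le> c * (1 / 2) ^ (i - 1)" if "2 \<le> i" "i \<le> n" for i
    using that
  proof (induction i rule: nat_induct_at_least)
    case base
    have X: "AE t in lebesgue_on {0..1}. w t \<le> c \<and> (t \<in> S 1 \<longrightarrow> 2 * s 2 \<le> w t)"
      using assms s by eventually_elim (use base in \<open>auto simp: numeral_2_eq_2\<close>)
    have "1 \<in> {1..n}" using base by simp
    then obtain t where "t \<in> S 1" "w t \<le> c \<and> (t \<in> S 1 \<longrightarrow> 2 * s 2 \<le> w t)"
      using obtain_from_nonnull[OF nonnull X] by blast
    then show ?case by simp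
  next
    case (Suc i)
    then have "2 * s (Suc i) \<le> c * (1 / 2) ^ (i - 1)" using s_step[of i] by simp
    moreover have "c * (1 / 2) ^ (Suc i - 1) = c * (1 / 2) ^ (i - 1) / 2"
      using Suc by (cases i) auto
    ultimately show ?case by linarith
  qed
  show "AE t in lebesgue_on {0..1}. \<forall>i\<in>{1..n}. t \<in> S i \<longrightarrow> w t \<le> c * (1 / 2) ^ (i - 1)"
    using assms s
  proof eventually_elim
    case (elim t)
    show ?case
    proof (intro ballI impI)
      fix i assume i: "i \<in> {1..n}" "t \<in> S i"
      show "w t \<le> c * (1 / 2) ^ (i - 1)"
      proof (cases "i = 1")
        case False
        then have "w t \<le> s i" "s i \<le> c * (1 / 2) ^ (i - 1)"
          using i elim s_decay[of i] by auto
        then show ?thesis by simp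
      qed (use elim in simp)
    qed
  qed
  have s_le: "s j \<le> s (i + 1)" if "1 \<le> i" "i < j" "j \<le> n" for i j
  proof -
    have "i + 1 \<le> j" using that by simp
    then show ?thesis using \<open>j \<le> n\<close>
    proof (induction j rule: nat_induct_at_least)
      case (Suc j)
      then show ?case using s_step[of j] s_pos[of "Suc j"] that(1) by simp
    qed simp
  qed
  have key: "t \<notin> S i \<or> t \<notin> S j" if ij: "1 \<le> i" "i < j" "j \<le> n" and "0 < w t"
    and el: "\<forall>i\<in>{1..n}. t \<in> S i \<longrightarrow> (2 \<le> i \<longrightarrow> w t \<le> s i) \<and> (i < n \<longrightarrow> 2 * s (i + 1) \<le> w t)" for i j t
  proof (rule ccontr)
    assume "\<not> ?thesis"
    then have "w t \<le> s j" "2 * s (i + 1) \<le> w t" using el ij by auto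
    then show False using s_le[OF ij] \<open>0 < w t\<close> by simp
  qed
  show "AE t in lebesgue_on {0..1}. \<forall>i\<in>{1..n}. \<forall>j\<in>{1..n}. i \<noteq> j \<longrightarrow> t \<notin> S i \<or> t \<notin> S j"
    using w_pos s
  proof eventually_elim
    case (elim t)
    show ?case
    proof (intro ballI impI)
      fix i j assume ij: "i \<in> {1..n}" "j \<in> {1..n}" "i \<noteq> j"
      then consider "i < j" | "j < i" by linarith
      then show "t \<notin> S i \<or> t \<notin> S j"
        using key[of i j t] key[of j i t] ij elim by cases auto
    qed
  qed
qed

end

section \<open>Almost linear behaviour of \<open>\<phi> powr p\<close>\<close>

context fundamental_function
begin

text \<open>Here and in \<open>prim_sum_lower\<close>, \<open>prim\<close> is exchanged for
  \<open>\<phi> powr p\<close> once on each side of an estimate, at the cost of one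
  \<open>prim_const\<close> each time.\<close>

lemma prim_sum_upper:
  assumes "\<And>i. i \<in> A \<Longrightarrow> 0 \<le> a i \<and> a i \<le> 1" "0 \<le> sum a A" "sum a A \<le> 1" "0 \<le> B"
    and "\<phi> (sum a A) powr p \<le> B * (\<Sum>i\<in>A. \<phi> (a i) powr p)"
  shows "prim (sum a A) \<le> prim_const\<^sup>2 * B * (\<Sum>i\<in>A. prim (a i))"
proof -
  have "prim (sum a A) \<le> prim_const * \<phi> (sum a A) powr p"
    using assms by (intro prim_upper)
  also have "\<dots> \<le> prim_const * (B * (\<Sum>i\<in>A. \<phi> (a i) powr p))"
    using assms prim_const_pos by (intro mult_left_mono) auto
  also have "\<dots> \<le> prim_const * (B * (\<Sum>i\<in>A. prim_const * prim (a i)))"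
    using assms prim_const_pos by (intro mult_left_mono sum_mono prim_lower) auto
  also have "\<dots> = prim_const\<^sup>2 * B * (\<Sum>i\<in>A. prim (a i))"
    by (simp add: power2_eq_square sum_distrib_left[symmetric])
  finally show ?thesis .
qed

lemma prim_sum_lower:
  assumes "\<And>i. i \<in> A \<Longrightarrow> 0 \<le> a i \<and> a i \<le> 1" "0 \<le> sum a A" "sum a A \<le> 1" "0 \<le> B"
    and "(\<Sum>i\<in>A. \<phi> (a i) powr p) \<le> B * \<phi> (sum a A) powr p"
  shows "(\<Sum>i\<in>A. prim (a i)) \<le> prim_const\<^sup>2 * B * prim (sum a A)"
proof -
  have "(\<Sum>i\<in>A. prim (a i)) \<le> (\<Sum>i\<in>A. prim_const * \<phi> (a i) powr p)"
    using assms by (intro sum_mono prim_upper) auto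
  also have "\<dots> = prim_const * (\<Sum>i\<in>A. \<phi> (a i) powr p)"
    by (simp add: sum_distrib_left)
  also have "\<dots> \<le> prim_const * (B * \<phi> (sum a A) powr p)"
    using assms prim_const_pos by (intro mult_left_mono) auto
  also have "\<dots> \<le> prim_const * (B * (prim_const * prim (sum a A)))"
    using assms prim_const_pos by (intro mult_left_mono prim_lower) auto
  also have "\<dots> = prim_const\<^sup>2 * B * prim (sum a A)"
    by (simp add: power2_eq_square)
  finally show ?thesis .
qed

text \<open>The range of ratios grows with \<open>i\<close> while \<open>B\<close> stays fixed; in
  the application the price is that \<open>M i\<close> shrinks. Base 4 makes the summands treated as
  small in \<open>almost_linear_sum\<close> add up to at most a third of the total, and
  \<open>u * a \<le> 1\<close> keeps the argument in the domain of \<phi>.\<close>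

definition almost_linear :: "(nat \<Rightarrow> real) \<Rightarrow> real \<Rightarrow> bool" where
  "almost_linear M B \<longleftrightarrow> (\<forall>i\<ge>1. \<forall>a u. 0 < a \<longrightarrow> a \<le> M i \<longrightarrow> 1 \<le> u \<longrightarrow> u \<le> 4 ^ i \<longrightarrow> u * a \<le> 1 \<longrightarrow>
     \<phi> (u * a) powr p \<le> B * (u * \<phi> a powr p) \<and> u * \<phi> a powr p \<le> B * \<phi> (u * a) powr p)"

text \<open>The \<open>i\<close>-th summand, if below the fraction \<open>(1 / 4) ^ i\<close> of the total, is controlled by the power
  decay of \<open>\<phi>\<close>; otherwise \<open>\<phi> powr p\<close> compares it linearly with the total.\<close>

lemma almost_linear_sum:
  assumes M: "almost_linear M B" and B: "1 \<le> B"
    and a: "\<And>i. i \<in> {1..n} \<Longrightarrow> 0 \<le> a i \<and> a i \<le> M i"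
    and s1: "sum a {1..n} \<le> 1"
  defines "r \<equiv> (1 / 4) powr (\<gamma> * p)"
  shows "\<phi> (sum a {1..n}) powr p \<le> 2 * B * (\<Sum>i\<in>{1..n}. \<phi> (a i) powr p)"
    and "(\<Sum>i\<in>{1..n}. \<phi> (a i) powr p) \<le> (B + K powr p / (1 - r)) * \<phi> (sum a {1..n}) powr p"
proof -
  define s where "s = sum a {1..n}"
  define h where "h = (\<lambda>t. \<phi> t powr p)"
  define G where "G = {i \<in> {1..n}. s * (1 / 4) ^ i \<le> a i}"
  define L where "L = {i \<in> {1..n}. a i < s * (1 / 4) ^ i}"
  have GL: "{1..n} = G \<union> L" "G \<inter> L = {}" "finite G" "finite L" "G \<subseteq> {1..n}" "L \<subseteq> {1..n}"
    by (auto simp: G_def L_def)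
  have h0: "0 \<le> h t" for t by (simp add: h_def)
  have r: "0 < r" "r < 1"
    using \<gamma>_pos p_ge_1 powr_less_mono2[of "\<gamma> * p" "1/4" 1] by (auto simp: r_def)
  have snn: "0 \<le> s" unfolding s_def using a by (intro sum_nonneg) auto
  have ale: "a i \<le> s" if "i \<in> {1..n}" for i
    unfolding s_def using a that by (intro member_le_sum) auto
  have geom: "(\<Sum>i\<in>L. q ^ i) \<le> q / (1 - q)" if "0 < q" "q < 1" for q :: real
  proof -
    have "(\<Sum>i\<in>L. q ^ i) \<le> (\<Sum>i\<in>{1..n}. q ^ i)"
      using GL that by (intro sum_mono2) auto
    also have "\<dots> = (\<Sum>i<n. q * q ^ i)"
      by (simp add: sum.atLeast1_atMost_eq)
    also have "\<dots> = q * ((1 - q ^ n) / (1 - q))"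
      using that by (simp add: sum_distrib_left[symmetric] sum_gp_strict)
    also have "\<dots> \<le> q / (1 - q)"
      using that by (simp add: field_simps)
    finally show ?thesis .
  qed
  have "h s \<le> 2 * B * (\<Sum>i\<in>{1..n}. h (a i)) \<and> (\<Sum>i\<in>{1..n}. h (a i)) \<le> (B + K powr p / (1 - r)) * h s"
  proof (cases "s = 0")
    case True
    then have "a i = 0" if "i \<in> {1..n}" for i using ale[OF that] a[OF that] by simp
    then have "(\<Sum>i\<in>{1..n}. h (a i)) = 0" by (simp add: h_def zero)
    then show ?thesis using True by (simp add: h_def zero)
  next
    case False
    then have s: "0 < s" using snn by simp
    \<comment> \<open>For a large summand the ratio u = s / a i lies between 1 and 4^i, the range
      covered by \<open>almost_linear\<close>, so \<open>h (a i) / a i\<close> is comparable to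
      \<open>h s / s\<close>.\<close>
    have lin: "a i * h s \<le> B * s * h (a i)" "s * h (a i) \<le> B * (a i * h s)" if "i \<in> G" for i
    proof -
      have i: "i \<in> {1..n}" "s * (1 / 4) ^ i \<le> a i" using that by (auto simp: G_def)
      then have ai: "0 < a i" using s by (metis mult_pos_pos zero_less_power zero_less_divide_1_iff zero_less_numeral less_le_trans)
      have "s / a i \<le> 4 ^ i" using i ai by (simp add: field_simps)
      moreover have "1 \<le> s / a i" using ale[OF i(1)] ai by simp
      ultimately have "h (s / a i * a i) \<le> B * (s / a i * h (a i)) \<and> s / a i * h (a i) \<le> B * h (s / a i * a i)"
        using M i(1) a[OF i(1)] ai s1 unfolding almost_linear_def h_def s_def
        by (metis atLeastAtMost_iff less_irrefl nonzero_eq_divide_eq)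
      then have "h s \<le> B * (s / a i * h (a i))" "s / a i * h (a i) \<le> B * h s"
        using ai by auto
      then show "a i * h s \<le> B * s * h (a i)" "s * h (a i) \<le> B * (a i * h s)"
        using ai by (auto simp: field_simps)
    qed
    have "s = sum a G + sum a L"
      unfolding s_def GL(1) using GL by (intro sum.union_disjoint) auto
    moreover have "sum a L \<le> s * (1 / 3)"
    proof -
      have "sum a L \<le> (\<Sum>i\<in>L. s * (1 / 4) ^ i)"
        by (intro sum_mono) (auto simp: L_def)
      also have "\<dots> \<le> s * (1 / 3)"
        using geom[of "1/4"] s by (simp add: sum_distrib_left[symmetric])
      finally show ?thesis .
    qed
    \<comment> \<open>The small summands carry at most 1/4 + 1/16 + ... = 1/3 of the total, so the
      large ones carry more than half of it.\<close>
    ultimately have "s \<le> 2 * sum a G" using s by simp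
    then have "s * h s \<le> 2 * sum a G * h s" using h0 by (intro mult_right_mono) auto
    also have "\<dots> = 2 * (\<Sum>i\<in>G. a i * h s)" by (simp add: sum_distrib_right)
    also have "\<dots> \<le> 2 * (\<Sum>i\<in>G. B * s * h (a i))" using lin by (intro mult_left_mono sum_mono) auto
    also have "\<dots> \<le> 2 * (\<Sum>i\<in>{1..n}. B * s * h (a i))"
      using GL B s h0 by (intro mult_left_mono sum_mono2) auto
    also have "\<dots> = s * (2 * B * (\<Sum>i\<in>{1..n}. h (a i)))" by (simp add: sum_distrib_left mult_ac)
    finally have 1: "h s \<le> 2 * B * (\<Sum>i\<in>{1..n}. h (a i))" using s by simp
    have "s * (\<Sum>i\<in>G. h (a i)) \<le> (\<Sum>i\<in>G. B * (a i * h s))"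
      unfolding sum_distrib_left using lin by (intro sum_mono) auto
    also have "\<dots> = B * h s * sum a G" by (simp add: sum_distrib_left mult_ac)
    also have "\<dots> \<le> B * h s * s"
    proof (intro mult_left_mono)
      show "sum a G \<le> s" unfolding s_def using a GL by (intro sum_mono2) auto
    qed (use B h0 in auto)
    finally have 2: "(\<Sum>i\<in>G. h (a i)) \<le> B * h s" using s by (simp add: mult_ac)
    have "h (a i) \<le> K powr p * r ^ i * h s" if "i \<in> L" for i
    proof (cases "a i = 0")
      case True then show ?thesis using h0 r by (simp add: h_def zero)
    next
      case False
      have i: "i \<in> {1..n}" "a i < s * (1 / 4) ^ i" using that by (auto simp: L_def)
      then have ai: "0 < a i" using a[OF i(1)] False by simp
      have "h (a i) \<le> K powr p * (a i / s) powr (\<gamma> * p) * h s"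
        using powr_decay[of "a i" s] ai ale[OF i(1)] s1 by (simp add: h_def s_def)
      also have "\<dots> \<le> K powr p * ((1 / 4) ^ i) powr (\<gamma> * p) * h s"
      proof (intro mult_right_mono mult_left_mono powr_mono2)
        show "a i / s \<le> (1 / 4) ^ i" using i s by (simp add: field_simps)
      qed (use \<gamma>_pos p_ge_1 ai s h0 in auto)
      also have "((1 / 4) ^ i) powr (\<gamma> * p) = r ^ i"
        by (simp add: r_def powr_power powr_realpow[symmetric] powr_powr mult.commute)
      finally show ?thesis .
    qed
    then have "(\<Sum>i\<in>L. h (a i)) \<le> (\<Sum>i\<in>L. K powr p * r ^ i * h s)" by (intro sum_mono)
    also have "\<dots> = K powr p * h s * (\<Sum>i\<in>L. r ^ i)" by (simp add: sum_distrib_left mult_ac)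
    also have "\<dots> \<le> K powr p * h s * (1 / (1 - r))"
    proof (intro mult_left_mono)
      show "(\<Sum>i\<in>L. r ^ i) \<le> 1 / (1 - r)"
        using geom[OF r] r by (smt (verit) divide_right_mono)
    qed (use h0 in auto)
    finally have 3: "(\<Sum>i\<in>L. h (a i)) \<le> K powr p / (1 - r) * h s" by (simp add: mult_ac)
    have "(\<Sum>i\<in>{1..n}. h (a i)) = (\<Sum>i\<in>G. h (a i)) + (\<Sum>i\<in>L. h (a i))"
      unfolding GL(1) using GL by (intro sum.union_disjoint) auto
    then show ?thesis using 1 2 3 by (simp add: algebra_simps)
  qed
  then show "\<phi> (sum a {1..n}) powr p \<le> 2 * B * (\<Sum>i\<in>{1..n}. \<phi> (a i) powr p)"
    "(\<Sum>i\<in>{1..n}. \<phi> (a i) powr p) \<le> (B + K powr p / (1 - r)) * \<phi> (sum a {1..n}) powr p"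
    by (auto simp: h_def s_def)
qed

end

lemma dyadic_bracket:
  fixes u :: real
  assumes "1 \<le> u"
  obtains j :: nat where "2 ^ j \<le> u" "u < 2 ^ Suc j"
proof -
  obtain n where n: "u < 2 ^ n" using real_arch_pow[of 2 u] by auto
  define k where "k = (LEAST n. u < 2 ^ n)"
  have k: "u < 2 ^ k" unfolding k_def using n by (rule LeastI)
  then have "k \<noteq> 0" using assms by (auto intro: ccontr)
  then obtain j where j: "k = Suc j" using not0_implies_Suc by blast
  have "\<not> u < 2 ^ j" using not_less_Least[of j "\<lambda>n. u < 2 ^ n"] j by (simp add: k_def)
  then show ?thesis using that[of j] k j by simp
qed

text \<open>Only finitely many powers of two are involved, so their neighbourhoods of 0 can be
  intersected; the factor 2 leaves room on both sides of the limit. Ratios in between are filled in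
  later by monotonicity of \<psi>.\<close>

lemma regularly_varying_dyadic:
  assumes rv: "regularly_varying_at_zero \<psi> p" and p: "1 \<le> p" and pos: "\<And>t. 0 < t \<Longrightarrow> t \<le> 1 \<Longrightarrow> 0 < \<psi> t"
  obtains m where "0 < m" "\<And>t j. 0 < t \<Longrightarrow> t \<le> m \<Longrightarrow> j \<le> N \<Longrightarrow> 2 ^ j * t \<le> 1 \<and>
    \<psi> (2 ^ j * t) powr p \<le> 2 * 2 ^ j * \<psi> t powr p \<and> 2 ^ j * \<psi> t powr p \<le> 2 * \<psi> (2 ^ j * t) powr p"
proof -
  let ?P = "\<lambda>j t. 2 ^ j * t \<le> 1 \<and>
    \<psi> (2 ^ j * t) powr p \<le> 2 * 2 ^ j * \<psi> t powr p \<and> 2 ^ j * \<psi> t powr p \<le> 2 * \<psi> (2 ^ j * t) powr p"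
  have ev: "\<forall>\<^sub>F t in at_right 0. ?P j t" for j :: nat
  proof -
    have lim: "((\<lambda>t. \<psi> (t * 2 ^ j) / \<psi> t) \<longlongrightarrow> (2 ^ j) powr (1 / p)) (at_right 0)"
      using rv by (simp add: regularly_varying_at_zero_def)
    have "\<forall>\<^sub>F t in at_right 0. \<psi> (t * 2 ^ j) / \<psi> t < (2 * 2 ^ j) powr (1 / p)"
      using p by (intro order_tendstoD(2)[OF lim] powr_less_mono2) auto
    moreover have "\<forall>\<^sub>F t in at_right 0. (2 ^ j / 2) powr (1 / p) < \<psi> (t * 2 ^ j) / \<psi> t"
      using p by (intro order_tendstoD(1)[OF lim] powr_less_mono2) auto
    moreover have "\<forall>\<^sub>F t in at_right (0::real). t < 1 / 2 ^ j"
      by (rule order_tendstoD(2)[OF tendsto_ident_at]) simp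
    moreover have "\<forall>\<^sub>F t in at_right (0::real). 0 < t"
      by (simp add: eventually_at_right_less)
    ultimately show ?thesis
    proof eventually_elim
      case (elim t)
      have t: "2 ^ j * t \<le> 1" using elim by (simp add: field_simps)
      moreover have "1 * t \<le> 2 ^ j * t" using elim by (intro mult_right_mono) auto
      ultimately have "t \<le> 1" by linarith
      then have "0 < \<psi> t" "0 < \<psi> (2 ^ j * t)" using pos t elim by auto
      then have *: "\<psi> (2 ^ j * t) \<le> (2 * 2 ^ j) powr (1 / p) * \<psi> t" "(2 ^ j / 2) powr (1 / p) * \<psi> t \<le> \<psi> (2 ^ j * t)"
        using elim by (auto simp: field_simps)
      have "\<psi> (2 ^ j * t) powr p \<le> ((2 * 2 ^ j) powr (1 / p) * \<psi> t) powr p"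
        using * p \<open>0 < \<psi> (2 ^ j * t)\<close> by (intro powr_mono2) auto
      moreover have "((2 ^ j / 2) powr (1 / p) * \<psi> t) powr p \<le> \<psi> (2 ^ j * t) powr p"
        using * p \<open>0 < \<psi> t\<close> by (intro powr_mono2) auto
      ultimately show ?case using t p by (simp add: powr_mult powr_powr)
    qed
  qed
  have "\<forall>\<^sub>F t in at_right 0. \<forall>j\<in>{..N}. ?P j t"
    by (rule eventually_ball_finite) (use ev in auto)
  then obtain b where b: "0 < b" "\<And>t. 0 < t \<Longrightarrow> t < b \<Longrightarrow> \<forall>j\<in>{..N}. ?P j t"
    unfolding eventually_at_right_field by auto
  show ?thesis using b by (intro that[of "b / 2"]) auto
qed

context fundamental_function
begin

lemma regularly_varying_almost_linear:
  assumes qc: "quasi_concave \<psi>" and rv: "regularly_varying_at_zero \<psi> p" and eq: "equivalent_on_unit \<phi> \<psi>"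
  obtains M B where "1 \<le> B" "almost_linear M B" "M 1 = 1" "\<And>i. 0 < M i" "antimono M" "M \<longlonglongrightarrow> 0"
proof -
  obtain C where C: "0 < C" "\<And>t. 0 \<le> t \<Longrightarrow> t \<le> 1 \<Longrightarrow> \<phi> t \<le> C * \<psi> t \<and> \<psi> t \<le> C * \<phi> t"
    using eq unfolding equivalent_on_unit_def by auto
  have \<psi>pos: "0 < \<psi> t" if "0 < t" "t \<le> 1" for t
    using C(1) C(2)[of t] pos[of t] that by (smt (verit) zero_less_mult_pos)
  have \<psi>mono: "\<psi> s powr p \<le> \<psi> t powr p" if "0 < s" "s \<le> t" "t \<le> 1" for s t
  proof -
    have "\<psi> s \<le> \<psi> t" using qc that mono_onD[of "{0..1}" \<psi> s t] by (simp add: quasi_concave_def)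
    then show ?thesis using \<psi>pos[of s] that p_ge_1 by (intro powr_mono2) auto
  qed
  have le1: "\<phi> t powr p \<le> C powr p * \<psi> t powr p" if "0 < t" "t \<le> 1" for t
    unfolding powr_mult[symmetric] using C(2)[of t] pos[of t] that p_ge_1 by (intro powr_mono2) auto
  have le2: "\<psi> t powr p \<le> C powr p * \<phi> t powr p" if "0 < t" "t \<le> 1" for t
    unfolding powr_mult[symmetric] using C(2)[of t] \<psi>pos[of t] that p_ge_1 by (intro powr_mono2) auto
  define D where "D = C powr p"
  have D: "0 < D" using C by (simp add: D_def)
  \<comment> \<open>\<open>4 powr p\<close> serves i = 1, where the ratios are at most 4 and
    monotonicity of \<phi>(t) and \<phi>(t)/t suffices on all of (0, 1]. In
    \<open>4 * D\<^sup>2\<close> one factor 2 comes from the limit, one from rounding the ratio to a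
    power of two, and each \<open>D\<close> from a passage between \<phi> and \<psi>.\<close>
  define B where "B = max (4 powr p) (4 * D\<^sup>2)"
  \<comment> \<open>Ratios up to 4^i = 2^(2i), rounded up to the next power of two, lead to
    exponents up to \<open>2 * i + 1\<close>.\<close>
  have "\<forall>i::nat. \<exists>m>0. \<forall>t j. 0 < t \<longrightarrow> t \<le> m \<longrightarrow> j \<le> 2 * i + 1 \<longrightarrow> 2 ^ j * t \<le> 1 \<and>
    \<psi> (2 ^ j * t) powr p \<le> 2 * 2 ^ j * \<psi> t powr p \<and> 2 ^ j * \<psi> t powr p \<le> 2 * \<psi> (2 ^ j * t) powr p"
  proof
    fix i :: nat
    show "\<exists>m>0. \<forall>t j. 0 < t \<longrightarrow> t \<le> m \<longrightarrow> j \<le> 2 * i + 1 \<longrightarrow> 2 ^ j * t \<le> 1 \<and>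
      \<psi> (2 ^ j * t) powr p \<le> 2 * 2 ^ j * \<psi> t powr p \<and> 2 ^ j * \<psi> t powr p \<le> 2 * \<psi> (2 ^ j * t) powr p"
      by (rule regularly_varying_dyadic[OF rv p_ge_1 \<psi>pos, of "2 * i + 1"]) blast+
  qed
  then obtain m where m: "\<And>i. 0 < m i"
    "\<And>i t j. 0 < t \<Longrightarrow> t \<le> m i \<Longrightarrow> j \<le> 2 * i + 1 \<Longrightarrow> 2 ^ j * t \<le> 1 \<and>
    \<psi> (2 ^ j * t) powr p \<le> 2 * 2 ^ j * \<psi> t powr p \<and> 2 ^ j * \<psi> t powr p \<le> 2 * \<psi> (2 ^ j * t) powr p"
    by metis
  \<comment> \<open>\<open>M 1 = 1\<close> lets the first summand live anywhere in [0, 1]; the power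
    of 1/2 forces convergence to 0, the minimum over all indices up to \<open>i\<close> forces
    monotonicity.\<close>
  define M where "M i = (if i \<le> 1 then 1 else min ((1 / 2) ^ i) (Min (m ` {..i})))" for i
  have "antimono M"
  proof (rule decseq_SucI)
    fix i
    have "Min (m ` {..Suc i}) \<le> Min (m ` {..i})" by (rule Min_antimono) auto
    moreover have "(1 / 2 :: real) ^ Suc i \<le> (1 / 2) ^ i" by simp
    moreover have "(1 / 2 :: real) ^ Suc i \<le> 1" by (rule power_le_one) auto
    ultimately show "M (Suc i) \<le> M i"
    proof (cases "i \<le> 1")
      case True
      have "M (Suc i) \<le> 1"
        unfolding M_def using \<open>(1 / 2 :: real) ^ Suc i \<le> 1\<close> by (auto simp: min_le_iff_disj simp del: power_Suc)
      then show ?thesis using True by (simp add: M_def)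
    next
      case False
      then have "M (Suc i) = min ((1 / 2) ^ Suc i) (Min (m ` {..Suc i}))" "M i = min ((1 / 2) ^ i) (Min (m ` {..i}))"
        by (auto simp: M_def)
      then show ?thesis
        using \<open>Min (m ` {..Suc i}) \<le> Min (m ` {..i})\<close> by (simp only:) (intro min.mono, auto)
    qed
  qed
  moreover have Mpos: "0 < M i" for i using m(1) by (auto simp: M_def)
  moreover have "M \<longlonglongrightarrow> 0"
  proof (rule tendsto_sandwich)
    show "\<forall>\<^sub>F i in sequentially. 0 \<le> M i" using Mpos by (simp add: less_imp_le)
    show "\<forall>\<^sub>F i in sequentially. M i \<le> (1 / 2) ^ i"
      using eventually_gt_at_top[of 1] by eventually_elim (simp add: M_def)
  qed (auto intro: LIMSEQ_power_zero)
  moreover have "almost_linear M B"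
    unfolding almost_linear_def
  proof (intro allI impI)
    fix i :: nat and a u :: real
    assume i: "1 \<le> i" and a: "0 < a" "a \<le> M i" and u: "1 \<le> u" "u \<le> 4 ^ i" "u * a \<le> 1"
    have aua: "a \<le> u * a" using a u by simp
    have h0: "0 \<le> \<phi> t powr p" for t by simp
    show "\<phi> (u * a) powr p \<le> B * (u * \<phi> a powr p) \<and> u * \<phi> a powr p \<le> B * \<phi> (u * a) powr p"
    proof (cases "i = 1")
      case True
      have "\<phi> (u * a) powr p \<le> u powr p * \<phi> a powr p"
        using powr_dilate[of a "u * a"] a u aua by simp
      also have "\<dots> \<le> 4 powr p * \<phi> a powr p"
        using u True p_ge_1 by (intro mult_right_mono powr_mono2) auto
      also have "\<dots> \<le> B * \<phi> a powr p"
        by (intro mult_right_mono) (auto simp: B_def)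
      also have "\<dots> \<le> B * (u * \<phi> a powr p)"
        using u D by (intro mult_left_mono mult_right_le_one_le) (auto simp: B_def le_max_iff_disj intro: mult_right_mono[of 1 u, simplified])
      finally have 1: "\<phi> (u * a) powr p \<le> B * (u * \<phi> a powr p)" .
      have "u * \<phi> a powr p \<le> 4 * \<phi> (u * a) powr p"
        using u True powr_mono_on[of a "u * a"] a aua by (intro mult_mono) auto
      also have "\<dots> \<le> B * \<phi> (u * a) powr p"
        using powr_mono[of 1 p "4::real"] p_ge_1 by (intro mult_right_mono) (auto simp: B_def le_max_iff_disj)
      finally show ?thesis using 1 by simp
    next
      case False
      then have "a \<le> Min (m ` {..i})" using a i by (simp add: M_def)
      also have "\<dots> \<le> m i" by (intro Min_le) auto
      finally have am: "a \<le> m i" .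
      obtain j :: nat where j: "2 ^ j \<le> u" "u < 2 ^ Suc j" using dyadic_bracket[OF u(1)] by blast
      have "(2::real) ^ j \<le> 2 ^ (2 * i)" using j u by (simp add: power_mult)
      then have j2: "j \<le> 2 * i" by simp
      have a1: "a \<le> 1" using aua u by simp
      have g1: "u * \<psi> a powr p \<le> 4 * \<psi> (u * a) powr p"
      proof -
        have "u * \<psi> a powr p \<le> 2 * (2 ^ j * \<psi> a powr p)"
          using j by (simp add: mult_right_mono flip: mult.assoc)
        also have "\<dots> \<le> 2 * (2 * \<psi> (2 ^ j * a) powr p)"
          using m(2)[OF a(1) am, of j] j2 by (intro mult_left_mono) auto
        also have "\<dots> \<le> 2 * (2 * \<psi> (u * a) powr p)"
          using j u a by (intro mult_left_mono \<psi>mono) auto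
        finally show ?thesis by simp
      qed
      have g2: "\<psi> (u * a) powr p \<le> 4 * (u * \<psi> a powr p)"
      proof -
        have "\<psi> (u * a) powr p \<le> \<psi> (2 ^ Suc j * a) powr p"
          using j u a m(2)[OF a(1) am, of "Suc j"] j2 by (intro \<psi>mono mult_right_mono) auto
        also have "\<dots> \<le> 2 * 2 ^ Suc j * \<psi> a powr p"
          using m(2)[OF a(1) am, of "Suc j"] j2 by simp
        also have "\<dots> \<le> 4 * (u * \<psi> a powr p)"
          using j by (simp add: mult_right_mono)
        finally show ?thesis .
      qed
      have "\<phi> (u * a) powr p \<le> D * \<psi> (u * a) powr p" using le1[of "u * a"] a u by (simp add: D_def)
      also have "\<dots> \<le> D * (4 * (u * \<psi> a powr p))" using g2 D by (intro mult_left_mono) auto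
      also have "\<dots> \<le> D * (4 * (u * (D * \<phi> a powr p)))"
        using le2[of a] a a1 D u by (intro mult_left_mono) (auto simp: D_def)
      also have "\<dots> = 4 * D\<^sup>2 * (u * \<phi> a powr p)" by (simp add: power2_eq_square)
      also have "\<dots> \<le> B * (u * \<phi> a powr p)" using u by (intro mult_right_mono) (auto simp: B_def)
      finally have 1: "\<phi> (u * a) powr p \<le> B * (u * \<phi> a powr p)" .
      have "u * \<phi> a powr p \<le> u * (D * \<psi> a powr p)"
        using le1[of a] a a1 u by (intro mult_left_mono) (auto simp: D_def)
      also have "\<dots> \<le> D * (4 * \<psi> (u * a) powr p)" using g1 D by (simp add: mult.left_commute)
      also have "\<dots> \<le> D * (4 * (D * \<phi> (u * a) powr p))"
        using le2[of "u * a"] a u D by (intro mult_left_mono) (auto simp: D_def)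
      also have "\<dots> = 4 * D\<^sup>2 * \<phi> (u * a) powr p" by (simp add: power2_eq_square)
      also have "\<dots> \<le> B * \<phi> (u * a) powr p" by (intro mult_right_mono) (auto simp: B_def)
      finally show ?thesis using 1 by simp
    qed
  qed
  moreover have "1 \<le> B"
    using ge_one_powr_ge_zero[of 4 p] p_ge_1 by (simp add: B_def le_max_iff_disj)
  moreover have "M 1 = 1" by (simp add: M_def)
  ultimately show ?thesis using that by blast
qed

end

section \<open>The staircase weight\<close>

lemma supp_measurable:
  assumes "x \<in> borel_measurable (lebesgue_on {0..1})"
  shows "supp x \<in> sets lebesgue"
proof -
  have "{t \<in> space (lebesgue_on {0..1}). x t \<noteq> 0} \<in> sets (lebesgue_on {0..1})"
    using assms by measurable
  then show ?thesis
    by (auto simp: supp_def sets_restrict_space_iff)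
qed

lemma AE_unit_interval: "AE t in lebesgue_on {0..1}. t \<in> {0..1::real}"
  by (rule AE_I2) simp

lemma AE_unit_interval_pos: "AE t in lebesgue_on {0..1}. 0 < t \<and> t \<le> (1::real)"
proof -
  have "AE t in lborel. t \<noteq> (0::real)" by (rule AE_lborel_singleton)
  then have "AE t in lebesgue. t \<noteq> (0::real)" by (rule AE_completion)
  then have "AE t in lebesgue_on {0..1}. t \<noteq> (0::real)"
    by (subst AE_restrict_space_iff) (auto elim: AE_mp)
  then show ?thesis using AE_unit_interval by eventually_elim auto
qed

text \<open>For \<open>t \<le> 0\<close> and positive \<open>M\<close> the \<open>LEAST\<close> ranges over an empty predicate.\<close>

definition staircase_weight :: "(nat \<Rightarrow> real) \<Rightarrow> real \<Rightarrow> real" where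
  "staircase_weight M t = (1 / 2) ^ (LEAST j. M (Suc j) < t)"

lemma staircase_weight_measurable: "staircase_weight M \<in> borel_measurable borel"
proof -
  have [measurable]: "(\<lambda>t. LEAST j. M (Suc j) < t) \<in> measurable borel (count_space UNIV)"
    by (rule measurable_Least) measurable
  show ?thesis unfolding staircase_weight_def by measurable
qed

lemma staircase_weight_pos: "0 < staircase_weight M t"
  by (simp add: staircase_weight_def)

context
  fixes M :: "nat \<Rightarrow> real" and t :: real
  assumes M: "M \<longlonglongrightarrow> 0" "antimono M" "M 1 = 1" and t: "0 < t"
begin

lemma staircase_Least: "M (Suc (LEAST j. M (Suc j) < t)) < t"
proof -
  have "(\<lambda>j. M (Suc j)) \<longlonglongrightarrow> 0" using M(1) by (rule LIMSEQ_Suc)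
  then have "\<forall>\<^sub>F j in sequentially. M (Suc j) < t" using t by (rule order_tendstoD)
  then obtain j where "M (Suc j) < t" using eventually_happens'[OF sequentially_bot] by blast
  then show ?thesis by (rule LeastI)
qed

text \<open>For k >= 1 the weight is (1/2)^k on (M (k + 1), M k]. With
  \<open>le_if_staircase_weight_le\<close> this makes (0, M i] the set of all t > 0 where the weight
  is at most (1/2)^i.\<close>

lemma staircase_weight_le:
  assumes "t \<le> M i" "1 \<le> i"
  shows "staircase_weight M t \<le> (1 / 2) ^ i"
proof -
  let ?k = "LEAST j. M (Suc j) < t"
  have "i \<le> ?k"
  proof (rule ccontr)
    assume "\<not> i \<le> ?k"
    then have "M i \<le> M (Suc ?k)" using M(2) by (intro antimonoD[of M]) auto
    then show False using staircase_Least assms by simp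
  qed
  then show ?thesis unfolding staircase_weight_def by (rule power_decreasing) auto
qed

lemma le_if_staircase_weight_le:
  assumes "staircase_weight M t \<le> (1 / 2) ^ i" "1 \<le> i"
  shows "t \<le> M i"
proof (rule ccontr)
  assume "\<not> t \<le> M i"
  then have "(LEAST j. M (Suc j) < t) \<le> i - 1" using assms by (intro Least_le) auto
  then have "(1 / 2 :: real) ^ (i - 1) \<le> staircase_weight M t"
    unfolding staircase_weight_def by (rule power_decreasing) auto
  moreover have "(1 / 2 :: real) ^ i < (1 / 2) ^ (i - 1)" using assms by (intro power_strict_decreasing) auto
  ultimately show False using assms(1) by linarith
qed

end

text \<open>For every i the reciprocal is at least 2^(i + 1) on (0, M (i + 1)], an interval of
  positive length.\<close>

lemma staircase_weight_nontrivial: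
  assumes M: "M \<longlonglongrightarrow> 0" "antimono M" "M 1 = 1" and pos: "\<And>i. 0 < M i"
  shows "nontrivial_weight (staircase_weight M)"
proof -
  have "\<not> ess_bounded_above (\<lambda>t. 1 / staircase_weight M t)"
  proof
    assume "ess_bounded_above (\<lambda>t. 1 / staircase_weight M t)"
    then obtain c where c: "AE t in lebesgue_on {0..1}. 1 / staircase_weight M t \<le> c"
      unfolding ess_bounded_above_def by blast
    obtain i where i: "c < 2 ^ i" using real_arch_pow[of 2 c] by auto
    define b where "b = M (Suc i)"
    have b: "0 < b" "b \<le> 1"
      using pos M(3) antimonoD[OF M(2), of 1 "Suc i"] by (auto simp: b_def)
    have "AE t in lebesgue_on {0..1}. t \<notin> {0<..b}"
      using c
    proof eventually_elim
      case (elim t)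
      show ?case
      proof
        assume "t \<in> {0<..b}"
        then have "staircase_weight M t \<le> (1 / 2) ^ Suc i"
          using staircase_weight_le[OF M, of t "Suc i"] by (simp add: b_def)
        then have "2 ^ Suc i \<le> 1 / staircase_weight M t"
          using staircase_weight_pos[of M t] by (simp add: field_simps)
        then have "2 ^ Suc i \<le> c" using elim by simp
        moreover have "(2::real) ^ i \<le> 2 ^ Suc i" by simp
        ultimately show False using i by linarith
      qed
    qed
    then have "{0<..b} \<in> null_sets (lebesgue_on {0..1})"
      using b by (subst AE_iff_null_sets) (auto simp: sets_restrict_space_iff)
    moreover have "{0<..b} \<subseteq> {0..1}" using b by auto
    ultimately have "emeasure lebesgue {0<..b} = 0"
      using emeasure_restrict_space[of "{0..1}" lebesgue "{0<..b}"] by (auto simp: null_sets_def)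
    then show False using b by simp
  qed
  moreover have "staircase_weight M \<in> borel_measurable lborel"
    using staircase_weight_measurable[of M] by simp
  then have "weight (staircase_weight M)"
    unfolding weight_def
    by (auto simp: staircase_weight_pos intro!: measurable_restrict_space1 measurable_completion)
  ultimately show ?thesis by (simp add: nontrivial_weight_def)
qed

context fundamental_function
begin

text \<open>A support inside [0, M i] bounds the distribution function of \<open>x i\<close> by
  \<open>M i\<close> at every positive level, so \<open>almost_linear_sum\<close> applies level by
  level. \<open>A\<close> dominates the constants of both its directions.\<close>

lemma modular_sum_almost_linear:
  assumes M: "almost_linear M B" "1 \<le> B"
    and x: "\<And>i. i \<in> {1..n} \<Longrightarrow> x i \<in> borel_measurable (lebesgue_on {0..1})"
    and disj: "AE t in lebesgue_on {0..1}. \<forall>i\<in>{1..n}. \<forall>j\<in>{1..n}. i \<noteq> j \<longrightarrow> x i t = 0 \<or> x j t = 0"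
    and small: "AE t in lebesgue_on {0..1}. \<forall>i\<in>{1..n}. x i t \<noteq> 0 \<longrightarrow> t \<le> M i"
    and Mpos: "\<And>i. 0 < M i"
  defines "A \<equiv> prim_const\<^sup>2 * (2 * B + K powr p / (1 - (1 / 4) powr (\<gamma> * p)))"
  shows "lorentz_modular p \<phi> (\<lambda>t. \<Sum>i=1..n. x i t) \<le> ennreal A * (\<Sum>i=1..n. lorentz_modular p \<phi> (x i))"
    and "(\<Sum>i=1..n. lorentz_modular p \<phi> (x i)) \<le> ennreal A * lorentz_modular p \<phi> (\<lambda>t. \<Sum>i=1..n. x i t)"
proof -
  define r where "r = (1 / 4) powr (\<gamma> * p)"
  have r: "r < 1"
    using \<gamma>_pos p_ge_1 powr_less_mono2[of "\<gamma> * p" "1/4" 1] by (auto simp: r_def)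
  have A: "A = prim_const\<^sup>2 * (2 * B + K powr p / (1 - r))" by (simp add: A_def r_def)
  have A0: "0 \<le> A" unfolding A using M r by simp
  have le: "distribution (x i) \<mu> \<le> M i" if i: "i \<in> {1..n}" and "0 < \<mu>" for i \<mu>
  proof -
    have "measure (lebesgue_on {0..1}) {s \<in> {0..1}. \<mu> < \<bar>x i s\<bar>} \<le> measure (lebesgue_on {0..1}) ({0..min 1 (M i)})"
    proof (rule unit_interval.finite_measure_mono_AE)
      show "AE t in lebesgue_on {0..1}. t \<in> {s \<in> {0..1}. \<mu> < \<bar>x i s\<bar>} \<longrightarrow> t \<in> {0..min 1 (M i)}"
        using small by eventually_elim (use i \<open>0 < \<mu>\<close> in auto)
    qed (auto simp: sets_restrict_space_iff)
    also have "\<dots> \<le> M i" using Mpos[of i] by (simp add: measure_restrict_space)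
    finally show ?thesis by (simp add: distribution_def)
  qed
  have d01: "0 \<le> distribution (x i) \<mu> \<and> distribution (x i) \<mu> \<le> 1" for i \<mu>
    by (simp add: distribution_le_1 distribution_nonneg)
  have s01: "0 \<le> (\<Sum>i=1..n. distribution (x i) \<mu>)" "(\<Sum>i=1..n. distribution (x i) \<mu>) \<le> 1" if "0 < \<mu>" for \<mu>
    using distribution_sum[OF _ x disj, of \<mu>] that distribution_le_1[of "\<lambda>t. \<Sum>i=1..n. x i t" \<mu>]
    by (auto intro: sum_nonneg simp: d01)
  have u: "prim (\<Sum>i=1..n. distribution (x i) \<mu>) \<le> A * (\<Sum>i=1..n. prim (distribution (x i) \<mu>))" if "0 < \<mu>" for \<mu>
  proof -
    have "prim (\<Sum>i=1..n. distribution (x i) \<mu>) \<le> prim_const\<^sup>2 * (2 * B) * (\<Sum>i=1..n. prim (distribution (x i) \<mu>))"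
      using M le that d01 s01[OF that] by (intro prim_sum_upper almost_linear_sum(1)[of M]) auto
    also have "\<dots> \<le> A * (\<Sum>i=1..n. prim (distribution (x i) \<mu>))"
      unfolding A using r by (intro mult_right_mono mult_left_mono sum_nonneg) auto
    finally show ?thesis .
  qed
  have l: "(\<Sum>i=1..n. prim (distribution (x i) \<mu>)) \<le> A * prim (\<Sum>i=1..n. distribution (x i) \<mu>)" if "0 < \<mu>" for \<mu>
  proof -
    have "(\<Sum>i=1..n. prim (distribution (x i) \<mu>)) \<le> prim_const\<^sup>2 * (B + K powr p / (1 - r)) * prim (\<Sum>i=1..n. distribution (x i) \<mu>)"
      using M le that d01 s01[OF that] r unfolding r_def
      by (intro prim_sum_lower almost_linear_sum(2)[of M]) auto
    also have "\<dots> \<le> A * prim (\<Sum>i=1..n. distribution (x i) \<mu>)"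
      unfolding A using M by (intro mult_right_mono mult_left_mono) auto
    finally show ?thesis .
  qed
  show "lorentz_modular p \<phi> (\<lambda>t. \<Sum>i=1..n. x i t) \<le> ennreal A * (\<Sum>i=1..n. lorentz_modular p \<phi> (x i))"
    using modular_sum_upper[OF _ x disj A0 u] by simp
  show "(\<Sum>i=1..n. lorentz_modular p \<phi> (x i)) \<le> ennreal A * lorentz_modular p \<phi> (\<lambda>t. \<Sum>i=1..n. x i t)"
    using modular_sum_lower[OF _ x disj A0 l] by simp
qed

lemma decomposable_if_regularly_varying:
  assumes "quasi_concave \<psi>" "regularly_varying_at_zero \<psi> p" "equivalent_on_unit \<phi> \<psi>"
  shows "\<exists>w. nontrivial_weight w \<and> w_decomposable w (lorentz_space p \<phi>) (lorentz_norm p \<phi>)"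
proof -
  obtain M B where B: "1 \<le> B" and M: "almost_linear M B" "M 1 = 1" "\<And>i. 0 < M i" "antimono M" "M \<longlonglongrightarrow> 0"
    using regularly_varying_almost_linear[OF assms] by blast
  define w where "w = staircase_weight M"
  have nt: "nontrivial_weight w"
    unfolding w_def using M by (intro staircase_weight_nontrivial) auto
  have w_pos: "AE t in lebesgue_on {0..1}. 0 < w t" by (simp add: w_def staircase_weight_pos)
  \<comment> \<open>Starting the decay from 1/2 aligns the indices: on the i-th support w <=
    (1/2)^i, which means t <= M i.\<close>
  have w_half: "AE t in lebesgue_on {0..1}. w t \<le> 1 / 2"
    using AE_unit_interval_pos
    by eventually_elim (use staircase_weight_le[OF M(5,4,2), of _ 1] M(2) in \<open>simp add: w_def\<close>)
  define A where "A = prim_const\<^sup>2 * (2 * B + K powr p / (1 - (1 / 4) powr (\<gamma> * p)))"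
  have "(1 / 4) powr (\<gamma> * p) < 1"
    using \<gamma>_pos p_ge_1 powr_less_mono2[of "\<gamma> * p" "1/4" 1] by auto
  then have "0 \<le> K powr p / (1 - (1 / 4) powr (\<gamma> * p))" by simp
  then have A: "0 < A" unfolding A_def using prim_const_pos B by (intro mult_pos_pos) auto
  \<comment> \<open>The comparison passes from the sum of the \<open>x i\<close> to the common sum
    of modulars and on to the sum of the \<open>y i\<close>, a factor \<open>A\<close> each time;
    the exponent \<open>1 / p\<close> returns to norms.\<close>
  define C where "C = (A\<^sup>2) powr (1 / p)"
  have C: "0 < C" "C powr p = A\<^sup>2" using A p_ge_1 by (auto simp: C_def powr_powr)
  have main: "lorentz_norm p \<phi> (\<lambda>t. \<Sum>i=1..n. x i t) \<le> ennreal C * lorentz_norm p \<phi> (\<lambda>t. \<Sum>i=1..n. y i t)"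
    if X: "\<forall>i\<in>{1..n}. x i \<in> lorentz_space p \<phi> \<and> y i \<in> lorentz_space p \<phi>
             \<and> \<not> (AE t in lebesgue_on {0..1}. x i t = 0) \<and> \<not> (AE t in lebesgue_on {0..1}. y i t = 0)
             \<and> lorentz_norm p \<phi> (x i) = lorentz_norm p \<phi> (y i)"
      and sep: "\<forall>i\<in>{1..<n}. ess_inf_on w (supp (x i) \<union> supp (y i))
             \<ge> 2 * ess_sup_on w (supp (x (i + 1)) \<union> supp (y (i + 1)))"
    for n :: nat and x y
  proof -
    let ?S = "\<lambda>i. supp (x i) \<union> supp (y i)"
    have xm: "x i \<in> borel_measurable (lebesgue_on {0..1})" and ym: "y i \<in> borel_measurable (lebesgue_on {0..1})" if "i \<in> {1..n}" for i
      using X that by (auto simp: lorentz_space_def)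
    have S: "?S i \<subseteq> {0..1} \<and> ?S i \<in> sets lebesgue" if "i \<in> {1..n}" for i
      using supp_measurable xm[OF that] ym[OF that] by (auto simp: supp_def)
    have nonnull: "\<not> (AE t in lebesgue_on {0..1}. t \<notin> ?S i)" if "i \<in> {1..n}" for i
    proof
      assume "AE t in lebesgue_on {0..1}. t \<notin> ?S i"
      then have "AE t in lebesgue_on {0..1}. x i t = 0"
        using AE_unit_interval by eventually_elim (auto simp: supp_def)
      then show False using X that by auto
    qed
    have sep': "2 * ess_sup_on w (?S (i + 1)) \<le> ess_inf_on w (?S i)" if "i \<in> {1..<n}" for i
      using sep that by blast
    have decay: "AE t in lebesgue_on {0..1}. \<forall>i\<in>{1..n}. t \<in> ?S i \<longrightarrow> w t \<le> 1 / 2 * (1 / 2) ^ (i - 1)"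
      by (rule separated_disjoint_decay(1)[where S = ?S, OF w_pos S nonnull sep' w_half])
    have disj: "AE t in lebesgue_on {0..1}. \<forall>i\<in>{1..n}. \<forall>j\<in>{1..n}. i \<noteq> j \<longrightarrow> t \<notin> ?S i \<or> t \<notin> ?S j"
      by (rule separated_disjoint_decay(2)[where S = ?S, OF w_pos S nonnull sep' w_half])
    have small: "AE t in lebesgue_on {0..1}. \<forall>i\<in>{1..n}. t \<in> ?S i \<longrightarrow> t \<le> M i"
      using decay AE_unit_interval_pos
    proof eventually_elim
      case (elim t)
      show ?case
      proof (intro ballI impI)
        fix i assume i: "i \<in> {1..n}" "t \<in> ?S i"
        then have "w t \<le> (1 / 2) ^ i" using elim by (cases i) auto
        then show "t \<le> M i"
          using le_if_staircase_weight_le[OF M(5,4,2), of t i] elim i by (simp add: w_def)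
      qed
    qed
    have dx: "AE t in lebesgue_on {0..1}. \<forall>i\<in>{1..n}. \<forall>j\<in>{1..n}. i \<noteq> j \<longrightarrow> x i t = 0 \<or> x j t = 0"
      and dy: "AE t in lebesgue_on {0..1}. \<forall>i\<in>{1..n}. \<forall>j\<in>{1..n}. i \<noteq> j \<longrightarrow> y i t = 0 \<or> y j t = 0"
      using disj AE_unit_interval by (eventually_elim, auto simp: supp_def)+
    have sx: "AE t in lebesgue_on {0..1}. \<forall>i\<in>{1..n}. x i t \<noteq> 0 \<longrightarrow> t \<le> M i"
      and sy: "AE t in lebesgue_on {0..1}. \<forall>i\<in>{1..n}. y i t \<noteq> 0 \<longrightarrow> t \<le> M i"
      using small AE_unit_interval by (eventually_elim, auto simp: supp_def)+
    have "lorentz_modular p \<phi> (\<lambda>t. \<Sum>i=1..n. x i t) \<le> ennreal A * (\<Sum>i=1..n. lorentz_modular p \<phi> (x i))"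
      unfolding A_def by (rule modular_sum_almost_linear(1)[OF M(1) B xm dx sx M(3)])
    also have "(\<Sum>i=1..n. lorentz_modular p \<phi> (x i)) = (\<Sum>i=1..n. lorentz_modular p \<phi> (y i))"
      using X p_ge_1 by (intro sum.cong lorentz_modular_eq_if_norm_eq) auto
    also have "ennreal A * \<dots> \<le> ennreal A * (ennreal A * lorentz_modular p \<phi> (\<lambda>t. \<Sum>i=1..n. y i t))"
      unfolding A_def by (intro mult_left_mono modular_sum_almost_linear(2)[OF M(1) B ym dy sy M(3)]) auto
    also have "\<dots> = ennreal (C powr p) * lorentz_modular p \<phi> (\<lambda>t. \<Sum>i=1..n. y i t)"
      using A by (simp add: C ennreal_mult[symmetric] power2_eq_square flip: mult.assoc)
    finally show ?thesis
      using lorentz_norm_le_iff[OF p_ge_1 C(1)] by blast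
  qed
  have "w_decomposable w (lorentz_space p \<phi>) (lorentz_norm p \<phi>)"
    unfolding w_decomposable_def
  proof (intro exI[of _ C] conjI allI impI C(1))
    fix n :: nat and x y :: "nat \<Rightarrow> real \<Rightarrow> real"
    assume X: "\<forall>i\<in>{1..n}. x i \<in> lorentz_space p \<phi> \<and> y i \<in> lorentz_space p \<phi>
             \<and> \<not> (AE t in lebesgue_on {0..1}. x i t = 0) \<and> \<not> (AE t in lebesgue_on {0..1}. y i t = 0)
             \<and> lorentz_norm p \<phi> (x i) = lorentz_norm p \<phi> (y i)"
      and sep: "\<forall>i\<in>{1..<n}. ess_inf_on w (supp (x i) \<union> supp (y i))
             \<ge> 2 * ess_sup_on w (supp (x (i + 1)) \<union> supp (y (i + 1)))"
    have 1: "lorentz_norm p \<phi> (\<lambda>t. \<Sum>i=1..n. x i t) \<le> ennreal C * lorentz_norm p \<phi> (\<lambda>t. \<Sum>i=1..n. y i t)"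
      using main[OF X sep] .
    \<comment> \<open>The hypotheses are symmetric in \<open>x\<close> and \<open>y\<close>, so
      \<open>main\<close> applies with the roles exchanged.\<close>
    show "lorentz_norm p \<phi> (\<lambda>t. \<Sum>i=1..n. y i t) \<le> ennreal C * lorentz_norm p \<phi> (\<lambda>t. \<Sum>i=1..n. x i t)"
      by (rule main) (use X sep in \<open>auto simp: Un_commute\<close>)
    have "ennreal (1 / C) * lorentz_norm p \<phi> (\<lambda>t. \<Sum>i=1..n. x i t) \<le>
      ennreal (1 / C) * (ennreal C * lorentz_norm p \<phi> (\<lambda>t. \<Sum>i=1..n. y i t))"
      using 1 by (intro mult_left_mono) auto
    also have "\<dots> = lorentz_norm p \<phi> (\<lambda>t. \<Sum>i=1..n. y i t)"
      using C(1) by (simp add: ennreal_mult[symmetric] flip: mult.assoc)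
    finally show "ennreal (1 / C) * lorentz_norm p \<phi> (\<lambda>t. \<Sum>i=1..n. x i t) \<le> lorentz_norm p \<phi> (\<lambda>t. \<Sum>i=1..n. y i t)" .
  qed
  then show ?thesis using nt by blast
qed

end

section \<open>Decomposability implies regular variation\<close>

text \<open>The measure of \<open>E \<inter> {0..t}\<close> is a 1-Lipschitz function of t, so the
  intermediate value theorem applies to it.\<close>

lemma subset_of_given_measure:
  assumes E: "E \<in> sets lebesgue" "E \<subseteq> {0..1::real}" and a: "0 \<le> a" "a \<le> measure lebesgue E"
  obtains A where "A \<subseteq> E" "A \<in> sets lebesgue" "measure lebesgue A = a"
proof -
  define f where "f t = measure lebesgue (E \<inter> {0..t})" for t :: real
  have fm: "E \<inter> {0..t} \<in> lmeasurable" for t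
    using E by (intro fmeasurable_Int_fmeasurable bounded_set_imp_lmeasurable bounded_subset[of "{0..1}" E]) auto
  have lip: "f s \<le> f t \<and> f t \<le> f s + (t - s)" if "s \<le> t" for s t
  proof
    show "f s \<le> f t" unfolding f_def using that fm by (intro measure_mono_fmeasurable) auto
    have "f t \<le> measure lebesgue ((E \<inter> {0..s}) \<union> {s..t})"
      unfolding f_def using fm that by (intro measure_mono_fmeasurable fmeasurable.Un) auto
    also have "\<dots> \<le> f s + measure lebesgue {s..t}"
      unfolding f_def using fm by (intro measure_Un_le) auto
    finally show "f t \<le> f s + (t - s)" using that by simp
  qed
  have "\<bar>f t - f s\<bar> \<le> \<bar>t - s\<bar>" for s t
    using lip[of s t] lip[of t s] by (cases "s \<le> t") auto
  then have "continuous_on {0..1} f"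
    unfolding continuous_on_iff dist_real_def by (meson le_less_trans)
  moreover have "f 0 \<le> a"
  proof -
    have "E \<inter> {0..0} = {} \<or> E \<inter> {0..0} = {0}" by auto
    then have "f 0 = 0" unfolding f_def by (elim disjE) (simp_all only: measure_empty, simp)
    then show ?thesis using a by simp
  qed
  moreover have "E \<inter> {0..1} = E" using E by auto
  then have "a \<le> f 1" using a by (simp add: f_def)
  ultimately obtain t where "f t = a" using IVT'[of f 0 a 1] by auto
  then show ?thesis using that[of "E \<inter> {0..t}"] fm[of t] by (auto simp: f_def fmeasurable_def)
qed

lemma measure_unit_interval_restrict:
  "S \<subseteq> {0..1::real} \<Longrightarrow> measure (lebesgue_on {0..1}) S = measure lebesgue S"
  by (intro measure_restrict_space) auto

lemma weight_level_sets:
  fixes w :: "real \<Rightarrow> real"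
  assumes "w \<in> borel_measurable (lebesgue_on {0..1})"
  shows "{t \<in> {0..1}. \<alpha> \<le> w t \<and> w t \<le> \<beta>} \<in> sets lebesgue"
proof -
  have "{t \<in> space (lebesgue_on {0..1}). \<alpha> \<le> w t \<and> w t \<le> \<beta>} \<in> sets (lebesgue_on {0..1})"
    using assms by measurable
  then show ?thesis by (auto simp: sets_restrict_space_iff)
qed

lemma level_set_positive_measure:
  fixes w :: "real \<Rightarrow> real"
  assumes w: "w \<in> borel_measurable (lebesgue_on {0..1})"
    and "\<not> (AE t in lebesgue_on {0..1}. \<not> (\<alpha> \<le> w t \<and> w t \<le> \<beta>))"
  shows "0 < measure lebesgue {t \<in> {0..1}. \<alpha> \<le> w t \<and> w t \<le> \<beta>}"
proof (rule ccontr)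
  let ?S = "{t \<in> {0..1}. \<alpha> \<le> w t \<and> w t \<le> \<beta>}"
  assume "\<not> ?thesis"
  moreover have "?S \<subseteq> {0..1}" by blast
  ultimately have "measure (lebesgue_on {0..1}) ?S = 0"
    by (simp only: measure_unit_interval_restrict zero_less_measure_iff not_not)
  moreover have "?S \<in> sets (lebesgue_on {0..1})"
    using weight_level_sets[OF w] by (auto simp: sets_restrict_space_iff)
  ultimately have "?S \<in> null_sets (lebesgue_on {0..1})"
    by (auto simp: null_sets_def unit_interval.emeasure_eq_measure)
  then have "AE t in lebesgue_on {0..1}. t \<notin> ?S" by (rule AE_not_in)
  then have "AE t in lebesgue_on {0..1}. \<not> (\<alpha> \<le> w t \<and> w t \<le> \<beta>)"
    using AE_unit_interval by eventually_elim auto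
  then show False using assms(2) by simp
qed

text \<open>If \<open>1 / w\<close> is unbounded, the set where \<open>w\<close> is at most e is not
  null for any e > 0, and by countable additivity neither is the part with w >= d for some d > 0;
  d/2 is the next upper edge. If \<open>w\<close> is unbounded, windows are built upwards in the
  same way.\<close>

lemma separated_level_sets:
  assumes "nontrivial_weight w"
  obtains \<alpha> \<beta> :: "nat \<Rightarrow> real" where "\<And>i. i \<le> n \<Longrightarrow> 0 < \<alpha> i"
    "\<And>i. i \<le> n \<Longrightarrow> 0 < measure lebesgue {t \<in> {0..1}. \<alpha> i \<le> w t \<and> w t \<le> \<beta> i}"
    "\<And>i. i < n \<Longrightarrow> 2 * \<beta> (i + 1) \<le> \<alpha> i"
proof -
  have w: "w \<in> borel_measurable (lebesgue_on {0..1})" "AE t in lebesgue_on {0..1}. 0 < w t"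
    using assms by (auto simp: nontrivial_weight_def weight_def)
  consider "\<not> ess_bounded_above (\<lambda>t. 1 / w t)" | "\<not> ess_bounded_above w"
    using assms by (auto simp: nontrivial_weight_def)
  then show ?thesis
  proof cases
    case 1
    have "\<exists>d>0. 0 < measure lebesgue {t \<in> {0..1}. d \<le> w t \<and> w t \<le> e}" if "0 < e" for e
    proof (rule ccontr)
      assume "\<not> ?thesis"
      then have "AE t in lebesgue_on {0..1}. \<not> (1 / real (Suc n) \<le> w t \<and> w t \<le> e)" for n
        using level_set_positive_measure[OF w(1), of "1 / real (Suc n)" e] by (auto simp del: of_nat_Suc)
      then have "AE t in lebesgue_on {0..1}. \<forall>n. \<not> (1 / real (Suc n) \<le> w t \<and> w t \<le> e)"
        by (subst AE_all_countable) blast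
      then have "AE t in lebesgue_on {0..1}. 1 / w t \<le> 1 / e"
        using w(2)
      proof eventually_elim
        case (elim t)
        obtain n where "inverse (real (Suc n)) < w t" using reals_Archimedean elim by blast
        then have "1 / real (Suc n) \<le> w t" by (simp add: inverse_eq_divide)
        then have "e < w t" using elim by (meson not_le)
        then show ?case using \<open>0 < e\<close> by (intro divide_left_mono) auto
      qed
      then show False using 1 by (auto simp: ess_bounded_above_def)
    qed
    then obtain d where d: "\<And>e. 0 < e \<Longrightarrow> 0 < d e \<and> 0 < measure lebesgue {t \<in> {0..1}. d e \<le> w t \<and> w t \<le> e}"
      by metis
    define e where "e = rec_nat 1 (\<lambda>_ e. d e / 2)"
    have e: "e 0 = 1" "e (Suc k) = d (e k) / 2" for k by (auto simp: e_def)
    have epos: "0 < e k" for k by (induction k) (auto simp: e d)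
    show ?thesis using d epos by (intro that[of "\<lambda>i. d (e i)" e]) (auto simp: e)
  next
    case 2
    have "\<exists>L. 0 < measure lebesgue {t \<in> {0..1}. k \<le> w t \<and> w t \<le> L}" for k
    proof (rule ccontr)
      assume "\<not> ?thesis"
      then have "AE t in lebesgue_on {0..1}. \<not> (k \<le> w t \<and> w t \<le> real n)" for n
        using level_set_positive_measure[OF w(1), of k "real n"] by auto
      then have "AE t in lebesgue_on {0..1}. \<forall>n. \<not> (k \<le> w t \<and> w t \<le> real n)"
        by (subst AE_all_countable) blast
      then have "AE t in lebesgue_on {0..1}. w t \<le> k"
      proof eventually_elim
        case (elim t)
        obtain n where "w t \<le> real n" using real_arch_simple by blast
        then show ?case using elim by (meson linear)
      qed
      then show False using 2 by (auto simp: ess_bounded_above_def)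
    qed
    then obtain L where L: "\<And>k. 0 < measure lebesgue {t \<in> {0..1}. k \<le> w t \<and> w t \<le> L k}" by metis
    \<comment> \<open>A window of positive measure is nonempty, so its edges are in order; this
      keeps all edges \<open>e k\<close> positive.\<close>
    have L_le: "k \<le> L k" for k
    proof (rule ccontr)
      assume "\<not> k \<le> L k"
      then have "{t \<in> {0..1}. k \<le> w t \<and> w t \<le> L k} = {}" by auto
      then have "measure lebesgue {t \<in> {0..1}. k \<le> w t \<and> w t \<le> L k} = 0" by (simp only: measure_empty)
      then show False using L[of k] by linarith
    qed
    define e where "e = rec_nat 1 (\<lambda>_ k. 2 * L k)"
    have e: "e 0 = 1" "e (Suc k) = 2 * L (e k)" for k by (auto simp: e_def)
    have epos: "0 < e k" for k
    proof (induction k)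
      case (Suc k) then show ?case using L_le[of "e k"] by (simp add: e)
    qed (simp add: e)
    show ?thesis
    \<comment> \<open>These windows climb, whereas decomposability lists supports with decreasing
      \<open>w\<close>. Reversing the order is possible because only finitely many windows are
      requested.\<close>
    proof (rule that[of "\<lambda>i. e (n - i)" "\<lambda>i. L (e (n - i))"])
      fix i assume "i < n"
      then have "n - i = Suc (n - (i + 1))" by simp
      then show "2 * L (e (n - (i + 1))) \<le> e (n - i)" by (simp only: e)
    qed (rule epos, rule L)
  qed
qed

lemma distribution_indicator:
  assumes "A \<subseteq> {0..1}" "0 < c" "0 \<le> l"
  shows "distribution (\<lambda>t. c * indicator A t) l = (if l < c then measure lebesgue A else 0)"
proof -
  have "{s \<in> {0..1}. l < \<bar>c * indicator A s\<bar>} = (if l < c then A else {})"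
    using assms by (auto simp: indicator_def)
  then show ?thesis
    using assms(1) by (simp add: distribution_def measure_unit_interval_restrict)
qed

lemma indicator_measurable_unit:
  assumes "A \<subseteq> {0..1::real}" "A \<in> sets lebesgue"
  shows "(\<lambda>t. c * indicator A t :: real) \<in> borel_measurable (lebesgue_on {0..1})"
proof -
  have "A \<in> sets (lebesgue_on {0..1})" using assms by (subst sets_restrict_space_iff) auto
  then show ?thesis by (intro borel_measurable_times borel_measurable_indicator) auto
qed

lemma measure_unit_subset:
  assumes "A \<subseteq> {0..1::real}" shows "measure lebesgue A \<le> 1"
  using unit_interval.bounded_measure[of A] measure_unit_interval measure_unit_interval_restrict[OF assms] by simp

context fundamental_function
begin

text \<open>Height and measure separate: the distribution function is constant below level
  \<open>c\<close> and zero from there on, so \<open>c\<close> contributes only the length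
  \<open>c powr p\<close> of an interval of levels.\<close>

lemma modular_indicator:
  assumes A: "A \<subseteq> {0..1}" "A \<in> sets lebesgue" and c: "0 < c"
  shows "lorentz_modular p \<phi> (\<lambda>t. c * indicator A t) = ennreal (c powr p * prim (measure lebesgue A))"
proof -
  have iff: "\<mu> powr (1 / p) < c \<longleftrightarrow> \<mu> < c powr p" if "0 < \<mu>" for \<mu>
  proof -
    have "\<mu> powr (1 / p) < c \<longleftrightarrow> (\<mu> powr (1 / p)) powr p < c powr p"
      using p_ge_1 c powr_less_mono2[of p "\<mu> powr (1 / p)" c] powr_mono2[of p c "\<mu> powr (1 / p)"] by fastforce
    then show ?thesis using that p_ge_1 by (simp add: powr_powr)
  qed
  have "lorentz_modular p \<phi> (\<lambda>t. c * indicator A t) =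
    (\<integral>\<^sup>+ \<mu>. ennreal (prim (measure lebesgue A)) * indicator {0<..<c powr p} \<mu> \<partial>lborel)"
    unfolding modular_layer_cake[OF indicator_measurable_unit[OF A]]
  proof (intro nn_integral_cong)
    fix \<mu> :: real
    show "ennreal (prim (distribution (\<lambda>t. c * indicator A t) (\<mu> powr (1 / p)))) * indicator {0<..} \<mu> =
       ennreal (prim (measure lebesgue A)) * indicator {0<..<c powr p} \<mu>"
      using iff[of \<mu>] distribution_indicator[OF A(1) c, of "\<mu> powr (1 / p)"] by (auto simp: indicator_def)
  qed
  also have "\<dots> = ennreal (c powr p * prim (measure lebesgue A))"
    by (subst nn_integral_cmult_indicator) (auto simp: ennreal_mult[symmetric] mult.commute)
  finally show ?thesis .
qed

end

section \<open>Lacunary sequences of measures\<close>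

lemma halving_sum_le:
  fixes q :: "nat \<Rightarrow> real"
  assumes half: "\<And>i. q (Suc i) \<le> q i / 2" and nonneg: "\<And>i. 0 \<le> q i"
    and J: "finite J" "\<And>j. j \<in> J \<Longrightarrow> k \<le> j"
  shows "sum q J \<le> 2 * q k"
proof (cases "J = {}")
  case False
  define m where "m = Max J"
  have "k \<le> m" unfolding m_def using False J by (intro J(2) Max_in)
  \<comment> \<open>The additional \<open>q m\<close> dominates the whole tail after m, which closes
    the induction.\<close>
  then have *: "sum q {k..m} + q m \<le> 2 * q k"
  proof (induction m rule: nat_induct_at_least)
    case (Suc m)
    then show ?case using half[of m] by simp
  qed simp
  have "sum q J \<le> sum q {k..m}"
    using J nonneg by (intro sum_mono2) (auto simp: m_def)
  then show ?thesis using * nonneg[of m] by simp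
qed (simp add: nonneg)

context fundamental_function
begin

lemma halving_ratio:
  obtains r where "0 < r" "r \<le> 1 / 2" "\<And>s. 0 < s \<Longrightarrow> s \<le> 1 \<Longrightarrow> \<phi> (r * s) powr p \<le> \<phi> s powr p / 2"
proof -
  \<comment> \<open>The second entry solves \<open>K powr p * r powr (\<gamma> * p) = 1 / 2\<close>,
    which halves \<open>\<phi> powr p\<close>; the entry 1/2 makes the measures themselves halve as
    well.\<close>
  define r where "r = min (1 / 2) ((1 / (2 * K powr p)) powr (1 / (\<gamma> * p)))"
  have gp: "0 < \<gamma> * p" using \<gamma>_pos p_ge_1 by simp
  have r: "0 < r" "r \<le> 1 / 2" using K_pos by (auto simp: r_def)
  have "r powr (\<gamma> * p) \<le> ((1 / (2 * K powr p)) powr (1 / (\<gamma> * p))) powr (\<gamma> * p)"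
    using gp r by (intro powr_mono2) (auto simp: r_def)
  also have "\<dots> = 1 / (2 * K powr p)" using \<gamma>_pos p_ge_1 K_pos by (simp add: powr_powr)
  finally have *: "K powr p * r powr (\<gamma> * p) \<le> 1 / 2" using K_pos by (simp add: field_simps)
  have "\<phi> (r * s) powr p \<le> \<phi> s powr p / 2" if s: "0 < s" "s \<le> 1" for s
  proof -
    have "\<phi> (r * s) powr p \<le> K powr p * r powr (\<gamma> * p) * \<phi> s powr p"
      using powr_decay[of "r * s" s] r s mult_right_mono[of r 1 s] by simp
    also have "\<dots> \<le> 1 / 2 * \<phi> s powr p" using * by (intro mult_right_mono) auto
    finally show ?thesis by simp
  qed
  then show ?thesis using that r by blast
qed

context
  fixes b :: "nat \<Rightarrow> real" and J :: "nat set"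
  assumes b: "\<And>i. 0 < b i" "\<And>i. b i \<le> 1" "\<And>i. b (Suc i) \<le> b i / 2"
      "\<And>i. \<phi> (b (Suc i)) powr p \<le> \<phi> (b i) powr p / 2"
    and J: "finite J" "sum b J \<le> 1"
begin

text \<open>The first index k of \<open>J\<close> decides everything: \<open>sum b J\<close> lies
  between \<open>b k\<close> and \<open>2 * b k\<close>, and the sum of the
  \<open>\<phi> (b i) powr p\<close> lies between its k-th term and twice that term.\<close>

lemma lacunary_sum:
  shows "\<phi> (sum b J) powr p \<le> 2 powr p * (\<Sum>i\<in>J. \<phi> (b i) powr p)"
    and "(\<Sum>i\<in>J. \<phi> (b i) powr p) \<le> 2 * \<phi> (sum b J) powr p"
proof -
  have b0: "0 \<le> b i" for i using b(1)[of i] by simp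
  have "\<phi> (sum b J) powr p \<le> 2 powr p * (\<Sum>i\<in>J. \<phi> (b i) powr p) \<and>
    (\<Sum>i\<in>J. \<phi> (b i) powr p) \<le> 2 * \<phi> (sum b J) powr p"
  proof (cases "J = {}")
    case True then show ?thesis by (simp add: zero)
  next
    case False
    define k where "k = Min J"
    have k: "k \<in> J" "\<And>j. j \<in> J \<Longrightarrow> k \<le> j" using False J by (auto simp: k_def)
    have bk: "b k \<le> sum b J" using k J b0 by (intro member_le_sum) auto
    have s2: "sum b J \<le> 2 * b k" using b J k b0 by (intro halving_sum_le) auto
    have "\<phi> (sum b J) powr p \<le> (sum b J / b k) powr p * \<phi> (b k) powr p"
      using powr_dilate[of "b k" "sum b J"] b J bk by simp
    also have "\<dots> \<le> 2 powr p * \<phi> (b k) powr p"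
      using b(1)[of k] s2 bk p_ge_1 by (intro mult_right_mono powr_mono2) (auto simp: field_simps)
    also have "\<dots> \<le> 2 powr p * (\<Sum>i\<in>J. \<phi> (b i) powr p)"
      using J k by (intro mult_left_mono member_le_sum) auto
    finally have 1: "\<phi> (sum b J) powr p \<le> 2 powr p * (\<Sum>i\<in>J. \<phi> (b i) powr p)" .
    have "(\<Sum>i\<in>J. \<phi> (b i) powr p) \<le> 2 * \<phi> (b k) powr p"
      using b J k by (intro halving_sum_le) auto
    also have "\<dots> \<le> 2 * \<phi> (sum b J) powr p"
      using b0 bk J by (intro mult_left_mono powr_mono_on) auto
    finally show ?thesis using 1 by simp
  qed
  then show "\<phi> (sum b J) powr p \<le> 2 powr p * (\<Sum>i\<in>J. \<phi> (b i) powr p)"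
    "(\<Sum>i\<in>J. \<phi> (b i) powr p) \<le> 2 * \<phi> (sum b J) powr p" by auto
qed

end

text \<open>Indicators of sets with lacunary measures span a copy of \<open>\<ell>\<^sub>p\<close>, whatever their heights.\<close>

lemma lacunary_modular:
  assumes b: "\<And>i. 0 < b i" "\<And>i. b i \<le> 1" "\<And>i. b (Suc i) \<le> b i / 2"
      "\<And>i. \<phi> (b (Suc i)) powr p \<le> \<phi> (b i) powr p / 2"
    and B: "\<And>i. i \<in> {1..n} \<Longrightarrow> B i \<subseteq> {0..1} \<and> B i \<in> sets lebesgue \<and> measure lebesgue (B i) = b i"
    and disj: "disjoint_family_on B {1..n}" and c: "\<And>i. i \<in> {1..n} \<Longrightarrow> 0 < c i"
  defines "A \<equiv> prim_const\<^sup>2 * (2 * 2 powr p)"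
  shows "lorentz_modular p \<phi> (\<lambda>t. \<Sum>i=1..n. c i * indicator (B i) t)
      \<le> ennreal A * (\<Sum>i=1..n. lorentz_modular p \<phi> (\<lambda>t. c i * indicator (B i) t))"
    and "(\<Sum>i=1..n. lorentz_modular p \<phi> (\<lambda>t. c i * indicator (B i) t))
      \<le> ennreal A * lorentz_modular p \<phi> (\<lambda>t. \<Sum>i=1..n. c i * indicator (B i) t)"
proof -
  let ?x = "\<lambda>i t. c i * indicator (B i) t"
  have x: "?x i \<in> borel_measurable (lebesgue_on {0..1})" if "i \<in> {1..n}" for i
    using B[OF that] by (intro indicator_measurable_unit) auto
  have dx: "AE t in lebesgue_on {0..1}. \<forall>i\<in>{1..n}. \<forall>j\<in>{1..n}. i \<noteq> j \<longrightarrow> ?x i t = 0 \<or> ?x j t = 0"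
    using disj by (intro AE_I2) (auto simp: disjoint_family_on_def indicator_def)
  have A0: "0 \<le> A" by (simp add: A_def)
  have bd: "prim (\<Sum>i=1..n. distribution (?x i) \<mu>) \<le> A * (\<Sum>i=1..n. prim (distribution (?x i) \<mu>)) \<and>
      (\<Sum>i=1..n. prim (distribution (?x i) \<mu>)) \<le> A * prim (\<Sum>i=1..n. distribution (?x i) \<mu>)"
    if \<mu>: "0 < \<mu>" for \<mu>
  proof -
    \<comment> \<open>At a fixed level the heights only decide which summands are still present, and
      the constants of \<open>lacunary_sum\<close> are the same for every such subset.\<close>
    define J where "J = {i \<in> {1..n}. \<mu> < c i}"
    have D: "distribution (?x i) \<mu> = (if \<mu> < c i then b i else 0)" if "i \<in> {1..n}" for i
      using B[OF that] c[OF that] \<mu> by (subst distribution_indicator) auto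
    have S: "(\<Sum>i=1..n. distribution (?x i) \<mu>) = sum b J"
      unfolding J_def by (subst sum.inter_filter) (auto intro!: sum.cong simp: D)
    have P: "(\<Sum>i=1..n. prim (distribution (?x i) \<mu>)) = (\<Sum>i\<in>J. prim (b i))"
      unfolding J_def by (subst sum.inter_filter) (auto intro!: sum.cong simp: D)
    have J: "finite J" by (simp add: J_def)
    have s1: "sum b J \<le> 1"
      using distribution_sum[OF _ x dx, of \<mu>] distribution_le_1[of "\<lambda>t. \<Sum>i=1..n. ?x i t" \<mu>] \<mu> S by simp
    have b01: "0 \<le> b i \<and> b i \<le> 1" for i using b(1)[of i] b(2)[of i] by simp
    have s0: "0 \<le> sum b J" using b01 by (intro sum_nonneg) auto
    have "prim (sum b J) \<le> prim_const\<^sup>2 * 2 powr p * (\<Sum>i\<in>J. prim (b i))"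
      using b01 s0 s1 lacunary_sum(1)[OF b J s1] by (intro prim_sum_upper) auto
    also have "\<dots> \<le> A * (\<Sum>i\<in>J. prim (b i))"
      unfolding A_def by (intro mult_right_mono mult_left_mono sum_nonneg) auto
    finally have 1: "prim (sum b J) \<le> A * (\<Sum>i\<in>J. prim (b i))" .
    have "(\<Sum>i\<in>J. prim (b i)) \<le> prim_const\<^sup>2 * 2 * prim (sum b J)"
      using b01 s0 s1 lacunary_sum(2)[OF b J s1] by (intro prim_sum_lower) auto
    also have "\<dots> \<le> A * prim (sum b J)"
      unfolding A_def using p_ge_1 ge_one_powr_ge_zero[of 2 p] by (intro mult_right_mono mult_left_mono) auto
    finally show ?thesis using 1 S P by simp
  qed
  show "lorentz_modular p \<phi> (\<lambda>t. \<Sum>i=1..n. ?x i t) \<le> ennreal A * (\<Sum>i=1..n. lorentz_modular p \<phi> (?x i))"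
    using modular_sum_upper[of "{1..n}" ?x, OF _ x dx A0] bd by simp
  show "(\<Sum>i=1..n. lorentz_modular p \<phi> (?x i)) \<le> ennreal A * lorentz_modular p \<phi> (\<lambda>t. \<Sum>i=1..n. ?x i t)"
    using modular_sum_lower[of "{1..n}" ?x, OF _ x dx A0] bd by simp
qed

end

section \<open>Test families on level sets of the weight\<close>

lemma ess_sup_on_le:
  assumes w: "w \<in> borel_measurable (lebesgue_on {0..1})" and S: "S \<subseteq> {0..1}" "\<And>t. t \<in> S \<Longrightarrow> w t \<le> \<beta>"
  shows "ess_sup_on w S \<le> ereal \<beta>"
proof -
  have [measurable]: "w \<in> borel_measurable (lebesgue_on S)"
    using w S(1) by (rule measurable_restrict_mono)
  have "AE t in lebesgue_on S. ereal (w t) \<le> ereal \<beta>"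
    using S(2) by (intro AE_I2) (auto simp: space_restrict_space)
  then show ?thesis unfolding ess_sup_on_def by (intro esssup_I) measurable
qed

lemma ess_inf_on_ge:
  assumes w: "w \<in> borel_measurable (lebesgue_on {0..1})" and S: "S \<subseteq> {0..1}" "\<And>t. t \<in> S \<Longrightarrow> \<alpha> \<le> w t"
  shows "ereal \<alpha> \<le> ess_inf_on w S"
proof -
  have [measurable]: "w \<in> borel_measurable (lebesgue_on S)"
    using w S(1) by (rule measurable_restrict_mono)
  have "AE t in lebesgue_on S. - ereal (w t) \<le> ereal (- \<alpha>)"
    using S(2) by (intro AE_I2) (auto simp: space_restrict_space)
  then have "esssup (lebesgue_on S) (\<lambda>t. - ereal (w t)) \<le> ereal (- \<alpha>)"
    by (intro esssup_I) measurable
  then have "- ereal (- \<alpha>) \<le> ess_inf_on w S" unfolding ess_inf_on_def by (subst ereal_minus_le_minus)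
  then show ?thesis by simp
qed

lemma indicator_nonnull:
  assumes A: "A \<subseteq> {0..1::real}" "A \<in> sets lebesgue" "0 < measure lebesgue A" and "0 < c"
  shows "\<not> (AE t in lebesgue_on {0..1}. c * indicator A t = (0::real))"
proof
  assume "AE t in lebesgue_on {0..1}. c * indicator A t = (0::real)"
  then have "AE t in lebesgue_on {0..1}. t \<notin> A"
    by eventually_elim (use \<open>0 < c\<close> in \<open>auto simp: indicator_def\<close>)
  moreover have "A \<in> sets (lebesgue_on {0..1})" using A by (subst sets_restrict_space_iff) auto
  ultimately have "measure (lebesgue_on {0..1}) A = 0"
    using AE_iff_null_sets[of A "lebesgue_on {0..1}"] by (auto simp: null_sets_def measure_def)
  then show False using A measure_unit_interval_restrict[OF A(1)] by simp
qed

lemma separated_intervals: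
  fixes \<alpha> \<beta> :: "nat \<Rightarrow> real"
  assumes "\<And>i. i \<le> n \<Longrightarrow> 0 < \<alpha> i" "\<And>i. i \<le> n \<Longrightarrow> \<alpha> i \<le> \<beta> i" "\<And>i. i < n \<Longrightarrow> 2 * \<beta> (i + 1) \<le> \<alpha> i"
    and "i < j" "j \<le> n"
  shows "\<beta> j < \<alpha> i"
proof -
  have "Suc i \<le> j" using assms by simp
  then have "2 * \<beta> j \<le> \<alpha> i" using \<open>j \<le> n\<close>
  proof (induction j rule: nat_induct_at_least)
    case base then show ?case using assms(3)[of i] by simp
  next
    case (Suc j)
    then show ?case using assms(1)[of j] assms(2)[of j] assms(3)[of j] by simp
  qed
  then show ?thesis using assms(1)[of j] assms(2)[of j] \<open>j \<le> n\<close> by simp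
qed

context fundamental_function
begin

lemma indicator_in_space:
  assumes "A \<subseteq> {0..1}" "A \<in> sets lebesgue" "0 < c"
  shows "(\<lambda>t. c * indicator A t) \<in> lorentz_space p \<phi>"
  using indicator_measurable_unit[OF assms(1,2)] modular_indicator[OF assms]
  by (simp add: lorentz_space_def lorentz_norm_modular less_top[symmetric])

text \<open>The sum of n indicators of measure \<open>a\<close> is an indicator of measure
  \<open>n * a\<close>, with modular \<open>prim (n * a)\<close>. Lacunary indicators on the same
  level sets, with heights adjusted to equal norms, have a sum of modular about
  \<open>n * prim a\<close>. In \<open>D\<close>, decomposability contributes
  \<open>C powr p\<close> and \<open>lacunary_modular\<close> the rest.\<close>

lemma decomposable_growth_at:
  assumes w: "w \<in> borel_measurable (lebesgue_on {0..1})"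
    and C: "0 < C"
    and dec: "\<And>x y. \<lbrakk>\<forall>i\<in>{1..n}. x i \<in> lorentz_space p \<phi> \<and> y i \<in> lorentz_space p \<phi>
             \<and> \<not> (AE t in lebesgue_on {0..1}. x i t = 0)
             \<and> \<not> (AE t in lebesgue_on {0..1}. y i t = 0)
             \<and> lorentz_norm p \<phi> (x i) = lorentz_norm p \<phi> (y i);
             \<forall>i\<in>{1..<n}. ess_inf_on w (supp (x i) \<union> supp (y i))
             \<ge> 2 * ess_sup_on w (supp (x (i + 1)) \<union> supp (y (i + 1)))\<rbrakk> \<Longrightarrow>
          ennreal (1 / C) * lorentz_norm p \<phi> (\<lambda>t. \<Sum>i=1..n. x i t) \<le> lorentz_norm p \<phi> (\<lambda>t. \<Sum>i=1..n. y i t)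
          \<and> lorentz_norm p \<phi> (\<lambda>t. \<Sum>i=1..n. y i t) \<le> ennreal C * lorentz_norm p \<phi> (\<lambda>t. \<Sum>i=1..n. x i t)"
    and \<alpha>: "\<And>i. i \<le> n \<Longrightarrow> 0 < \<alpha> i" "\<And>i. i < n \<Longrightarrow> 2 * \<beta> (i + 1) \<le> \<alpha> i"
    and E_def: "\<And>i. E i = {t \<in> {0..1}. \<alpha> i \<le> w t \<and> w t \<le> \<beta> i}"
    and e: "\<And>i. i \<le> n \<Longrightarrow> e \<le> measure lebesgue (E i)" "0 < e" "e \<le> 1"
    and a: "0 < a" "a \<le> e"
  defines "D \<equiv> C powr p * (prim_const\<^sup>2 * (2 * 2 powr p))"
  shows "real n * a \<le> 1" "prim (real n * a) \<le> D * (real n * prim a)" "real n * prim a \<le> D * prim (real n * a)"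
proof -
  obtain r where r: "0 < r" "r \<le> 1 / 2" "\<And>s. 0 < s \<Longrightarrow> s \<le> 1 \<Longrightarrow> \<phi> (r * s) powr p \<le> \<phi> s powr p / 2"
    using halving_ratio by blast
  \<comment> \<open>Starting at \<open>e\<close>, which is at most the measure of each level set in
    use, every lacunary measure fits into its level set.\<close>
  define b where "b i = e * r ^ i" for i :: nat
  have b_le: "b i \<le> e" for i
    using r e power_le_one[of r i] by (simp add: b_def mult_left_le)
  have b: "0 < b i" "b i \<le> 1" "b (Suc i) \<le> b i / 2" "\<phi> (b (Suc i)) powr p \<le> \<phi> (b i) powr p / 2" for i
  proof -
    show b0: "0 < b i" using r e by (simp add: b_def)
    show b1: "b i \<le> 1" using b_le[of i] e by simp
    have S: "b (Suc i) = r * b i" by (simp add: b_def)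
    show "b (Suc i) \<le> b i / 2" unfolding S using r b0 mult_right_mono[of r "1/2" "b i"] by simp
    show "\<phi> (b (Suc i)) powr p \<le> \<phi> (b i) powr p / 2" unfolding S using r(3)[OF b0 b1] .
  qed
  have E: "E i \<subseteq> {0..1}" "E i \<in> sets lebesgue" for i
    using weight_level_sets[OF w] by (auto simp: E_def)
  have \<alpha>\<beta>: "\<alpha> i \<le> \<beta> i" if "i \<le> n" for i
  proof -
    have "E i \<noteq> {}" using e(1)[OF that] e(2) by auto
    then show ?thesis by (auto simp: E_def)
  qed
  have lt: "\<beta> j < \<alpha> i" if "i < j" "j \<le> n" for i j
    using separated_intervals[of n \<alpha> \<beta>] \<alpha> \<alpha>\<beta> that by blast
  have E_disj: "disjoint_family_on E {1..n}"
    unfolding disjoint_family_on_def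
  proof (intro ballI impI)
    fix i j assume ij: "i \<in> {1..n}" "j \<in> {1..n}" "i \<noteq> j"
    then consider "i < j" | "j < i" by linarith
    then show "E i \<inter> E j = {}"
      using lt[of i j] lt[of j i] ij by cases (auto simp: E_def)
  qed
  have "\<exists>A\<subseteq>E i. A \<in> sets lebesgue \<and> measure lebesgue A = a" if "i \<in> {1..n}" for i
    using subset_of_given_measure[OF E(2,1), of a i] e(1)[of i] a that by (auto intro: order_trans)
  then obtain A where A: "\<And>i. i \<in> {1..n} \<Longrightarrow> A i \<subseteq> E i \<and> A i \<in> sets lebesgue \<and> measure lebesgue (A i) = a"
    by metis
  have "\<exists>B\<subseteq>E i. B \<in> sets lebesgue \<and> measure lebesgue B = b i" if "i \<in> {1..n}" for i
  proof -
    have "0 \<le> b i" "b i \<le> measure lebesgue (E i)"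
      using b(1)[of i] b_le[of i] e(1)[of i] that by auto
    then show ?thesis using subset_of_given_measure[OF E(2,1), of "b i" i] by metis
  qed
  then obtain B where B: "\<And>i. i \<in> {1..n} \<Longrightarrow> B i \<subseteq> E i \<and> B i \<in> sets lebesgue \<and> measure lebesgue (B i) = b i"
    by metis
  have A1: "A i \<subseteq> {0..1}" "B i \<subseteq> {0..1}" if "i \<in> {1..n}" for i using A[OF that] B[OF that] E(1)[of i] by blast+
  have A_disj: "disjoint_family_on A {1..n}" and B_disj: "disjoint_family_on B {1..n}"
    using E_disj A B unfolding disjoint_family_on_def by blast+
  \<comment> \<open>By \<open>modular_indicator\<close>, this height gives the i-th lacunary
    indicator the modular \<open>prim a\<close>.\<close>
  define c where "c i = (prim a / prim (b i)) powr (1 / p)" for i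
  have pa: "0 < prim a" using a e by (intro prim_pos) auto
  have c: "0 < c i" "c i powr p * prim (b i) = prim a" for i
    using pa prim_pos[OF b(1,2), of i] p_ge_1 by (auto simp: c_def powr_powr)
  define x where "x = (\<lambda>i t. 1 * indicator (A i) t :: real)"
  define y where "y = (\<lambda>i t. c i * indicator (B i) t :: real)"
  have Ix: "lorentz_modular p \<phi> (x i) = ennreal (prim a)" if "i \<in> {1..n}" for i
    unfolding x_def using modular_indicator[of "A i" 1] A[OF that] A1[OF that] by simp
  have Iy: "lorentz_modular p \<phi> (y i) = ennreal (prim a)" if "i \<in> {1..n}" for i
    unfolding y_def using modular_indicator[of "B i" "c i"] B[OF that] A1[OF that] c[of i] by simp
  have sup: "supp (x i) \<union> supp (y i) \<subseteq> E i" if "i \<in> {1..n}" for i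
    using A[OF that] B[OF that] by (auto simp: supp_def x_def y_def indicator_def split: if_splits)
  have 1: "\<forall>i\<in>{1..n}. x i \<in> lorentz_space p \<phi> \<and> y i \<in> lorentz_space p \<phi>
             \<and> \<not> (AE t in lebesgue_on {0..1}. x i t = 0)
             \<and> \<not> (AE t in lebesgue_on {0..1}. y i t = 0)
             \<and> lorentz_norm p \<phi> (x i) = lorentz_norm p \<phi> (y i)"
  proof (intro ballI conjI)
    fix i assume i: "i \<in> {1..n}"
    show "x i \<in> lorentz_space p \<phi>" unfolding x_def using A[OF i] A1[OF i] by (intro indicator_in_space) auto
    show "y i \<in> lorentz_space p \<phi>" unfolding y_def using B[OF i] A1[OF i] c by (intro indicator_in_space) auto
    show "\<not> (AE t in lebesgue_on {0..1}. x i t = 0)"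
      unfolding x_def using A[OF i] A1[OF i] a by (intro indicator_nonnull) auto
    show "\<not> (AE t in lebesgue_on {0..1}. y i t = 0)"
      unfolding y_def using B[OF i] A1[OF i] b c by (intro indicator_nonnull) auto
    show "lorentz_norm p \<phi> (x i) = lorentz_norm p \<phi> (y i)"
      by (simp add: lorentz_norm_modular Ix[OF i] Iy[OF i])
  qed
  have 2: "\<forall>i\<in>{1..<n}. ess_inf_on w (supp (x i) \<union> supp (y i))
             \<ge> 2 * ess_sup_on w (supp (x (i + 1)) \<union> supp (y (i + 1)))"
  proof
    fix i assume i: "i \<in> {1..<n}"
    have S: "supp (x i) \<union> supp (y i) \<subseteq> E i" "supp (x (i + 1)) \<union> supp (y (i + 1)) \<subseteq> E (i + 1)"
      using sup[of i] sup[of "i + 1"] i by auto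
    have "ess_sup_on w (supp (x (i + 1)) \<union> supp (y (i + 1))) \<le> ereal (\<beta> (i + 1))"
      using S(2) E(1)[of "i + 1"] by (intro ess_sup_on_le w) (auto simp: E_def)
    then have "2 * ess_sup_on w (supp (x (i + 1)) \<union> supp (y (i + 1))) \<le> 2 * ereal (\<beta> (i + 1))"
      by (intro ereal_mult_left_mono) auto
    also have "\<dots> \<le> ereal (\<alpha> i)" using \<alpha>(2)[of i] i by simp
    also have "\<dots> \<le> ess_inf_on w (supp (x i) \<union> supp (y i))"
      using S(1) E(1)[of i] by (intro ess_inf_on_ge w) (auto simp: E_def)
    finally show "2 * ess_sup_on w (supp (x (i + 1)) \<union> supp (y (i + 1))) \<le> ess_inf_on w (supp (x i) \<union> supp (y i))" .
  qed
  define U where "U = (\<Union>i\<in>{1..n}. A i)"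
  have U: "U \<subseteq> {0..1}" "U \<in> sets lebesgue"
    unfolding U_def using A1(1) A by (blast, intro sets.finite_UN, auto)
  have mU: "measure lebesgue U = real n * a"
  proof -
    have "measure lebesgue U = (\<Sum>i\<in>{1..n}. measure lebesgue (A i))"
      unfolding U_def
    proof (rule measure_finite_Union)
      show "emeasure lebesgue (A i) \<noteq> \<infinity>" if "i \<in> {1..n}" for i
      proof -
        have "A i \<in> lmeasurable" using A[OF that] A1[OF that] bounded_subset[of "{0..1}" "A i"]
          by (intro bounded_set_imp_lmeasurable) auto
        then show ?thesis by (auto simp: fmeasurable_def)
      qed
    qed (use A A_disj in auto)
    then show ?thesis using A by simp
  qed
  show na: "real n * a \<le> 1" using measure_unit_subset[OF U(1)] mU by simp
  have "indicat_real U t = (\<Sum>i=1..n. indicator (A i) t)" for t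
    unfolding U_def by (rule indicator_UN_disjoint[OF _ A_disj]) simp
  then have "(\<lambda>t. \<Sum>i=1..n. x i t) = (\<lambda>t. 1 * indicator U t)"
    by (simp add: x_def fun_eq_iff)
  then have Isx: "lorentz_modular p \<phi> (\<lambda>t. \<Sum>i=1..n. x i t) = ennreal (prim (real n * a))"
    using modular_indicator[OF U, of 1] mU by simp
  define Q where "Q = prim_const\<^sup>2 * (2 * 2 powr p)"
  have Q: "0 < Q" using prim_const_pos by (simp add: Q_def)
  have D: "D = C powr p * Q" by (simp add: D_def Q_def)
  have sumIy: "(\<Sum>i=1..n. lorentz_modular p \<phi> (y i)) = ennreal (real n * prim a)"
    using Iy pa by (simp add: ennreal_of_nat_eq_real_of_nat ennreal_mult[symmetric])
  have B': "B i \<subseteq> {0..1} \<and> B i \<in> sets lebesgue \<and> measure lebesgue (B i) = b i" if "i \<in> {1..n}" for i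
    using B[OF that] A1[OF that] by auto
  have y1: "lorentz_modular p \<phi> (\<lambda>t. \<Sum>i=1..n. y i t) \<le> ennreal Q * ennreal (real n * prim a)"
    unfolding sumIy[symmetric] unfolding y_def Q_def
    by (rule lacunary_modular(1)[where b = b and c = c, OF b B' B_disj c(1)])
  have y2: "ennreal (real n * prim a) \<le> ennreal Q * lorentz_modular p \<phi> (\<lambda>t. \<Sum>i=1..n. y i t)"
    unfolding sumIy[symmetric] unfolding y_def Q_def
    by (rule lacunary_modular(2)[where b = b and c = c, OF b B' B_disj c(1)])
  let ?X = "lorentz_norm p \<phi> (\<lambda>t. \<Sum>i=1..n. x i t)" and ?Y = "lorentz_norm p \<phi> (\<lambda>t. \<Sum>i=1..n. y i t)"
  have "?X = ennreal C * (ennreal (1 / C) * ?X)"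
    using C by (simp add: ennreal_mult[symmetric] flip: mult.assoc)
  also have "\<dots> \<le> ennreal C * ?Y" using dec[OF 1 2] by (intro mult_left_mono) auto
  finally have "lorentz_modular p \<phi> (\<lambda>t. \<Sum>i=1..n. x i t) \<le> ennreal (C powr p) * lorentz_modular p \<phi> (\<lambda>t. \<Sum>i=1..n. y i t)"
    using lorentz_norm_le_iff[OF p_ge_1 C] by blast
  also have "\<dots> \<le> ennreal (C powr p) * (ennreal Q * ennreal (real n * prim a))"
    using y1 by (intro mult_left_mono) auto
  also have "\<dots> = ennreal (D * (real n * prim a))"
    using Q C pa by (simp add: D ennreal_mult[symmetric])
  finally show "prim (real n * a) \<le> D * (real n * prim a)"
    unfolding Isx using Q C pa D by (subst (asm) ennreal_le_iff) auto
  have "lorentz_modular p \<phi> (\<lambda>t. \<Sum>i=1..n. y i t) \<le> ennreal (C powr p) * lorentz_modular p \<phi> (\<lambda>t. \<Sum>i=1..n. x i t)"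
    using lorentz_norm_le_iff[OF p_ge_1 C] dec[OF 1 2] by blast
  then have "ennreal Q * lorentz_modular p \<phi> (\<lambda>t. \<Sum>i=1..n. y i t) \<le> ennreal Q * (ennreal (C powr p) * ennreal (prim (real n * a)))"
    unfolding Isx by (intro mult_left_mono) auto
  also have "\<dots> = ennreal (D * prim (real n * a))"
    using Q C by (simp add: D ennreal_mult[symmetric] mult_ac)
  finally have "ennreal (real n * prim a) \<le> ennreal (D * prim (real n * a))"
    using y2 by (rule order_trans[rotated])
  then show "real n * prim a \<le> D * prim (real n * a)"
    using Q C D by (subst (asm) ennreal_le_iff) auto
qed

lemma decomposable_growth:
  assumes nt: "nontrivial_weight w"
    and dec: "w_decomposable w (lorentz_space p \<phi>) (lorentz_norm p \<phi>)"
  obtains B where "1 \<le> B" "\<And>n::nat. \<exists>d>0. \<forall>a. 0 < a \<longrightarrow> a \<le> d \<longrightarrow> real n * a \<le> 1 \<and>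
    \<phi> (real n * a) powr p \<le> B * (real n * \<phi> a powr p) \<and> real n * \<phi> a powr p \<le> B * \<phi> (real n * a) powr p"
proof -
  have w: "w \<in> borel_measurable (lebesgue_on {0..1})"
    using nt by (auto simp: nontrivial_weight_def weight_def)
  obtain C where C: "C > 0" and dec': "\<And>(n::nat) x y. \<lbrakk>\<forall>i\<in>{1..n}. x i \<in> lorentz_space p \<phi> \<and> y i \<in> lorentz_space p \<phi>
             \<and> \<not> (AE t in lebesgue_on {0..1}. x i t = 0)
             \<and> \<not> (AE t in lebesgue_on {0..1}. y i t = 0)
             \<and> lorentz_norm p \<phi> (x i) = lorentz_norm p \<phi> (y i);
             \<forall>i\<in>{1..<n}. ess_inf_on w (supp (x i) \<union> supp (y i))
             \<ge> 2 * ess_sup_on w (supp (x (i + 1)) \<union> supp (y (i + 1)))\<rbrakk> \<Longrightarrow>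
          ennreal (1 / C) * lorentz_norm p \<phi> (\<lambda>t. \<Sum>i=1..n. x i t) \<le> lorentz_norm p \<phi> (\<lambda>t. \<Sum>i=1..n. y i t)
          \<and> lorentz_norm p \<phi> (\<lambda>t. \<Sum>i=1..n. y i t) \<le> ennreal C * lorentz_norm p \<phi> (\<lambda>t. \<Sum>i=1..n. x i t)"
    using dec unfolding w_decomposable_def by auto
  define D where "D = C powr p * (prim_const\<^sup>2 * (2 * 2 powr p))"
  have D: "0 < D" using C prim_const_pos by (simp add: D_def)
  define B where "B = max 1 (prim_const\<^sup>2 * D)"
  have "\<exists>d>0. \<forall>a. 0 < a \<longrightarrow> a \<le> d \<longrightarrow> real n * a \<le> 1 \<and>
    \<phi> (real n * a) powr p \<le> B * (real n * \<phi> a powr p) \<and> real n * \<phi> a powr p \<le> B * \<phi> (real n * a) powr p" for n :: nat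
  proof -
    obtain \<alpha> \<beta> where \<alpha>: "\<And>i. i \<le> n \<Longrightarrow> 0 < \<alpha> i"
      and m: "\<And>i. i \<le> n \<Longrightarrow> 0 < measure lebesgue {t \<in> {0..1}. \<alpha> i \<le> w t \<and> w t \<le> \<beta> i}"
      and \<beta>: "\<And>i. i < n \<Longrightarrow> 2 * \<beta> (i + 1) \<le> \<alpha> i"
      using separated_level_sets[OF nt, of n] by blast
    define E where "E i = {t \<in> {0..1}. \<alpha> i \<le> w t \<and> w t \<le> \<beta> i}" for i
    \<comment> \<open>The smallest measure among the chosen level sets is the threshold on
      \<open>a\<close>, and this is where it depends on \<open>n\<close>; the entry 1 keeps
      \<open>a\<close> in the domain of \<phi>.\<close>
    define e where "e = Min (insert 1 ((\<lambda>i. measure lebesgue (E i)) ` {..n}))"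
    have e: "\<And>i. i \<le> n \<Longrightarrow> e \<le> measure lebesgue (E i)" "e \<le> 1"
      unfolding e_def by (intro Min_le; auto)+
    have "0 < measure lebesgue (E i)" if "i \<le> n" for i unfolding E_def using m[OF that] .
    then have e0: "0 < e" unfolding e_def by (subst Min_gr_iff) auto
    show ?thesis
    proof (intro exI[of _ e] conjI e0 allI impI)
      fix a assume a: "0 < a" "a \<le> e"
      note * = decomposable_growth_at[where n = n and \<alpha> = \<alpha> and \<beta> = \<beta> and E = E and e = e, OF w C dec' \<alpha> \<beta> E_def e(1) e0 e(2) a, folded D_def]
      show na: "real n * a \<le> 1" by (rule *(1))
      have n0: "0 \<le> real n * a" using a by simp
      have a01: "0 \<le> a" "a \<le> 1" using a e(2) by auto
      have "\<phi> (real n * a) powr p \<le> prim_const * prim (real n * a)" by (rule prim_lower[OF n0 na])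
      also have "\<dots> \<le> prim_const * (D * (real n * prim a))"
        using *(2) prim_const_pos by (intro mult_left_mono) auto
      also have "\<dots> \<le> prim_const * (D * (real n * (prim_const * \<phi> a powr p)))"
        using prim_const_pos D prim_upper[OF a01] by (intro mult_left_mono) auto
      also have "\<dots> = prim_const\<^sup>2 * D * (real n * \<phi> a powr p)" by (simp add: power2_eq_square)
      also have "\<dots> \<le> B * (real n * \<phi> a powr p)" by (intro mult_right_mono) (auto simp: B_def)
      finally show "\<phi> (real n * a) powr p \<le> B * (real n * \<phi> a powr p)" .
      have "real n * \<phi> a powr p \<le> real n * (prim_const * prim a)"
        using prim_lower[OF a01] by (intro mult_left_mono) auto
      also have "\<dots> = prim_const * (real n * prim a)" by simp
      also have "\<dots> \<le> prim_const * (D * prim (real n * a))"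
        using *(3) prim_const_pos by (intro mult_left_mono) auto
      also have "\<dots> \<le> prim_const * (D * (prim_const * \<phi> (real n * a) powr p))"
        using prim_const_pos D prim_upper[OF n0 na] by (intro mult_left_mono) auto
      also have "\<dots> = prim_const\<^sup>2 * D * \<phi> (real n * a) powr p" by (simp add: power2_eq_square)
      also have "\<dots> \<le> B * \<phi> (real n * a) powr p" by (intro mult_right_mono) (auto simp: B_def)
      finally show "real n * \<phi> a powr p \<le> B * \<phi> (real n * a) powr p" .
    qed
  qed
  then show ?thesis using that[of B] by (simp add: B_def)
qed

end

section \<open>Slow variation on the logarithmic scale\<close>

lemma increment_bounds:
  fixes u :: "nat \<Rightarrow> real"
  assumes "\<And>k. \<alpha> \<le> u (Suc k) - u k \<and> u (Suc k) - u k \<le> \<beta>"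
  shows "real i * \<alpha> \<le> u (k + i) - u k \<and> u (k + i) - u k \<le> real i * \<beta>"
proof (induction i)
  case (Suc i)
  then show ?case using assms[of "k + i"] by (simp add: algebra_simps)
qed simp

text \<open>Averaging the increments over consecutive blocks whose lengths tend to infinity; the block
  containing \<open>j\<close> starts at \<open>st j\<close>.\<close>

lemma slow_increments:
  fixes u :: "nat \<Rightarrow> real"
  assumes step: "\<And>k. \<alpha> \<le> u (Suc k) - u k \<and> u (Suc k) - u k \<le> \<beta>"
    and lip: "\<And>k. \<bar>u (Suc k) - u k\<bar> \<le> c"
    and far: "\<And>i. \<exists>S. \<forall>k\<ge>S. \<bar>u (k + i) - u k\<bar> \<le> c"
  obtains \<sigma> :: "nat \<Rightarrow> real" where "\<And>k. \<alpha> \<le> \<sigma> k \<and> \<sigma> k \<le> \<beta>" "\<sigma> \<longlonglongrightarrow> 0"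
    "\<And>k. \<bar>u 0 + (\<Sum>j<k. \<sigma> j) - u k\<bar> \<le> 2 * c"
proof -
  have c0: "0 \<le> c" using lip[of 0] by simp
  \<comment> \<open>A block of length \<open>h\<close> may start at \<open>s\<close> if
    \<open>u\<close> stays within \<open>c\<close> of \<open>u s\<close> along it. The cap
    \<open>h \<le> s + 1\<close> makes a longest block exist and lets block starts tend to
    infinity.\<close>
  define ok where "ok s h \<longleftrightarrow> 1 \<le> h \<and> h \<le> s + 1 \<and> (\<forall>i\<le>h. \<bar>u (s + i) - u s\<bar> \<le> c)" for s h
  define h where "h s = Max {h. ok s h}" for s
  have fin: "finite {h. ok s h}" for s
    by (rule finite_subset[of _ "{..s + 1}"]) (auto simp: ok_def)
  have "\<bar>u (s + i) - u s\<bar> \<le> c" if "i \<le> 1" for s i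
    using that lip[of s] c0 by (cases i) auto
  then have "ok s 1" for s by (auto simp: ok_def)
  then have "h s \<in> {h. ok s h}" for s
    unfolding h_def using fin by (intro Max_in) auto
  then have h1: "1 \<le> h s" "h s \<le> s + 1" and hc: "i \<le> h s \<Longrightarrow> \<bar>u (s + i) - u s\<bar> \<le> c" for s i
    by (auto simp: ok_def)
  \<comment> \<open>Length \<open>n\<close> involves only the shifts i <= n, so finitely many
    thresholds from \<open>far\<close> can be combined.\<close>
  have h_inf: "\<exists>S. \<forall>s\<ge>S. n \<le> h s" for n
  proof (cases "n = 0")
    case False
    obtain S where S: "\<And>i k. S i \<le> k \<Longrightarrow> \<bar>u (k + i) - u k\<bar> \<le> c" using far by metis
    define T where "T = Max (insert n (S ` {..n}))"
    have "ok s n" if "T \<le> s" for s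
    proof -
      have "n \<le> T" "\<And>i. i \<le> n \<Longrightarrow> S i \<le> T" unfolding T_def by (intro Max_ge; auto)+
      then have "n \<le> s" "\<And>i. i \<le> n \<Longrightarrow> S i \<le> s" using that le_trans by blast+
      then show ?thesis using S False by (simp add: ok_def)
    qed
    then have "n \<le> h s" if "T \<le> s" for s unfolding h_def using that fin by (intro Max_ge) auto
    then show ?thesis by blast
  qed simp
  \<comment> \<open>At \<open>Suc j\<close> either the block starting at \<open>st j\<close> is
    exhausted and a new one begins, or its start is kept.\<close>
  define st where "st = rec_nat 0 (\<lambda>j s. if Suc j = s + h s then Suc j else s)"
  have st: "st 0 = 0" "st (Suc j) = (if Suc j = st j + h (st j) then Suc j else st j)" for j
    by (auto simp: st_def)
  have st_le: "st j \<le> j \<and> j < st j + h (st j)" for j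
  proof (induction j)
    case 0 then show ?case using h1(1)[of 0] by (simp add: st)
  next
    case (Suc j) then show ?case using h1(1)[of "Suc j"] by (auto simp: st)
  qed
  define \<sigma> where "\<sigma> j = (u (st j + h (st j)) - u (st j)) / real (h (st j))" for j
  have hpos: "0 < real (h s)" for s using h1(1)[of s] by simp
  have "\<alpha> \<le> \<sigma> k \<and> \<sigma> k \<le> \<beta>" for k
    using increment_bounds[where u = u and \<alpha> = \<alpha> and \<beta> = \<beta>, OF step, of "h (st k)" "st k"] hpos[of "st k"]
    by (simp add: \<sigma>_def pos_le_divide_eq pos_divide_le_eq mult.commute)
  moreover have "\<sigma> \<longlonglongrightarrow> 0"
  proof (rule LIMSEQ_I)
    fix \<epsilon> :: real assume "0 < \<epsilon>"
    obtain n :: nat where n: "c / \<epsilon> < real n" using reals_Archimedean2 by blast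
    obtain S where S: "\<And>s. S \<le> s \<Longrightarrow> n \<le> h s" using h_inf by blast
    \<comment> \<open>From j < st j + h (st j) <= 2 * st j + 1 it follows that \<open>st j\<close>
      is at least \<open>S\<close>, so the block is long and its average slope, at most
      \<open>c\<close> over its length, is small.\<close>
    have "norm (\<sigma> j - 0) < \<epsilon>" if j: "2 * S + 1 \<le> j" for j
    proof -
      have "S \<le> st j" using st_le[of j] h1(2)[of "st j"] j by linarith
      then have "c / \<epsilon> < real (h (st j))" using S[of "st j"] n by linarith
      then have "c < \<epsilon> * real (h (st j))" using \<open>0 < \<epsilon>\<close> by (simp add: field_simps)
      moreover have "\<bar>u (st j + h (st j)) - u (st j)\<bar> \<le> c" by (rule hc) simp
      ultimately show ?thesis using hpos[of "st j"] by (simp add: \<sigma>_def abs_divide divide_less_eq)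
    qed
    then show "\<exists>no. \<forall>n\<ge>no. norm (\<sigma> n - 0) < \<epsilon>" by blast
  qed
  moreover have "\<bar>u 0 + (\<Sum>j<k. \<sigma> j) - u k\<bar> \<le> 2 * c" for k
  proof -
    \<comment> \<open>Complete blocks telescope, so the partial sums interpolate \<open>u\<close>
      linearly between block starts.\<close>
    have inv: "u 0 + (\<Sum>j<k. \<sigma> j) = u (st k) + (real k - real (st k)) * \<sigma> k"
    proof (induction k)
      case (Suc k)
      have "u 0 + (\<Sum>j<Suc k. \<sigma> j) = u (st k) + (real (Suc k) - real (st k)) * \<sigma> k"
        using Suc by (simp add: algebra_simps)
      also have "\<dots> = u (st (Suc k)) + (real (Suc k) - real (st (Suc k))) * \<sigma> (Suc k)"
      proof (cases "Suc k = st k + h (st k)")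
        case True
        then have "real (Suc k) - real (st k) = real (h (st k))" by simp
        then have "u (st k) + (real (Suc k) - real (st k)) * \<sigma> k = u (Suc k)"
          using hpos[of "st k"] True by (simp add: \<sigma>_def)
        moreover have "st (Suc k) = Suc k" using st(2)[of k] by (simp only: if_P[OF True])
        ultimately show ?thesis by simp
      next
        case False
        then have "st (Suc k) = st k" by (simp add: st)
        then show ?thesis by (simp add: \<sigma>_def)
      qed
      finally show ?case .
    qed (simp add: st)
    \<comment> \<open>Both the interpolant and \<open>u\<close> stay within \<open>c\<close> of the
      value at the start of the block, whence the bound \<open>2 * c\<close>.\<close>
    have "\<bar>(real k - real (st k)) * \<sigma> k\<bar> \<le> c"
    proof -
      have "\<bar>(real k - real (st k)) * \<sigma> k\<bar> \<le> real (h (st k)) * \<bar>\<sigma> k\<bar>"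
        unfolding abs_mult using st_le[of k] by (intro mult_right_mono) auto
      also have "\<dots> = \<bar>u (st k + h (st k)) - u (st k)\<bar>" using hpos[of "st k"] by (simp add: \<sigma>_def abs_divide)
      also have "\<dots> \<le> c" by (rule hc) simp
      finally show ?thesis .
    qed
    moreover have "k - st k \<le> h (st k)" using st_le[of k] by linarith
    then have "\<bar>u k - u (st k)\<bar> \<le> c"
      using hc[of "k - st k" "st k"] st_le[of k] by simp
    ultimately show ?thesis unfolding inv by linarith
  qed
  ultimately show ?thesis using that by blast
qed

text \<open>On s >= 0 this is the integral from 0 to s of the step function equal to
  \<open>\<sigma> j\<close> on [j, j + 1).\<close>

definition polygon :: "(nat \<Rightarrow> real) \<Rightarrow> real \<Rightarrow> real" where
  "polygon \<sigma> s = (\<Sum>j<nat \<lfloor>s\<rfloor>. \<sigma> j) + \<sigma> (nat \<lfloor>s\<rfloor>) * (s - real (nat \<lfloor>s\<rfloor>))"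

text \<open>The increment splits into two partial steps and the full steps between them. With
  \<open>N = 0\<close> this yields quasi-concavity later, with large \<open>N\<close> and small
  slopes it yields slow variation.\<close>

lemma polygon_slope:
  assumes \<sigma>: "\<And>j. N \<le> j \<Longrightarrow> \<alpha> \<le> \<sigma> j \<and> \<sigma> j \<le> \<beta>" and s: "real N \<le> s" "s \<le> s'"
  shows "\<alpha> * (s' - s) \<le> polygon \<sigma> s' - polygon \<sigma> s \<and> polygon \<sigma> s' - polygon \<sigma> s \<le> \<beta> * (s' - s)"
proof -
  define j k where "j = nat \<lfloor>s\<rfloor>" and "k = nat \<lfloor>s'\<rfloor>"
  have j: "N \<le> j" "real j \<le> s" "s < real j + 1" and k: "real k \<le> s'" "s' < real k + 1"
    using s unfolding j_def k_def by (auto simp: le_nat_floor)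
  have "j \<le> k" unfolding j_def k_def using s by (intro nat_mono floor_mono)
  have *: "\<alpha> * d \<le> \<sigma> i * d \<and> \<sigma> i * d \<le> \<beta> * d" if "N \<le> i" "0 \<le> d" for i d
    using \<sigma>[OF that(1)] that(2) by (auto intro: mult_right_mono)
  show ?thesis
  proof (cases "j = k")
    case True
    then have "polygon \<sigma> s' - polygon \<sigma> s = \<sigma> j * (s' - s)"
      by (simp add: polygon_def j_def[symmetric] k_def[symmetric] algebra_simps)
    then show ?thesis using *[of j "s' - s"] j s by simp
  next
    case False
    then have jk: "Suc j \<le> k" using \<open>j \<le> k\<close> by simp
    have "(\<Sum>i<k. \<sigma> i) = (\<Sum>i<Suc j. \<sigma> i) + (\<Sum>i\<in>{Suc j..<k}. \<sigma> i)"
      using sum.atLeastLessThan_concat[of 0 "Suc j" k \<sigma>] jk by (simp add: atLeast0LessThan)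
    then have "polygon \<sigma> s' - polygon \<sigma> s = \<sigma> j * (real j + 1 - s) + (\<Sum>i\<in>{Suc j..<k}. \<sigma> i) + \<sigma> k * (s' - real k)"
      by (simp add: polygon_def j_def[symmetric] k_def[symmetric] algebra_simps)
    moreover have "\<alpha> * (real k - real (Suc j)) \<le> (\<Sum>i\<in>{Suc j..<k}. \<sigma> i)" "(\<Sum>i\<in>{Suc j..<k}. \<sigma> i) \<le> \<beta> * (real k - real (Suc j))"
      using sum_bounded_below[of "{Suc j..<k}" \<alpha> \<sigma>] sum_bounded_above[of "{Suc j..<k}" \<sigma> \<beta>] \<sigma> j jk
      by (auto simp: of_nat_diff mult.commute)
    moreover have "\<alpha> * (real j + 1 - s) \<le> \<sigma> j * (real j + 1 - s)" "\<sigma> j * (real j + 1 - s) \<le> \<beta> * (real j + 1 - s)"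
      using *[of j "real j + 1 - s"] j by auto
    moreover have "\<alpha> * (s' - real k) \<le> \<sigma> k * (s' - real k)" "\<sigma> k * (s' - real k) \<le> \<beta> * (s' - real k)"
      using *[of k "s' - real k"] j k \<open>j \<le> k\<close> by auto
    moreover have "s' - s = (real j + 1 - s) + (real k - real (Suc j)) + (s' - real k)" by simp
    ultimately show ?thesis by (simp only: distrib_left) linarith
  qed
qed

lemma polygon_of_nat: "polygon \<sigma> (real k) = (\<Sum>j<k. \<sigma> j)"
  by (simp add: polygon_def)

lemma polygon_slowly_varying:
  assumes "\<sigma> \<longlonglongrightarrow> 0"
  shows "((\<lambda>s. polygon \<sigma> (s - d) - polygon \<sigma> s) \<longlongrightarrow> 0) at_top"
proof (rule tendstoI)
  fix e :: real assume "0 < e"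
  define \<delta> where "\<delta> = e / (\<bar>d\<bar> + 1)"
  have \<delta>: "0 < \<delta>" using \<open>0 < e\<close> by (simp add: \<delta>_def)
  obtain N where N: "\<And>j. N \<le> j \<Longrightarrow> norm (\<sigma> j - 0) < \<delta>"
    using LIMSEQ_D[OF assms \<delta>] by blast
  have \<sigma>: "- \<delta> \<le> \<sigma> j \<and> \<sigma> j \<le> \<delta>" if "N \<le> j" for j using N[OF that] by auto
  have bd: "\<bar>polygon \<sigma> s' - polygon \<sigma> s\<bar> \<le> \<delta> * (s' - s)" if "real N \<le> s" "s \<le> s'" for s s'
    using polygon_slope[of N "- \<delta>" \<sigma> \<delta>, OF \<sigma> that] by auto
  have *: "\<bar>polygon \<sigma> (s - d) - polygon \<sigma> s\<bar> < e" if s: "real N + \<bar>d\<bar> \<le> s" for s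
  proof -
    have "\<bar>polygon \<sigma> (s - d) - polygon \<sigma> s\<bar> \<le> \<delta> * \<bar>d\<bar>"
      using bd[of s "s - d"] bd[of "s - d" s] s by (cases "0 \<le> d") (auto simp: abs_minus_commute)
    also have "\<dots> < \<delta> * (\<bar>d\<bar> + 1)" using \<delta> by simp
    also have "\<dots> = e" by (simp add: \<delta>_def)
    finally show ?thesis .
  qed
  show "\<forall>\<^sub>F s in at_top. dist (polygon \<sigma> (s - d) - polygon \<sigma> s) 0 < e"
    using eventually_ge_at_top[of "real N + \<bar>d\<bar>"] by eventually_elim (use * in auto)
qed

context fundamental_function
begin

lemma regularly_varying_if_growth:
  assumes B: "1 \<le> B"
    and growth: "\<And>n::nat. \<exists>d>0. \<forall>a. 0 < a \<longrightarrow> a \<le> d \<longrightarrow> real n * a \<le> 1 \<and>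
      \<phi> (real n * a) powr p \<le> B * (real n * \<phi> a powr p) \<and> real n * \<phi> a powr p \<le> B * \<phi> (real n * a) powr p"
  shows "\<exists>\<psi>. quasi_concave \<psi> \<and> regularly_varying_at_zero \<psi> p \<and> equivalent_on_unit \<phi> \<psi>"
proof -
  define l where "l = ln (2::real)"
  have l: "0 < l" by (simp add: l_def)
  define F where "F s = ln (\<phi> (2 powr - s))" for s :: real
  \<comment> \<open>At t = 2^(-s) this is ln(\<phi>(t) / t^(1/p)). Regular variation of order p
    means that its increments over any fixed distance tend to 0; the growth condition merely bounds
    them.\<close>
  define u where "u s = F s + s * (l / p)" for s :: real
  \<comment> \<open>\<open>ln B / p\<close> bounds distant increments of any length,
    \<open>l\<close> bounds single steps; the sum serves for both.\<close>
  define c where "c = ln B / p + l"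
  have lp: "0 < l / p" "l / p \<le> l" using l p_ge_1 by (auto simp: divide_le_eq_1 field_simps)
  have c: "l \<le> c" "ln B / p \<le> c" using B p_ge_1 l by (auto simp: c_def)
  have z: "0 < 2 powr - s" "2 powr - s \<le> (1::real)" if "0 \<le> s" for s :: real
    using that powr_mono[of "- s" 0 "2::real"] by auto
  have F_slope: "F s' \<le> F s \<and> F s \<le> F s' + (s' - s) * l" if s: "0 \<le> s" "s \<le> s'" for s s'
  proof
    have le: "2 powr - s' \<le> (2::real) powr - s" using s by (intro powr_mono) auto
    have pos: "0 < \<phi> (2 powr - s)" "0 < \<phi> (2 powr - s')" using z[of s] z[of s'] s by (auto intro: pos)
    show "F s' \<le> F s"
      unfolding F_def using mono[OF _ le] z[of s] s pos by (subst ln_le_cancel_iff) auto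
    have "\<phi> (2 powr - s) \<le> 2 powr (s' - s) * \<phi> (2 powr - s')"
      using quotient_antimono[OF _ le] z[of s] z[of s'] s
      by (simp add: powr_diff powr_minus field_simps)
    then have "ln (\<phi> (2 powr - s)) \<le> ln (2 powr (s' - s) * \<phi> (2 powr - s'))"
      using pos by (subst ln_le_cancel_iff) auto
    also have "\<dots> = (s' - s) * l + ln (\<phi> (2 powr - s'))"
      using pos by (simp add: ln_mult ln_powr l_def)
    finally show "F s \<le> F s' + (s' - s) * l" by (simp add: F_def)
  qed
  have far: "\<exists>S. \<forall>k\<ge>S. \<bar>u (real (k + i)) - u (real k)\<bar> \<le> c" for i :: nat
  proof -
    \<comment> \<open>With n = 2^i, multiplication by n becomes a shift by the integer i on the
      logarithmic scale.\<close>
    obtain d where d: "0 < d" "\<And>a. 0 < a \<Longrightarrow> a \<le> d \<Longrightarrow> real (2 ^ i) * a \<le> 1 \<and>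
      \<phi> (real (2 ^ i) * a) powr p \<le> B * (real (2 ^ i) * \<phi> a powr p) \<and> real (2 ^ i) * \<phi> a powr p \<le> B * \<phi> (real (2 ^ i) * a) powr p"
      using growth[of "2 ^ i"] by blast
    obtain S :: nat where S: "(1 / 2) ^ S < d" using real_arch_pow_inv[of d "1/2"] d(1) by auto
    have "\<bar>u (real (k + i)) - u (real k)\<bar> \<le> c" if k: "S \<le> k" for k
    proof -
      define a where "a = 2 powr - real (k + i)"
      have a0: "0 < a" by (simp add: a_def)
      have "a = (1 / 2) ^ (k + i)"
        unfolding a_def by (simp only: powr_minus powr_realpow zero_less_numeral) (simp add: power_one_over inverse_eq_divide)
      also have "\<dots> \<le> (1 / 2) ^ S" using k by (intro power_decreasing) auto
      finally have ad: "a \<le> d" using S by simp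
      have na: "real (2 ^ i) * a = 2 powr - real k"
      proof -
        have "real (2 ^ i) = 2 powr real i" by (simp add: powr_realpow)
        then show ?thesis by (simp add: a_def powr_add[symmetric])
      qed
      have pos: "0 < \<phi> a" "0 < \<phi> (2 powr - real k)"
        using z[of "real (k + i)"] z[of "real k"] by (auto simp: a_def intro: pos)
      note g = d(2)[OF a0 ad, unfolded na]
      have Fa: "F (real (k + i)) = ln (\<phi> a)" by (simp add: F_def a_def)
      have Fk: "F (real k) = ln (\<phi> (2 powr - real k))" by (simp add: F_def)
      have ln1: "ln (real (2 ^ i)) = real i * l" by (simp add: l_def ln_realpow)
      have "ln (\<phi> (2 powr - real k) powr p) \<le> ln (B * (real (2 ^ i) * \<phi> a powr p))"
        using g pos B by (subst ln_le_cancel_iff) auto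
      also have "\<dots> = ln B + (ln (real (2 ^ i)) + ln (\<phi> a powr p))"
        using pos B by (simp add: ln_mult)
      finally have 1: "p * F (real k) \<le> ln B + (real i * l + p * F (real (k + i)))"
        unfolding Fa Fk using pos ln1 by (simp add: ln_powr)
      have "ln (real (2 ^ i) * \<phi> a powr p) \<le> ln (B * \<phi> (2 powr - real k) powr p)"
        using g pos B by (subst ln_le_cancel_iff) auto
      also have "ln (real (2 ^ i) * \<phi> a powr p) = ln (real (2 ^ i)) + ln (\<phi> a powr p)"
        using pos by (simp add: ln_mult)
      also have "ln (B * \<phi> (2 powr - real k) powr p) = ln B + ln (\<phi> (2 powr - real k) powr p)"
        using pos B by (simp add: ln_mult)
      finally have 2: "real i * l + p * F (real (k + i)) \<le> ln B + p * F (real k)"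
        unfolding Fa Fk using pos ln1 by (simp add: ln_powr)
      have "p * (u (real (k + i)) - u (real k)) = p * F (real (k + i)) - p * F (real k) + real i * l"
        using p_ge_1 by (simp add: u_def field_simps)
      then have "\<bar>p * (u (real (k + i)) - u (real k))\<bar> \<le> ln B" using 1 2 by linarith
      then have "\<bar>u (real (k + i)) - u (real k)\<bar> \<le> ln B / p"
        using p_ge_1 by (simp add: abs_mult pos_le_divide_eq mult.commute)
      then show ?thesis using c(2) by simp
    qed
    then show ?thesis by blast
  qed
  \<comment> \<open>The slopes of \<open>F\<close> lie between -l and 0. Averaging preserves the
    corresponding bounds for \<open>u\<close>, so they pass on to \<sigma>.\<close>
  have step: "l / p - l \<le> u (real (Suc k)) - u (real k) \<and> u (real (Suc k)) - u (real k) \<le> l / p" for k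
    using F_slope[of "real k" "real (Suc k)"] by (simp add: u_def algebra_simps add_divide_distrib)
  have lip: "\<bar>u (real (Suc k)) - u (real k)\<bar> \<le> c" for k using step[of k] lp c by (simp only: abs_le_iff) linarith
  obtain \<sigma> where \<sigma>: "\<And>k. l / p - l \<le> \<sigma> k \<and> \<sigma> k \<le> l / p" "\<sigma> \<longlonglongrightarrow> 0"
    "\<And>k. \<bar>u (real 0) + (\<Sum>j<k. \<sigma> j) - u (real k)\<bar> \<le> 2 * c"
    by (rule slow_increments[where u = "\<lambda>k. u (real k)", OF step lip far]) blast
  \<comment> \<open>Slopes of \<open>G\<close> between -l and 0 say exactly that \<psi>(t) is
    non-decreasing and \<psi>(t)/t non-increasing.\<close>
  define G where "G s = u 0 + polygon \<sigma> s - s * (l / p)" for s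
  have G_slope: "G s' \<le> G s \<and> G s \<le> G s' + (s' - s) * l" if "0 \<le> s" "s \<le> s'" for s s'
    using polygon_slope[of 0 "l / p - l" \<sigma> "l / p" s s'] \<sigma>(1) that by (simp add: G_def algebra_simps diff_divide_distrib)
  \<comment> \<open>At integers the distance is at most \<open>2 * c\<close> by
    \<open>slow_increments\<close>; moving to the integer part of \<open>s\<close> costs
    \<open>l\<close> for each of the two functions.\<close>
  have FG: "\<bar>F s - G s\<bar> \<le> 2 * c + 2 * l" if s: "0 \<le> s" for s
  proof -
    define k where "k = nat \<lfloor>s\<rfloor>"
    have k: "real k \<le> s" "s \<le> real k + 1" using s unfolding k_def by (auto simp: le_nat_floor)
    have d: "0 \<le> s - real k" "(s - real k) * l \<le> l" using k l by (auto simp: mult_left_le_one_le)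
    have "\<bar>F (real k) - G (real k)\<bar> \<le> 2 * c"
      using \<sigma>(3)[of k] by (simp add: G_def u_def polygon_of_nat abs_minus_commute algebra_simps)
    moreover have "\<bar>F s - F (real k)\<bar> \<le> l" using F_slope[of "real k" s] k d by linarith
    moreover have "\<bar>G s - G (real k)\<bar> \<le> l" using G_slope[of "real k" s] k d by linarith
    ultimately show ?thesis by linarith
  qed
  define L where "L t = - ln t / l" for t :: real
  have L_mono: "L t' \<le> L t" if "0 < t" "t \<le> t'" for t t'
    using that l by (simp add: L_def divide_right_mono)
  have L0: "0 \<le> L t" if "0 < t" "t \<le> 1" for t using that l by (simp add: L_def divide_le_0_iff)
  have Lp: "2 powr - L t = t" if "0 < t" for t using that l by (simp add: L_def powr_def l_def)
  have Ll: "L t * l = - ln t" for t using l by (simp add: L_def)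
  define \<psi> where "\<psi> t = (if t \<le> 0 then 0 else exp (G (L t)))" for t
  have \<phi>F: "\<phi> t = exp (F (L t))" if "0 < t" "t \<le> 1" for t
    using pos[OF that] Lp[OF that(1)] by (simp add: F_def)
  have "quasi_concave \<psi>"
    unfolding quasi_concave_def
  proof (intro conjI ballI monotone_onI)
    fix t t' :: real assume t: "t \<in> {0..1}" "t' \<in> {0..1}" "t \<le> t'"
    show "\<psi> t \<le> \<psi> t'"
    proof (cases "t = 0")
      case False
      then show ?thesis using t G_slope[of "L t'" "L t"] L_mono[of t t'] L0[of t'] by (simp add: \<psi>_def)
    qed (simp add: \<psi>_def)
  next
    fix t t' :: real assume t: "t \<in> {0<..1}" "t' \<in> {0<..1}" "t \<le> t'"
    have eq: "\<psi> t / t = exp (G (L t) + L t * l)" if "0 < t" for t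
      using that by (simp add: \<psi>_def Ll exp_diff)
    have "G (L t') + L t' * l \<le> G (L t) + L t * l"
      using t G_slope[of "L t'" "L t"] L_mono[of t t'] L0[of t'] by (simp add: algebra_simps)
    then show "\<psi> t' / t' \<le> \<psi> t / t" using t eq by simp
  qed (auto simp: \<psi>_def)
  moreover have "regularly_varying_at_zero \<psi> p"
    unfolding regularly_varying_at_zero_def
  proof (intro allI impI)
    fix v :: real assume v: "0 < v"
    have "filterlim L at_top (at_right 0)"
    proof -
      have "filterlim (\<lambda>t::real. - ln t) at_top (at_right 0)"
        using ln_at_0 by (simp add: filterlim_uminus_at_top)
      from filterlim_tendsto_pos_mult_at_top[OF tendsto_const[of "1 / l"] _ this]
      show ?thesis using l by (simp add: L_def[abs_def])
    qed
    \<comment> \<open>Multiplying t by v shifts \<open>L t\<close> by \<open>ln v / l\<close>. The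
      linear part of \<open>G\<close> then contributes exactly the factor v^(1/p), while the polygon
      part tends to 0.\<close>
    from filterlim_compose[OF polygon_slowly_varying[OF \<sigma>(2), of "ln v / l"] this]
    have "((\<lambda>t. exp ((polygon \<sigma> (L t - ln v / l) - polygon \<sigma> (L t)) + ln v / p)) \<longlongrightarrow> exp (0 + ln v / p)) (at_right 0)"
      by (intro tendsto_intros)
    moreover have "exp (0 + ln v / p) = v powr (1 / p)" using v by (simp add: powr_def)
    moreover have "\<forall>\<^sub>F t in at_right 0. exp ((polygon \<sigma> (L t - ln v / l) - polygon \<sigma> (L t)) + ln v / p) = \<psi> (t * v) / \<psi> t"
      using eventually_at_right_less[of 0]
    proof eventually_elim
      case (elim t)
      have Ltv: "L (t * v) = L t - ln v / l" using elim v l by (simp add: L_def ln_mult field_simps)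
      have "(L t - ln v / l) * (l / p) = L t * (l / p) - ln v / p" using l by (simp add: left_diff_distrib diff_divide_distrib)
      then have "G (L (t * v)) - G (L t) = (polygon \<sigma> (L t - ln v / l) - polygon \<sigma> (L t)) + ln v / p"
        unfolding Ltv G_def by linarith
      then show ?case using elim v by (simp add: \<psi>_def exp_diff[symmetric] not_le)
    qed
    ultimately show "((\<lambda>t. \<psi> (t * v) / \<psi> t) \<longlongrightarrow> v powr (1 / p)) (at_right 0)"
      by (simp only: tendsto_cong)
  qed
  moreover have "equivalent_on_unit \<phi> \<psi>"
    unfolding equivalent_on_unit_def
  proof (intro exI[of _ "exp (2 * c + 2 * l)"] conjI ballI)
    fix t :: real assume t: "t \<in> {0..1}"
    show "\<phi> t \<le> exp (2 * c + 2 * l) * \<psi> t"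
      using t zero \<phi>F[of t] FG[of "L t"] L0[of t]
      by (cases "t = 0") (auto simp: \<psi>_def exp_add[symmetric])
    show "\<psi> t \<le> exp (2 * c + 2 * l) * \<phi> t"
      using t zero \<phi>F[of t] FG[of "L t"] L0[of t]
      by (cases "t = 0") (auto simp: \<psi>_def exp_add[symmetric])
  qed simp
  ultimately show ?thesis by blast
qed

end

section \<open>The lower dilation index\<close>

lemma concave_quotient_antimono:
  fixes \<phi> :: "real \<Rightarrow> real"
  assumes "concave_on {0..1} \<phi>" "\<phi> 0 = 0" "0 < s" "s \<le> t" "t \<le> 1"
  shows "\<phi> t / t \<le> \<phi> s / s"
proof -
  have "(1 - s / t) * \<phi> 0 + (s / t) * \<phi> t \<le> \<phi> ((1 - s / t) *\<^sub>R 0 + (s / t) *\<^sub>R t)"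
    using assms by (intro concave_onD[OF assms(1)]) auto
  then show ?thesis using assms by (simp add: field_simps)
qed

text \<open>If the dilation function never drops below 1, or \<open>\<phi>\<close> vanishes, the quotient defining the index is
  identically 0; so the existence of the limit in general is not needed.\<close>

lemma positive_index_contraction:
  assumes mono: "mono_on {0..1} \<phi>" and conc: "concave_on {0..1} \<phi>" and zero: "\<phi> 0 = 0"
    and ind: "lower_dilation_index \<phi> > 0"
  obtains \<tau> q where "\<And>t. 0 < t \<Longrightarrow> t \<le> 1 \<Longrightarrow> 0 < \<phi> t" "0 < \<tau>" "\<tau> < 1" "0 < q" "q < 1"
    "\<And>s. 0 < s \<Longrightarrow> s \<le> 1 \<Longrightarrow> \<phi> (s * \<tau>) \<le> q * \<phi> s"
proof -
  have mon: "\<phi> s \<le> \<phi> t" if "0 \<le> s" "s \<le> t" "t \<le> 1" for s t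
    using mono_onD[OF mono, of s t] that by simp
  have index_zero: "\<not> (\<forall>\<^sub>F t in at_right 0. ln (dilation_function \<phi> t) = 0)"
  proof
    assume "\<forall>\<^sub>F t in at_right 0. ln (dilation_function \<phi> t) = 0"
    then have "\<forall>\<^sub>F t in at_right 0. ln (dilation_function \<phi> t) / ln t = 0"
      by eventually_elim simp
    then have "lower_dilation_index \<phi> = 0"
      unfolding lower_dilation_index_def by (intro tendsto_Lim tendsto_eventually) auto
    then show False using ind by simp
  qed
  have ev: "\<forall>\<^sub>F t in at_right (0::real). 0 < t \<and> t < 1"
    by (auto simp: eventually_at_right_field intro: exI[of _ 1])
  have set: "{s. s \<in> {0<..1} \<and> s * t \<in> {0<..1}} = {0<..1}" if "0 < t" "t < 1" for t :: real
    using that by (auto intro: mult_le_one)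
  have "\<phi> 1 \<noteq> 0"
  proof
    assume "\<phi> 1 = 0"
    then have z: "\<phi> t = 0" if "0 \<le> t" "t \<le> 1" for t
      using mon[of 0 t] mon[of t 1] that zero by simp
    have "dilation_function \<phi> t = 0" if "0 < t \<and> t < 1" for t
    proof -
      have "dilation_function \<phi> t = (SUP s\<in>{0<..1::real}. (0::real))"
        unfolding dilation_function_def set[OF conjunct1[OF that] conjunct2[OF that]]
        by (intro SUP_cong) (auto simp: z)
      then show ?thesis by simp
    qed
    then have "\<forall>\<^sub>F t in at_right 0. ln (dilation_function \<phi> t) = 0"
      using ev by (auto elim!: eventually_mono)
    then show False using index_zero by simp
  qed
  then have \<phi>1: "0 < \<phi> 1" using mon[of 0 1] zero by simp
  have pos: "0 < \<phi> t" if "0 < t" "t \<le> 1" for t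
  proof -
    have "\<phi> 1 \<le> \<phi> t / t" using concave_quotient_antimono[OF conc zero, of t 1] that by simp
    then have "0 < \<phi> t / t" using \<phi>1 by linarith
    then show ?thesis using that by (simp add: zero_less_divide_iff)
  qed
  have ratio_le: "\<phi> (s * t) / \<phi> s \<le> 1" if "0 < t" "t < 1" "s \<in> {0<..1}" for s t
    using mon[of "s * t" s] pos[of s] that by (simp add: mult_left_le)
  have bdd: "bdd_above ((\<lambda>s. \<phi> (s * t) / \<phi> s) ` {0<..1})" if "0 < t" "t < 1" for t
    using ratio_le that by (intro bdd_aboveI[of _ 1]) auto
  have dil_le: "dilation_function \<phi> t \<le> 1" if "0 < t" "t < 1" for t
    unfolding dilation_function_def set[OF that] using ratio_le that by (intro cSUP_least) auto
  have "\<exists>t. 0 < t \<and> t < 1 \<and> dilation_function \<phi> t < 1"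
  proof (rule ccontr)
    assume "\<not> ?thesis"
    then have "dilation_function \<phi> t = 1" if "0 < t \<and> t < 1" for t
      using that dil_le[of t] by force
    then have "\<forall>\<^sub>F t in at_right 0. ln (dilation_function \<phi> t) = 0"
      using ev by (auto elim!: eventually_mono)
    then show False using index_zero by simp
  qed
  then obtain \<tau> where \<tau>: "0 < \<tau>" "\<tau> < 1" "dilation_function \<phi> \<tau> < 1" by blast
  define q where "q = dilation_function \<phi> \<tau>"
  have q: "\<phi> (s * \<tau>) / \<phi> s \<le> q" if "0 < s" "s \<le> 1" for s
    unfolding q_def dilation_function_def set[OF \<tau>(1,2)] using that by (intro cSUP_upper bdd \<tau>) auto
  have "0 < \<phi> (1 * \<tau>) / \<phi> 1" using pos[of \<tau>] \<phi>1 \<tau> by simp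
  then have "0 < q" using q[of 1] by linarith
  moreover have "\<phi> (s * \<tau>) \<le> q * \<phi> s" if "0 < s" "s \<le> 1" for s
    using q[OF that] pos[OF that] by (simp add: field_simps)
  ultimately show ?thesis using that[of \<tau> q] pos \<tau> by (simp add: q_def)
qed

text \<open>Iterating the contraction gives geometric decay along powers of \<tau>, and \<gamma> is
  the exponent with \<open>\<tau> powr \<gamma> = q\<close>. The constant \<open>1 / q\<close> pays
  for rounding \<open>s / t\<close> up to a power of \<tau>.\<close>

lemma fundamental_functionI:
  assumes mono: "mono_on {0..1} \<phi>" and conc: "concave_on {0..1} \<phi>" and zero: "\<phi> 0 = 0"
    and ind: "lower_dilation_index \<phi> > 0" and p: "1 \<le> p"
  obtains K \<gamma> where "fundamental_function \<phi> p K \<gamma>"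
proof -
  obtain \<tau> q where pos: "\<And>t. 0 < t \<Longrightarrow> t \<le> 1 \<Longrightarrow> 0 < \<phi> t" and \<tau>: "0 < \<tau>" "\<tau> < 1" and q: "0 < q" "q < 1"
    and contr: "\<And>s. 0 < s \<Longrightarrow> s \<le> 1 \<Longrightarrow> \<phi> (s * \<tau>) \<le> q * \<phi> s"
    using positive_index_contraction[OF mono conc zero ind] by blast
  have mon: "\<phi> s \<le> \<phi> t" if "0 \<le> s" "s \<le> t" "t \<le> 1" for s t
    using mono_onD[OF mono, of s t] that by simp
  have iter: "\<phi> (t * \<tau> ^ j) \<le> q ^ j * \<phi> t" if t: "0 < t" "t \<le> 1" for t j
  proof (induction j)
    case (Suc j)
    have "t * \<tau> ^ j \<le> 1" using t \<tau> by (intro mult_le_one power_le_one) auto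
    then have "\<phi> (t * \<tau> ^ j * \<tau>) \<le> q * \<phi> (t * \<tau> ^ j)" using t \<tau> by (intro contr) auto
    also have "\<dots> \<le> q * (q ^ j * \<phi> t)" using Suc q by (intro mult_left_mono) auto
    finally show ?case by (simp add: mult_ac)
  qed simp
  define \<gamma> where "\<gamma> = ln q / ln \<tau>"
  have \<gamma>: "0 < \<gamma>" using q \<tau> by (simp add: \<gamma>_def divide_neg_neg)
  have \<tau>\<gamma>: "\<tau> powr \<gamma> = q" using q \<tau> by (simp add: powr_def \<gamma>_def)
  have decay: "\<phi> s \<le> 1 / q * (s / t) powr \<gamma> * \<phi> t" if st: "0 < s" "s \<le> t" "t \<le> 1" for s t
  proof -
    obtain n where n: "\<tau> ^ n < s / t" using real_arch_pow_inv[of "s / t" \<tau>] \<tau> st by auto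
    define k where "k = (LEAST n. \<tau> ^ n < s / t)"
    have k: "\<tau> ^ k < s / t" unfolding k_def using n by (rule LeastI)
    then have "k \<noteq> 0" using st by (auto intro: ccontr)
    then obtain j where j: "k = Suc j" using not0_implies_Suc by blast
    have "\<not> \<tau> ^ j < s / t" using not_less_Least[of j "\<lambda>n. \<tau> ^ n < s / t"] j by (simp add: k_def)
    then have "s \<le> t * \<tau> ^ j" using st by (simp add: field_simps)
    then have "\<phi> s \<le> \<phi> (t * \<tau> ^ j)" using st \<tau> by (intro mon mult_le_one power_le_one) auto
    also have "\<dots> \<le> q ^ j * \<phi> t" using iter[of t j] st by simp
    also have "q ^ j = 1 / q * (\<tau> ^ k) powr \<gamma>"
    proof -
      have "(\<tau> ^ k) powr \<gamma> = q ^ k"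
        using \<tau> by (simp add: \<tau>\<gamma>[symmetric] powr_realpow[symmetric] powr_powr mult.commute)
      then show ?thesis using q j by simp
    qed
    also have "1 / q * (\<tau> ^ k) powr \<gamma> * \<phi> t \<le> 1 / q * (s / t) powr \<gamma> * \<phi> t"
      using k \<tau> \<gamma> q st pos[of t] by (intro mult_right_mono mult_left_mono powr_mono2) auto
    finally show ?thesis .
  qed
  have "fundamental_function \<phi> p (1 / q) \<gamma>"
  proof
    show "\<phi> t / t \<le> \<phi> s / s" if "0 < s" "s \<le> t" "t \<le> 1" for s t
      using concave_quotient_antimono[OF conc zero that] .
  qed (use p q \<gamma> mon zero pos decay in auto)
  then show ?thesis by (rule that)
qed

theorem theorem4p4:
  fixes \<phi> :: "real \<Rightarrow> real" and p :: real
  assumes "mono_on {0..1} \<phi>"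
    and "concave_on {0..1} \<phi>"
    and "\<phi> 0 = 0"
    and "lower_dilation_index \<phi> > 0"
    and "1 \<le> p"
  shows "(\<exists>w. nontrivial_weight w \<and> w_decomposable w (lorentz_space p \<phi>) (lorentz_norm p \<phi>))
     \<longleftrightarrow> (\<exists>\<psi>. quasi_concave \<psi> \<and> regularly_varying_at_zero \<psi> p \<and> equivalent_on_unit \<phi> \<psi>)"
proof -
  obtain K \<gamma> where "fundamental_function \<phi> p K \<gamma>"
    using fundamental_functionI[OF assms] by blast
  then interpret fundamental_function \<phi> p K \<gamma> .
  show ?thesis
  proof
    assume "\<exists>w. nontrivial_weight w \<and> w_decomposable w (lorentz_space p \<phi>) (lorentz_norm p \<phi>)"
    then obtain w where "nontrivial_weight w" "w_decomposable w (lorentz_space p \<phi>) (lorentz_norm p \<phi>)"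
      by blast
    then show "\<exists>\<psi>. quasi_concave \<psi> \<and> regularly_varying_at_zero \<psi> p \<and> equivalent_on_unit \<phi> \<psi>"
      by (rule decomposable_growth) (rule regularly_varying_if_growth)
  next
    assume "\<exists>\<psi>. quasi_concave \<psi> \<and> regularly_varying_at_zero \<psi> p \<and> equivalent_on_unit \<phi> \<psi>"
    then show "\<exists>w. nontrivial_weight w \<and> w_decomposable w (lorentz_space p \<phi>) (lorentz_norm p \<phi>)"
      using decomposable_if_regularly_varying by blast
  qed
qed

end
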